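(* Let $1<p<\infty$, let $\mathbf{y}=(y_j)_{j\in\mathbb{Z}}\in\ell_p(\mathbb{Z})$, and fix $\alpha\in(-\infty,-3/2)\cup\big([1/2,\infty)\setminus\mathbb{N}\big)$. Then $$\lim_{c\to\infty}\|\mathscr{I}_{\alpha,c}\mathbf{y}-\mathcal{W}\mathbf{y}\|_{L_p(\mathbb{R})}=0.$$
   Context: The Whittaker operator is $\mathcal{W}\mathbf{y}(x)=\sum_{j\in\mathbb{Z}}y_j\frac{\sin(\pi(x-j))}{\pi(x-j)}$, $x\in\mathbb{R}$ (the quotient being $1$ at $x=j$); it is bounded from $\ell_p(\mathbb{Z})$ to $L_p(\mathbb{R})$ for $1<p<\infty$. For $c>0$ and $\alpha\in\mathbb{R}\setminus\{0,1,2,\dots\}$, the one-dimensional general multiquadric $\phi_{\alpha,c}(x)=(x^2+c^2)^\alpha$ has generalized Fourier transform $$\widehat{\phi}_{\alpha,c}(\xi)=\frac{2^{1+\alpha}}{\Gamma(-\alpha)}\Big(\frac{c}{|\xi|}\Big)^{\alpha+\frac12}K_{\alpha+\frac12}(c|\xi|),\quad \xi\neq 0,$$ where $K_\nu=K_{-\nu}$ is the modified Bessel function of the second kind. Set $$\widehat{L}_{\alpha,c}(\xi)=\frac{\widehat{\phi}_{\alpha,c}(\xi)}{\sum_{j\in\mathbb{Z}}\widehat{\phi}_{\alpha,c}(\xi+2\pi j)},\quad\xi\in\mathbb{R}$$ (extended by continuity to $\xi\in2\pi\mathbb{Z}$). This is in $L_1(\mathbb{R})$, and the fundamental function is $L_{\alpha,c}(x)=\frac1{2\pi}\int_{\mathbb{R}}\widehat{L}_{\alpha,c}(\xi)e^{ix\xi}d\xi$.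 The cardinal interpolation operator is $\mathscr{I}_{\alpha,c}\mathbf{y}(x)=\sum_{j\in\mathbb{Z}}y_jL_{\alpha,c}(x-j)$. *)

theory Defs
  imports "HOL-Probability.Sinc_Integral"
begin

definition ell_p :: "real \<Rightarrow> (int \<Rightarrow> complex) set" where
  "ell_p p = {y. (\<lambda>j. norm (y j) powr p) summable_on UNIV}"

text \<open>Infinite outside \<open>L\<^sub>p(\<real>)\<close>, so that convergence of norms to \<open>0\<close> includes the claim that
  the functions eventually belong to \<open>L\<^sub>p(\<real>)\<close>.\<close>
definition Lp_norm :: "real \<Rightarrow> (real \<Rightarrow> complex) \<Rightarrow> ennreal" where
  "Lp_norm p f =
    (if f \<in> borel_measurable lborel \<and> integrable lborel (\<lambda>x. norm (f x) powr p)
     then ennreal ((LINT x|lborel. norm (f x) powr p) powr (1 / p)) else \<infinity>)"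

text \<open>The library function \<^const>\<open>sinc\<close> is unnormalised: \<open>sinc t = sin t / t\<close>, with
  \<open>sinc 0 = 1\<close>.\<close>
definition whittaker :: "(int \<Rightarrow> complex) \<Rightarrow> real \<Rightarrow> complex" where
  "whittaker y x = (\<Sum>\<^sub>\<infinity>j\<in>UNIV. y j * of_real (sinc (pi * (x - of_int j))))"

text \<open>The modified Bessel function of the second kind for real order and argument \<open>r > 0\<close>, by its
  standard integral formula.\<close>
definition bessel_K :: "real \<Rightarrow> real \<Rightarrow> real" where
  "bessel_K \<nu> r = (LBINT t:{0..}. exp (- r * cosh t) * cosh (\<nu> * t))"

text \<open>The generalized Fourier transform of the general multiquadric
  \<open>x \<mapsto> (x\<^sup>2 + c\<^sup>2) powr \<alpha>\<close>, meaningful for \<open>c > 0\<close>, \<open>\<alpha> \<notin> \<nat>\<close> and \<open>\<xi> \<noteq> 0\<close>.\<close>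
definition multiquadric_hat :: "real \<Rightarrow> real \<Rightarrow> real \<Rightarrow> real" where
  "multiquadric_hat \<alpha> c \<xi> =
    2 powr (1 + \<alpha>) / Gamma (- \<alpha>) * (c / \<bar>\<xi>\<bar>) powr (\<alpha> + 1/2) * bessel_K (\<alpha> + 1/2) (c * \<bar>\<xi>\<bar>)"

definition fundamental_quotient :: "real \<Rightarrow> real \<Rightarrow> real \<Rightarrow> real" where
  "fundamental_quotient \<alpha> c \<xi> =
    multiquadric_hat \<alpha> c \<xi> / (\<Sum>\<^sub>\<infinity>j\<in>(UNIV :: int set). multiquadric_hat \<alpha> c (\<xi> + 2 * pi * of_int j))"

text \<open>On \<open>2\<pi>\<int>\<close> one of the shifted arguments is \<open>0\<close>, where the formula above is not meaningful; the
  quotient is extended there by its limit.\<close>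
definition fundamental_hat :: "real \<Rightarrow> real \<Rightarrow> real \<Rightarrow> real" where
  "fundamental_hat \<alpha> c \<xi> =
    (if \<xi> \<in> range (\<lambda>k::int. 2 * pi * of_int k)
     then Lim (at \<xi>) (fundamental_quotient \<alpha> c) else fundamental_quotient \<alpha> c \<xi>)"

definition fundamental_function :: "real \<Rightarrow> real \<Rightarrow> real \<Rightarrow> complex" where
  "fundamental_function \<alpha> c x =
    1 / (2 * of_real pi) *
      (LINT \<xi>|lborel. of_real (fundamental_hat \<alpha> c \<xi>) * exp (\<i> * of_real (x * \<xi>)))"

definition cardinal_interpolant :: "real \<Rightarrow> real \<Rightarrow> (int \<Rightarrow> complex) \<Rightarrow> real \<Rightarrow> complex" where
  "cardinal_interpolant \<alpha> c y x =
    (\<Sum>\<^sub>\<infinity>j\<in>UNIV. y j * fundamental_function \<alpha> c (x - of_int j))"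

end

theory Submission
  imports Defs "HOL-Complex_Analysis.Cauchy_Integral_Theorem" "HOL-Real_Asymp.Real_Asymp"
begin

text \<open>
  Up to a constant the Fourier transform of the multiquadric is a positive decreasing function \<open>G\<close> of
  \<open>\<bar>\<xi>\<bar>\<close> with \<open>G s \<le> (s / r) powr m * exp (- c * (s - r)) * G r\<close> for \<open>r \<le> s\<close>; nothing else about
  Bessel functions matters. On each interval \<open>(\<pi> n, \<pi> (n + 1))\<close> the terms of the periodization of \<open>G\<close>
  split into decreasing and increasing ones, which exhibits the quotient \<open>L\<close> defining the fundamental
  function as a product (for \<open>n = 0\<close>, a difference of such) of a decreasing and an increasing function,
  with bounds that are summable in \<open>n\<close> uniformly in \<open>c \<ge> 1\<close>.
  By the layer-cake formula the fundamental function is therefore an average, with uniformly bounded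
  total mass, of the kernels \<open>sin (t x) / x\<close>. These act boundedly from \<open>\<ell>\<^sub>p\<close> to \<open>L\<^sub>p\<close> because the
  discrete Hilbert transform is bounded on \<open>\<ell>\<^sub>p\<close>. For the latter, let \<open>F\<close> be the Cauchy transform of a
  nonnegative sequence: on the upper half plane \<open>Re F > 0\<close>, the integral of \<open>F powr p\<close> over a horizontal
  line vanishes, and \<open>\<bar>Im F\<bar> powr p \<le> A * Re F powr p - B * Re (F powr p)\<close> if \<open>1 < p \<le> 2\<close>; duality gives
  \<open>p > 2\<close>.

  So the interpolation operators are bounded uniformly in \<open>c\<close>, and it suffices to treat finitely
  supported sequences. There the kernel of the difference is bounded by a constant times
  \<open>1 / (1 + \<bar>x\<bar>)\<close>, and tends to \<open>0\<close> uniformly because \<open>L\<close> tends to the indicator of \<open>[-\<pi>, \<pi>]\<close> in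
  \<open>L\<^sub>1\<close>; dominated convergence concludes.
\<close>

section \<open>Convexity and Poisson kernels\<close>

text \<open>The difficulty is uniformity in \<open>c\<close>. As \<open>c\<close> grows,
  \<open>L\<close> steepens into a jump at \<pi>, so estimates through its derivative blow up;
  monotonicity measures the same oscillation by suprema alone. The decay of \<open>G\<close> is
  spent twice: at rate 1 it gives majorants common to all c \<ge> 1, while the growing rate drives
  \<open>L\<close> to its limit on either side of \<pi>. The Hilbert transform is taken with the
  kernel \<open>u / (u\<^sup>2 + 1)\<close>, which differs from 1 / u on the nonzero integers by a
  summable amount and needs no exception on the diagonal. The poles of \<open>F\<close> then lie on
  the line Im z = -1, so \<open>F\<close> is holomorphic across the real axis and the contour may
  run on that axis; the integral of \<open>F powr p\<close> vanishes because F = O(1 / |z|) and p >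
  1. The bound p \<le> 2 keeps p times an argument below \<pi>/2 in the range where cos decreases.
  Averages and infinite sums of kernels go through Jensen's inequality, whose constants do not
  accumulate, whereas every use of \<open>powr_sum_le\<close> costs a factor
  \<open>2 powr p\<close>.\<close>

lemma powr_sum_le:
  fixes a b p :: real
  assumes "0 \<le> a" "0 \<le> b" "0 \<le> p"
  shows "(a + b) powr p \<le> 2 powr p * (a powr p + b powr p)"
proof -
  have "(a + b) powr p \<le> (2 * max a b) powr p"
    using assms by (intro powr_mono2) auto
  also have "\<dots> = 2 powr p * max a b powr p"
    using assms by (simp add: powr_mult)
  also have "\<dots> \<le> 2 powr p * (a powr p + b powr p)"
    by (intro mult_left_mono) (auto simp: max_def)
  finally show ?thesis .
qed

text \<open>Young's inequality for \<open>u\<close> and \<open>a powr (p - 1)\<close>, with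
  exponents p and p / (p - 1), is the tangent-line form of convexity; obtained this way it needs no
  derivative and includes \<open>a = 0\<close> and \<open>u = 0\<close>.\<close>

lemma powr_tangent_le:
  fixes a u p :: real
  assumes "1 < p" "0 \<le> a" "0 \<le> u"
  shows "a powr p + p * a powr (p - 1) * (u - a) \<le> u powr p"
proof -
  have "u * a powr (p - 1) \<le> u powr p / p + (a powr (p - 1)) powr (p / (p - 1)) / (p / (p - 1))"
    using assms by (intro Youngs_inequality) (auto simp: field_simps)
  also have "(a powr (p - 1)) powr (p / (p - 1)) = a powr p"
    using assms by (simp add: powr_powr)
  finally have "p * (u * a powr (p - 1)) \<le> p * (u powr p / p + a powr p / (p / (p - 1)))"
    using assms by (intro mult_left_mono) auto
  also have "\<dots> = u powr p + (p - 1) * a powr p"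
    using assms by (simp add: field_simps)
  finally have 1: "p * a powr (p - 1) * u \<le> u powr p + (p - 1) * a powr p"
    by (simp add: mult_ac)
  have "a powr (p - 1) * a = a powr p"
    using assms by (cases "a = 0") (auto simp: powr_mult_base mult.commute)
  with 1 show ?thesis by (simp add: algebra_simps)
qed

text \<open>Jensen's inequality for weights that are not normalized: the tangent bound at the
  weighted mean \<open>a\<close> is averaged, and the total weight accounts for the power p -
  1.\<close>

lemma powr_sum_weighted_le:
  fixes w u :: "'a \<Rightarrow> real" and p :: real
  assumes "1 < p" "finite J" "\<And>j. j \<in> J \<Longrightarrow> 0 \<le> w j" "\<And>j. j \<in> J \<Longrightarrow> 0 \<le> u j"
  shows "(\<Sum>j\<in>J. w j * u j) powr p \<le> (\<Sum>j\<in>J. w j) powr (p - 1) * (\<Sum>j\<in>J. w j * u j powr p)"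
proof (cases "(\<Sum>j\<in>J. w j) = 0")
  case True
  then have "\<forall>j\<in>J. w j = 0" using assms by (simp add: sum_nonneg_eq_0_iff)
  then show ?thesis using assms by simp
next
  case False
  define W where "W = (\<Sum>j\<in>J. w j)"
  have W: "W > 0" using False assms by (simp add: W_def sum_nonneg less_le)
  define a where "a = (\<Sum>j\<in>J. w j * u j) / W"
  have a: "0 \<le> a" using W assms by (auto simp: a_def intro!: sum_nonneg divide_nonneg_pos)
  \<comment> \<open>The linear terms of the tangent cancel because \<open>a\<close> is the weighted
    mean.\<close>
  have "W * a powr p = (\<Sum>j\<in>J. w j * (a powr p + p * a powr (p - 1) * (u j - a)))"
  proof -
    have "(\<Sum>j\<in>J. w j * (u j - a)) = 0"
      using W by (simp add: right_diff_distrib sum_subtractf sum_distrib_right[symmetric] W_def[symmetric])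
       (simp add: a_def)
    moreover have "(\<Sum>j\<in>J. w j * (a powr p + p * a powr (p - 1) * (u j - a)))
        = (\<Sum>j\<in>J. w j) * a powr p + (p * a powr (p - 1)) * (\<Sum>j\<in>J. w j * (u j - a))"
      by (simp add: distrib_left sum.distrib sum_distrib_right sum_distrib_left mult_ac)
    ultimately show ?thesis by (simp add: W_def)
  qed
  also have "\<dots> \<le> (\<Sum>j\<in>J. w j * u j powr p)"
    using assms a by (intro sum_mono mult_left_mono powr_tangent_le) auto
  finally have "W powr (p - 1) * (W * a powr p) \<le> W powr (p - 1) * (\<Sum>j\<in>J. w j * u j powr p)"
    by (intro mult_left_mono) auto
  moreover have "W powr (p - 1) * (W * a powr p) = (W * a) powr p"
    using W a by (simp add: powr_mult powr_diff)
  moreover have "W * a = (\<Sum>j\<in>J. w j * u j)" using W by (simp add: a_def)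
  ultimately show ?thesis by (simp add: W_def)
qed

text \<open>Up to the factor 1/\<pi>, the Poisson kernel at height 1 and its conjugate: real and
  imaginary part of i / (u + i).\<close>

definition poisson :: "real \<Rightarrow> real" where "poisson u = 1 / (u\<^sup>2 + 1)"
definition conj_poisson :: "real \<Rightarrow> real" where "conj_poisson u = u / (u\<^sup>2 + 1)"

lemma sq_plus_1_pos: "0 < (u::real)\<^sup>2 + 1"
  by (smt (verit) zero_le_power2)

lemma poisson_pos: "0 < poisson u"
  using sq_plus_1_pos[of u] by (simp add: poisson_def)

lemma poisson_minus: "poisson (- u) = poisson u"
  by (simp add: poisson_def)

lemma conj_poisson_minus: "conj_poisson (- u) = - conj_poisson u"
  by (simp add: conj_poisson_def)

text \<open>Harnack-type comparison at unit distance: it replaces x - j by n - j for x in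
  [n, n + 1]. The constant comes from v^2 = 2 u^2 + 2 (u - v)^2 - (2 u - v)^2 \<le> 2 u^2 +
  2.\<close>

lemma poisson_le_shift:
  assumes "\<bar>u - v\<bar> \<le> 1"
  shows "poisson u \<le> 3 * poisson v"
proof -
  have "(u - v)\<^sup>2 \<le> 1" using assms by (simp add: abs_square_le_1)
  moreover have "0 \<le> (2 * u - v)\<^sup>2" by simp
  ultimately have "v\<^sup>2 \<le> 2 + 2 * u\<^sup>2"
    by (simp add: power2_eq_square algebra_simps)
  then have "v\<^sup>2 + 1 \<le> 3 * (u\<^sup>2 + 1)"
    by (smt (verit) zero_le_power2)
  then show ?thesis using sq_plus_1_pos[of u] sq_plus_1_pos[of v]
    by (simp add: poisson_def field_simps)
qed

text \<open>The difference is (u - v) (1 - u v) / ((u^2 + 1) (v^2 + 1)), of quadratic decay. Hence a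
  unit shift changes the conjugate kernel, which is not summable over the integers, only by a
  summable Poisson term.\<close>

lemma conj_poisson_shift:
  assumes "\<bar>u - v\<bar> \<le> 1"
  shows "\<bar>conj_poisson u - conj_poisson v\<bar> \<le> 2 * poisson v"
proof -
  have "(u - v)\<^sup>2 \<le> 1" using assms by (simp add: abs_square_le_1)
  then have vv: "v\<^sup>2 \<le> 2 * u\<^sup>2 + 2"
    using zero_le_power2[of "2 * u - v"]
    by (simp add: power2_eq_square algebra_simps)
  have "0 \<le> (u - v)\<^sup>2" "0 \<le> (u + v)\<^sup>2" by auto
  then have "2 * (u * v) \<le> u\<^sup>2 + v\<^sup>2" "- (2 * (u * v)) \<le> u\<^sup>2 + v\<^sup>2"
    by (simp_all add: power2_eq_square algebra_simps)
  then have 1: "\<bar>1 - u * v\<bar> \<le> 2 * (u\<^sup>2 + 1)"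
    using vv by (smt (verit) zero_le_power2)
  have "conj_poisson u - conj_poisson v = (u - v) * ((1 - u * v) / ((u\<^sup>2 + 1) * (v\<^sup>2 + 1)))"
    using sq_plus_1_pos[of u] sq_plus_1_pos[of v]
    by (simp add: conj_poisson_def diff_frac_eq) (simp add: power2_eq_square algebra_simps)
  then have "\<bar>conj_poisson u - conj_poisson v\<bar> = \<bar>u - v\<bar> * (\<bar>1 - u * v\<bar> / ((u\<^sup>2 + 1) * (v\<^sup>2 + 1)))"
    by (simp add: abs_mult sq_plus_1_pos)
  also have "\<dots> \<le> 1 * (2 * (u\<^sup>2 + 1) / ((u\<^sup>2 + 1) * (v\<^sup>2 + 1)))"
    using assms 1 sq_plus_1_pos[of u] sq_plus_1_pos[of v]
    by (intro mult_mono divide_right_mono) auto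
  also have "\<dots> = 2 * poisson v"
    using sq_plus_1_pos[of u, THEN less_imp_neq] sq_plus_1_pos[of v, THEN less_imp_neq]
    by (simp add: poisson_def divide_simps)
  finally show ?thesis .
qed

section \<open>Sums of the Poisson kernel over the integers\<close>

lemma summable_on_int_abs:
  fixes f :: "int \<Rightarrow> real"
  assumes "summable (\<lambda>n. f (int n))" "summable (\<lambda>n. f (- int n))" "\<And>j. 0 \<le> f j"
  shows "f summable_on UNIV"
proof -
  have 1: "f summable_on (range int)"
    using assms by (subst summable_on_reindex)
      (auto simp: o_def intro!: norm_summable_imp_summable_on)
  have 2: "f summable_on (range (\<lambda>n. - int n))"
    using assms by (subst summable_on_reindex)
      (auto simp: o_def inj_on_def intro!: norm_summable_imp_summable_on)
  have U: "(UNIV :: int set) = range int \<union> (range (\<lambda>n. - int n) - range int)"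
  proof -
    have "j \<in> range int \<union> range (\<lambda>n. - int n)" for j :: int
      by (cases "0 \<le> j") (auto intro: range_eqI[of _ _ "nat j"] range_eqI[of _ _ "nat (- j)"])
    then show ?thesis by blast
  qed
  have "f summable_on (range int \<union> (range (\<lambda>n. - int n) - range int))"
    by (intro summable_on_Un_disjoint 1 summable_on_subset[OF 2]) auto
  then show ?thesis using U by metis
qed

lemma poisson_summable_on: "(\<lambda>m::int. poisson (of_int m)) summable_on UNIV"
proof -
  have 1: "summable (\<lambda>n. poisson (real n))"
  proof (rule summable_comparison_test_ev)
    show "summable (\<lambda>n. 1 / real n ^ 2)" using inverse_power_summable[of 2] by (simp add: inverse_eq_divide)
    show "\<forall>\<^sub>F n in sequentially. norm (poisson (real n)) \<le> 1 / real n ^ 2"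
      using eventually_gt_at_top[of 0]
      by eventually_elim (auto simp: poisson_def intro!: divide_left_mono mult_pos_pos sq_plus_1_pos)
  qed
  show ?thesis
    by (rule summable_on_int_abs) (use 1 poisson_pos in \<open>auto simp: poisson_minus less_imp_le\<close>)
qed

definition poisson_sum :: real where "poisson_sum = (\<Sum>\<^sub>\<infinity>m\<in>UNIV. poisson (of_int m))"

lemma sum_poisson_le:
  assumes "finite F"
  shows "(\<Sum>m\<in>F. poisson (of_int m)) \<le> poisson_sum"
  unfolding poisson_sum_def
  using assms poisson_pos by (intro finite_sum_le_infsum poisson_summable_on) (auto simp: less_imp_le)

lemma poisson_sum_pos: "0 < poisson_sum"
  using sum_poisson_le[of "{0}"] poisson_pos[of 0] by simp

lemma sum_poisson_shift_le:
  assumes "finite F"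
  shows "(\<Sum>m\<in>F. poisson (of_int (n - m))) \<le> poisson_sum"
    "(\<Sum>m\<in>F. poisson (of_int (m - n))) \<le> poisson_sum"
proof -
  have "(\<Sum>m\<in>F. poisson (of_int (m - n))) = (\<Sum>m\<in>(\<lambda>m. m - n) ` F. poisson (of_int m))"
    by (subst sum.reindex) (auto simp: inj_on_def)
  then show 2: "(\<Sum>m\<in>F. poisson (of_int (m - n))) \<le> poisson_sum"
    using sum_poisson_le[of "(\<lambda>m. m - n) ` F"] assms by simp
  have "poisson (of_int (n - m)) = poisson (of_int (m - n))" for m
    using poisson_minus[of "of_int (n - m)"] by simp
  then show "(\<Sum>m\<in>F. poisson (of_int (n - m))) \<le> poisson_sum" using 2 by simp
qed

text \<open>Young's inequality for convolution with a summable kernel: Jensen over \<open>j\<close>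
  with the Poisson weights gives the power p - 1 of \<open>poisson_sum\<close>, and summing over
  \<open>n\<close> gives the remaining one.\<close>

lemma poisson_convolution_bound:
  fixes a :: "int \<Rightarrow> real" and p :: real
  assumes "1 < p" "finite J" "finite N" "\<And>j. j \<in> J \<Longrightarrow> 0 \<le> a j"
  shows "(\<Sum>n\<in>N. (\<Sum>j\<in>J. a j * poisson (of_int (n - j))) powr p) \<le> poisson_sum powr p * (\<Sum>j\<in>J. a j powr p)"
proof -
  let ?P = "\<lambda>n j. poisson (of_int (n - j))"
  have P: "0 \<le> ?P n j" for n j using poisson_pos by (simp add: less_imp_le)
  have "(\<Sum>j\<in>J. a j * ?P n j) powr p \<le> poisson_sum powr (p - 1) * (\<Sum>j\<in>J. ?P n j * a j powr p)" for n
  proof -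
    have "(\<Sum>j\<in>J. a j * ?P n j) powr p = (\<Sum>j\<in>J. ?P n j * a j) powr p" by (simp add: mult.commute)
    also have "\<dots> \<le> (\<Sum>j\<in>J. ?P n j) powr (p - 1) * (\<Sum>j\<in>J. ?P n j * a j powr p)"
      using assms P by (intro powr_sum_weighted_le) auto
    also have "\<dots> \<le> poisson_sum powr (p - 1) * (\<Sum>j\<in>J. ?P n j * a j powr p)"
      using assms P sum_poisson_shift_le(1)[OF \<open>finite J\<close>]
      by (intro mult_right_mono powr_mono2) (auto intro!: sum_nonneg)
    finally show ?thesis .
  qed
  then have "(\<Sum>n\<in>N. (\<Sum>j\<in>J. a j * ?P n j) powr p)
      \<le> (\<Sum>n\<in>N. poisson_sum powr (p - 1) * (\<Sum>j\<in>J. ?P n j * a j powr p))"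
    by (intro sum_mono)
  also have "\<dots> = poisson_sum powr (p - 1) * (\<Sum>j\<in>J. (\<Sum>n\<in>N. ?P n j) * a j powr p)"
    by (subst sum_distrib_left[symmetric], subst sum.swap) (simp add: sum_distrib_right)
  also have "\<dots> \<le> poisson_sum powr (p - 1) * (\<Sum>j\<in>J. poisson_sum * a j powr p)"
    using sum_poisson_shift_le(2)[OF \<open>finite N\<close>]
    by (intro mult_left_mono sum_mono mult_right_mono) auto
  also have "\<dots> = poisson_sum powr p * (\<Sum>j\<in>J. a j powr p)"
    using poisson_sum_pos by (simp add: sum_distrib_left[symmetric] powr_diff)
  finally show ?thesis .
qed

section \<open>Powers of functions with positive real part\<close>

text \<open>In polar form z = r e^(it) with |t| < \<pi>/2 this becomes |sin t|^p \<le> A cos(t)^p -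
  B cos(p t). Where |t| stays away from \<pi>/2 the first term suffices; near \<pi>/2, where cos t
  vanishes, cos(p t) is negative, and p \<le> 2 keeps p |t| within [0, \<pi>], where cos
  decreases.\<close>

lemma complex_powr_conjugate_bound:
  fixes p :: real
  assumes "1 < p" "p \<le> 2"
  obtains A B where "0 \<le> A" "0 \<le> B"
    "\<And>z. 0 < Re z \<Longrightarrow> \<bar>Im z\<bar> powr p \<le> A * Re z powr p - B * Re (z powr of_real p)"
proof -
  \<comment> \<open>The midpoint between \<pi>/(2p) and \<pi>/2: beyond \<open>t0\<close> the cosine
    of \<open>p * t\<close> is at most \<open>- \<eta>\<close>, below it cos t is at least
    \<open>cos t0\<close>.\<close>
  define t0 where "t0 = (pi / 2 + pi / (2 * p)) / 2"
  have t0: "pi / 2 < p * t0" "t0 < pi / 2" "0 < t0" "p * t0 \<le> pi"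
    using assms pi_gt_zero by (auto simp: t0_def field_simps intro!: add_pos_pos)
  define \<eta> where "\<eta> = - cos (p * t0)"
  have eta: "0 < \<eta>"
  proof -
    have "cos (p * t0) < cos (pi / 2)"
      using t0 by (intro cos_monotone_0_pi) auto
    then show ?thesis by (simp add: \<eta>_def)
  qed
  \<comment> \<open>\<open>B\<close> makes the second term at least 1 beyond \<open>t0\<close>;
    \<open>A\<close> then pays for 1 and for the loss \<open>B\<close> below it.\<close>
  define B where "B = 1 / \<eta>"
  define A where "A = (1 + B) / cos t0 powr p"
  have ct0: "0 < cos t0" using t0 by (intro cos_gt_zero) auto
  have B: "0 < B" using eta by (simp add: B_def)
  have A: "0 \<le> A" using B by (simp add: A_def)
  have key: "\<bar>sin t\<bar> powr p \<le> A * cos t powr p - B * cos (p * t)" if t: "\<bar>t\<bar> < pi / 2" for t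
  proof -
    have s: "\<bar>sin t\<bar> powr p \<le> 1" using assms by (intro powr_le1) auto
    show ?thesis
    proof (cases "\<bar>t\<bar> \<le> t0")
      case True
      have "cos t0 \<le> cos \<bar>t\<bar>" using True t0 t by (intro cos_monotone_0_pi_le) auto
      then have "cos t0 powr p \<le> cos t powr p" using ct0 assms by (intro powr_mono2) auto
      then have "A * cos t0 powr p \<le> A * cos t powr p" using A by (intro mult_left_mono)
      moreover have "A * cos t0 powr p = 1 + B" using ct0 by (simp add: A_def)
      moreover have "B * cos (p * t) \<le> B * 1" using B by (intro mult_left_mono) auto
      ultimately show ?thesis using s by linarith
    next
      case False
      have "p * \<bar>t\<bar> \<le> 2 * (pi / 2)" using assms t by (intro mult_mono) auto
      then have "cos (p * \<bar>t\<bar>) \<le> cos (p * t0)"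
        using False t0 assms by (intro cos_monotone_0_pi_le) auto
      moreover have "cos (p * \<bar>t\<bar>) = cos (p * t)" by (cases "t \<ge> 0") auto
      ultimately have "B * cos (p * t) \<le> B * (- \<eta>)" using B by (intro mult_left_mono) (auto simp: \<eta>_def)
      also have "B * (- \<eta>) = -1" using eta by (simp add: B_def)
      finally show ?thesis using s A by (smt (verit) mult_nonneg_nonneg powr_ge_zero)
    qed
  qed
  show ?thesis
  proof (rule that[of A B])
    fix z :: complex assume z: "0 < Re z"
    then have z0: "z \<noteq> 0" by auto
    define r where "r = cmod z"
    define t where "t = Im (Ln z)"
    have r: "0 < r" using z0 by (simp add: r_def)
    have t: "\<bar>t\<bar> < pi / 2" using Re_Ln_pos_lt_imp[OF z] by (simp add: t_def)
    have zeq: "z = r * exp (\<i> * t)"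
    proof -
      have "z = exp (Ln z)" using z0 by simp
      also have "Ln z = of_real (ln r) + \<i> * t" using z0 by (simp add: complex_eq_iff r_def t_def)
      also have "exp (of_real (ln r) + \<i> * t) = r * exp (\<i> * t)"
        using r by (simp add: exp_add exp_of_real)
      finally show ?thesis .
    qed
    have re: "Re z = r * cos t" and im: "Im z = r * sin t"
      by (simp_all add: zeq Re_exp Im_exp)
    have "z powr of_real p = exp (of_real p * Ln z)" using z0 by (simp add: powr_def)
    then have "Re (z powr of_real p) = exp (p * ln r) * cos (p * t)"
      using z0 by (simp add: Re_exp r_def t_def)
    also have "exp (p * ln r) = r powr p" using r by (simp add: powr_def)
    finally have rp: "Re (z powr of_real p) = r powr p * cos (p * t)" .
    have "\<bar>Im z\<bar> powr p = r powr p * \<bar>sin t\<bar> powr p"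
      using r by (simp add: im abs_mult powr_mult)
    also have "\<dots> \<le> r powr p * (A * cos t powr p - B * cos (p * t))"
      using key[OF t] by (intro mult_left_mono) auto
    also have "\<dots> = A * Re z powr p - B * Re (z powr of_real p)"
    proof -
      have "0 < cos t" using z r by (simp add: re zero_less_mult_iff)
      then show ?thesis using r by (simp add: rp re powr_mult algebra_simps)
    qed
    finally show "\<bar>Im z\<bar> powr p \<le> A * Re z powr p - B * Re (z powr of_real p)" .
  qed (use A B in auto)
qed

text \<open>Cauchy's theorem for the triangle with vertices -R, R, iR. On the two slanted sides |Re
  z| + Im z = R, so |z| \<ge> R / 2; their lengths are at most 2 R and their contribution is O(R^(1
  - p)).\<close>

lemma triangle_integral_tendsto_0:
  fixes G :: "complex \<Rightarrow> complex" and K p R0 :: real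
  assumes hol: "G holomorphic_on {z. -1 < Im z}" and p: "1 < p"
    and bound: "\<And>z. 0 \<le> Im z \<Longrightarrow> R0 \<le> norm z \<Longrightarrow> norm (G z) \<le> K * norm z powr (- p)"
    and R0: "0 < R0" and K: "0 \<le> K"
  shows "((\<lambda>R. integral {-R..R} (\<lambda>x. G (of_real x))) \<longlongrightarrow> 0) at_top"
proof (rule Lim_null_comparison)
  have "((\<lambda>R::real. 4 * K * (R * (R / 2) powr (- p))) \<longlongrightarrow> 4 * K * 0) at_top"
    using p by (intro tendsto_mult tendsto_const) real_asymp
  then show "((\<lambda>R::real. 4 * K * (R * (R / 2) powr (- p))) \<longlongrightarrow> 0) at_top" by simp
  show "\<forall>\<^sub>F R in at_top. norm (integral {-R..R} (\<lambda>x. G (of_real x))) \<le> 4 * K * (R * (R / 2) powr (- p))"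
    using eventually_ge_at_top[of "2 * R0"]
  proof eventually_elim
    case (elim R)
    have R: "0 < R" using elim R0 by simp
    define a b c where "a = complex_of_real (- R)" and "b = complex_of_real R" and "c = \<i> * complex_of_real R"
    have sub: "convex hull {a, b, c} \<subseteq> {z. -1 < Im z}"
    proof (rule hull_minimal)
      show "{a, b, c} \<subseteq> {z. -1 < Im z}" using R by (auto simp: a_def b_def c_def)
      show "convex {z. -1 < Im z}" by (rule convex_halfspace_Im_gt)
    qed
    have C: "(G has_contour_integral 0) (linepath a b +++ linepath b c +++ linepath c a)"
      by (rule Cauchy_theorem_triangle) (rule holomorphic_on_subset[OF hol sub])
    have cont: "continuous_on (convex hull {a, b, c}) G"
      by (rule holomorphic_on_imp_continuous_on, rule holomorphic_on_subset[OF hol sub])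
    have seg: "closed_segment u v \<subseteq> convex hull {a, b, c}" if "u \<in> {a,b,c}" "v \<in> {a,b,c}" for u v
      unfolding segment_convex_hull using that by (intro hull_mono) auto
    have int: "G contour_integrable_on (linepath u v)" if "u \<in> {a,b,c}" "v \<in> {a,b,c}" for u v
      by (intro contour_integrable_continuous_linepath continuous_on_subset[OF cont] seg that)
    have sum0: "contour_integral (linepath a b) G + contour_integral (linepath b c) G + contour_integral (linepath c a) G = 0"
      using contour_integral_unique[OF C] int by (simp add: add.assoc)
    have lower: "0 \<le> Im z \<and> R / 2 \<le> norm z" if z: "z \<in> closed_segment b c \<or> z \<in> closed_segment c a" for z
    proof -
      obtain u where u: "0 \<le> u" "u \<le> 1" "Im z = u * R" "\<bar>Re z\<bar> = (1 - u) * R"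
      proof -
        from z show ?thesis
        proof
          assume "z \<in> closed_segment b c"
          then obtain u where "0 \<le> u" "u \<le> 1" "z = (1 - u) *\<^sub>R b + u *\<^sub>R c"
            by (auto simp: closed_segment_def)
          then show ?thesis using R by (intro that[of u]) (auto simp: b_def c_def)
        next
          assume "z \<in> closed_segment c a"
          then obtain u where "0 \<le> u" "u \<le> 1" "z = (1 - u) *\<^sub>R c + u *\<^sub>R a"
            by (auto simp: closed_segment_def)
          then show ?thesis using R by (intro that[of "1 - u"]) (auto simp: a_def c_def abs_mult)
        qed
      qed
      have "Im z + \<bar>Re z\<bar> = R" using u by (simp add: algebra_simps)
      moreover have "Im z \<le> norm z" "\<bar>Re z\<bar> \<le> norm z"
        using abs_Im_le_cmod[of z] abs_Re_le_cmod[of z] by auto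
      ultimately show ?thesis using u R by auto
    qed
    have GB: "norm (G z) \<le> K * (R / 2) powr (- p)" if "z \<in> closed_segment b c \<or> z \<in> closed_segment c a" for z
    proof -
      have "norm (G z) \<le> K * norm z powr (- p)" using lower[OF that] elim by (intro bound) auto
      also have "\<dots> \<le> K * (R / 2) powr (- p)"
        using lower[OF that] R p K by (intro mult_left_mono powr_mono2') auto
      finally show ?thesis .
    qed
    have nbc: "norm (c - b) \<le> 2 * R" "norm (a - c) \<le> 2 * R"
      using R norm_triangle_ineq4[of c b] norm_triangle_ineq4[of a c]
      by (auto simp: a_def b_def c_def norm_mult)
    have K': "0 \<le> K * (R / 2) powr (- p)" using K by simp
    have "norm (contour_integral (linepath b c) G) \<le> K * (R / 2) powr (- p) * norm (c - b)"
      using GB K' by (intro contour_integral_bound_linepath int) auto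
    also have "\<dots> \<le> K * (R / 2) powr (- p) * (2 * R)" using nbc K' by (intro mult_left_mono)
    finally have 1: "norm (contour_integral (linepath b c) G) \<le> K * (R / 2) powr (- p) * (2 * R)" .
    have "norm (contour_integral (linepath c a) G) \<le> K * (R / 2) powr (- p) * norm (a - c)"
      using GB K' by (intro contour_integral_bound_linepath int) auto
    also have "\<dots> \<le> K * (R / 2) powr (- p) * (2 * R)" using nbc K' by (intro mult_left_mono)
    finally have 2: "norm (contour_integral (linepath c a) G) \<le> K * (R / 2) powr (- p) * (2 * R)" .
    have "contour_integral (linepath a b) G = integral {-R..R} (\<lambda>x. G (of_real x))"
      using contour_integral_linepath_Reals_eq[of a b G] R by (simp add: a_def b_def)
    moreover have "contour_integral (linepath a b) G = - (contour_integral (linepath b c) G + contour_integral (linepath c a) G)"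
      using sum0 by (metis add.assoc eq_neg_iff_add_eq_0)
    ultimately have "norm (integral {-R..R} (\<lambda>x. G (of_real x))) \<le>
       norm (contour_integral (linepath b c) G) + norm (contour_integral (linepath c a) G)"
      by (metis norm_minus_cancel norm_triangle_ineq)
    then show ?case using 1 2 by (simp add: mult_ac)
  qed
qed

section \<open>Cauchy transforms of positive sequences\<close>

definition discrete_hilbert :: "int set \<Rightarrow> (int \<Rightarrow> 'a) \<Rightarrow> int \<Rightarrow> 'a::real_vector" where
  "discrete_hilbert J a n = (\<Sum>j\<in>J. conj_poisson (of_int (n - j)) *\<^sub>R a j)"

text \<open>On the real axis the Cauchy transform \<open>F\<close> has the Poisson sum of
  \<open>a\<close> as real part and the conjugate sum as imaginary part. On [n, n + 1] the imaginary
  part differs from \<open>discrete_hilbert J a n\<close> by at most \<open>2 * w n\<close>; the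
  pointwise inequality for \<open>F powr p\<close>, integrated over these intervals, leaves a
  Poisson convolution because the integral of \<open>F powr p\<close> vanishes. Strict positivity of
  \<open>a\<close> on a nonempty \<open>J\<close> puts the values of \<open>F\<close> in the open
  right half plane, where the power is holomorphic.\<close>

lemma discrete_hilbert_nonneg_aux:
  fixes p A B :: real and a :: "int \<Rightarrow> real"
  assumes p: "1 < p" and J: "finite J" and N: "finite N" and a: "\<And>j. j \<in> J \<Longrightarrow> 0 < a j" and "J \<noteq> {}"
    and AB: "0 \<le> A" "0 \<le> B"
    and ineq: "\<And>z. 0 < Re z \<Longrightarrow> \<bar>Im z\<bar> powr p \<le> A * Re z powr p - B * Re (z powr of_real p)"
  shows "(\<Sum>n\<in>N. \<bar>discrete_hilbert J a n\<bar> powr p)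
      \<le> 2 powr p * (A * 3 powr p + 2 powr p) * poisson_sum powr p * (\<Sum>j\<in>J. a j powr p)"
proof -
  define F where "F = (\<lambda>z. \<Sum>j\<in>J. of_real (a j) * (\<i> / (z + \<i> - of_int j)))"
  define G where "G = (\<lambda>z. F z powr of_real p)"
  define w where "w = (\<lambda>n. \<Sum>j\<in>J. a j * poisson (of_int (n - j)))"
  have ReF: "0 < Re (F z)" if "-1 < Im z" for z
  proof -
    \<comment> \<open>For Im w > 0 the real part of i / w is Im w / |w|^2 > 0; here w = z + i -
      j.\<close>
    have "Re (of_real (a j) * (\<i> / (z + \<i> - of_int j))) > 0" if "j \<in> J" for j
    proof -
      have "Im (z + \<i> - of_int j) > 0" using \<open>-1 < Im z\<close> by simp
      then have "0 < Re (\<i> / (z + \<i> - of_int j))"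
        by (auto simp: Re_divide intro!: divide_pos_pos) (smt (verit) zero_le_power2 zero_less_power2)
      moreover have "Re (of_real (a j) * u) = a j * Re u" for u by simp
      ultimately show ?thesis using a[OF that] by (simp only: mult_pos_pos)
    qed
    then show ?thesis using J \<open>J \<noteq> {}\<close> by (auto simp: F_def intro!: sum_pos)
  qed
  have holF: "F holomorphic_on {z. -1 < Im z}"
    unfolding F_def by (intro holomorphic_intros) (auto simp: complex_eq_iff)
  have holG: "G holomorphic_on {z. -1 < Im z}"
    unfolding G_def using ReF
    by (intro holomorphic_on_powr holF) (auto simp: complex_nonpos_Reals_iff, fastforce)
  have contG: "continuous_on S (\<lambda>x::real. G (of_real x))" for S
    by (intro continuous_on_compose2[OF holomorphic_on_imp_continuous_on[OF holG]] continuous_intros) auto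
  \<comment> \<open>\<open>m\<close> bounds all |j|, so |z| \<ge> 2 m + 2 places z at distance at
    least |z| / 2 from every pole j - i.\<close>
  define m where "m = (\<Sum>j\<in>J. \<bar>of_int j\<bar>) + (1::real)"
  define K where "K = (\<Sum>j\<in>J. a j)"
  have m: "\<bar>of_int j\<bar> \<le> m" if "j \<in> J" for j
    using member_le_sum[OF that, of "\<lambda>j. \<bar>of_int j\<bar> :: real"] J by (simp add: m_def)
  have m0: "0 < m" by (auto simp: m_def intro!: add_nonneg_pos sum_nonneg)
  have K0: "0 \<le> K" using a by (auto simp: K_def less_imp_le intro!: sum_nonneg)
  have Gb: "norm (G z) \<le> (2 * K) powr p * norm z powr (- p)" if z: "0 \<le> Im z" "2 * m + 2 \<le> norm z" for z
  proof -
    have "norm (F z) \<le> (\<Sum>j\<in>J. a j * (2 / norm z))"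
      unfolding F_def
    proof (rule sum_norm_le)
      fix j assume j: "j \<in> J"
      have "norm z \<le> norm (z + \<i> - of_int j) + norm (\<i> - of_int j)"
        using norm_triangle_ineq4[of "z + \<i> - of_int j" "\<i> - of_int j"] by simp
      moreover have "norm (\<i> - of_int j) \<le> 1 + m"
        using norm_triangle_ineq4[of \<i> "of_int j"] m[OF j] by (simp add: norm_of_int)
      ultimately have "norm z / 2 \<le> norm (z + \<i> - of_int j)" using z by linarith
      moreover have z0: "0 < norm z" using z m0 by linarith
      ultimately have "1 / norm (z + \<i> - of_int j) \<le> 1 / (norm z / 2)"
        by (intro divide_left_mono mult_pos_pos) auto
      then have "norm (\<i> / (z + \<i> - of_int j)) \<le> 2 / norm z"
        by (simp add: norm_divide)
      then show "norm (of_real (a j) * (\<i> / (z + \<i> - of_int j))) \<le> a j * (2 / norm z)"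
        using a[OF j] by (simp only: norm_mult norm_of_real abs_of_pos mult_left_mono less_imp_le)
    qed
    also have "\<dots> = 2 * K / norm z" by (simp add: K_def sum_divide_distrib[symmetric] sum_distrib_right[symmetric] field_simps sum_distrib_left)
    finally have "norm (F z) powr p \<le> (2 * K / norm z) powr p" using p by (intro powr_mono2) auto
    also have "\<dots> = (2 * K) powr p * norm z powr (- p)"
      using K0 by (simp add: powr_divide powr_minus_divide)
    finally show ?thesis by (simp add: G_def norm_powr_real_powr')
  qed
  have lim: "((\<lambda>R. integral {-R..R} (\<lambda>x. G (of_real x))) \<longlongrightarrow> 0) at_top"
    by (rule triangle_integral_tendsto_0[where ?R0.0 = "2 * m + 2" and K = "(2 * K) powr p", OF holG p Gb])
      (use m0 in auto)
  have FRe: "Re (F (of_real x)) = (\<Sum>j\<in>J. a j * poisson (x - of_int j))"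
    and FIm: "Im (F (of_real x)) = (\<Sum>j\<in>J. a j * conj_poisson (x - of_int j))" for x
    by (auto simp: F_def Re_divide Im_divide poisson_def conj_poisson_def intro!: sum.cong)
  have w0: "0 \<le> w n" for n
    using a poisson_pos by (auto simp: w_def less_imp_le intro!: sum_nonneg)
  define c where "c = 2 powr p * (A * 3 powr p + 2 powr p)"
  have c0: "0 \<le> c" using AB by (simp add: c_def)
  have step: "\<bar>discrete_hilbert J a n\<bar> powr p \<le> c * w n powr p - 2 powr p * B * Re (integral {real_of_int n..real_of_int n + 1} (\<lambda>x. G (of_real x)))" for n
  proof -
    let ?I = "{real_of_int n..real_of_int n + 1}"
    \<comment> \<open>The left side does not depend on \<open>x\<close>, so integration over an
      interval of length 1 keeps it unchanged.\<close>
    have pt: "\<bar>discrete_hilbert J a n\<bar> powr p \<le> c * w n powr p - 2 powr p * B * Re (G (of_real x))" if x: "x \<in> ?I" for x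
    proof -
      have d: "\<bar>(x - of_int j) - of_int (n - j)\<bar> \<le> 1" for j using x by auto
      have "\<bar>discrete_hilbert J a n - Im (F (of_real x))\<bar> \<le> (\<Sum>j\<in>J. a j * (2 * poisson (of_int (n - j))))"
      proof -
        have "discrete_hilbert J a n - Im (F (of_real x)) = (\<Sum>j\<in>J. a j * (conj_poisson (of_int (n - j)) - conj_poisson (x - of_int j)))"
          by (simp add: discrete_hilbert_def FIm right_diff_distrib sum_subtractf mult.commute)
        also have "\<bar>\<dots>\<bar> \<le> (\<Sum>j\<in>J. a j * (2 * poisson (of_int (n - j))))"
        proof (rule order_trans[OF sum_abs], rule sum_mono)
          fix j assume j: "j \<in> J"
          show "\<bar>a j * (conj_poisson (of_int (n - j)) - conj_poisson (x - of_int j))\<bar> \<le> a j * (2 * poisson (of_int (n - j)))"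
            using conj_poisson_shift[OF d[of j]] a[OF j] by (simp add: abs_mult abs_minus_commute)
        qed
        finally show ?thesis .
      qed
      also have "\<dots> = 2 * w n" by (simp add: w_def sum_distrib_left mult_ac)
      finally have "\<bar>discrete_hilbert J a n\<bar> \<le> \<bar>Im (F (of_real x))\<bar> + 2 * w n" by linarith
      then have "\<bar>discrete_hilbert J a n\<bar> powr p \<le> (\<bar>Im (F (of_real x))\<bar> + 2 * w n) powr p"
        using p by (intro powr_mono2) auto
      also have "\<dots> \<le> 2 powr p * (\<bar>Im (F (of_real x))\<bar> powr p + (2 * w n) powr p)"
        using p w0 by (intro powr_sum_le) auto
      also have "\<bar>Im (F (of_real x))\<bar> powr p \<le> A * Re (F (of_real x)) powr p - B * Re (G (of_real x))"
        unfolding G_def by (rule ineq) (rule ReF, simp)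
      also have "Re (F (of_real x)) powr p \<le> (3 * w n) powr p"
      proof (rule powr_mono2)
        have "Re (F (of_real x)) \<le> (\<Sum>j\<in>J. a j * (3 * poisson (of_int (n - j))))"
          unfolding FRe using poisson_le_shift[OF d] a by (intro sum_mono mult_left_mono) (auto simp: less_imp_le)
        also have "\<dots> = 3 * w n" by (simp add: w_def sum_distrib_left mult_ac)
        finally show "Re (F (of_real x)) \<le> 3 * w n" .
        show "0 \<le> Re (F (of_real x))" using ReF[of "of_real x"] by simp
      qed (use p in auto)
      finally have "\<bar>discrete_hilbert J a n\<bar> powr p
          \<le> 2 powr p * (A * (3 * w n) powr p - B * Re (G (of_real x)) + (2 * w n) powr p)"
        using AB by (simp add: mult_left_mono)
      then show ?thesis
        using w0[of n] by (simp add: c_def powr_mult algebra_simps)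
    qed
    have "integral ?I (\<lambda>x. \<bar>discrete_hilbert J a n\<bar> powr p) \<le> integral ?I (\<lambda>x. c * w n powr p - 2 powr p * B * Re (G (of_real x)))"
      by (intro integral_le pt integrable_continuous_real continuous_intros contG)
    also have "\<dots> = integral ?I (\<lambda>x. c * w n powr p) - integral ?I (\<lambda>x. 2 powr p * B * Re (G (of_real x)))"
      by (intro Henstock_Kurzweil_Integration.integral_diff integrable_continuous_real continuous_intros contG)
    also have "integral ?I (\<lambda>x. 2 powr p * B * Re (G (of_real x))) = 2 powr p * B * Re (integral ?I (\<lambda>x. G (of_real x)))"
      using integral_linear[OF integrable_continuous_real[OF contG] bounded_linear_Re, of "real_of_int n" "real_of_int n + 1"]
      by (simp add: o_def)
    finally show ?thesis by simp
  qed
  \<comment> \<open>The unit intervals fill [-k, k], where the vanishing limit of the contour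
    integral applies.\<close>
  have tele: "(\<Sum>n\<in>{- int k..<int k}. integral {real_of_int n..real_of_int n + 1} (\<lambda>x. G (of_real x)))
      = integral {- real k..real k} (\<lambda>x. G (of_real x))" for k
  proof (induction k)
    case 0
    then show ?case by simp
  next
    case (Suc k)
    have set: "{- int (Suc k)..<int (Suc k)} = insert (- int (Suc k)) (insert (int k) {- int k..<int k})"
      by auto
    have "integral {- real (Suc k)..real (Suc k)} (\<lambda>x. G (of_real x)) =
       integral {- real (Suc k)..- real k} (\<lambda>x. G (of_real x)) + integral {- real k..real (Suc k)} (\<lambda>x. G (of_real x))"
      by (rule Henstock_Kurzweil_Integration.integral_combine[symmetric]) (auto intro!: integrable_continuous_real contG)
    also have "integral {- real k..real (Suc k)} (\<lambda>x. G (of_real x)) =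
      integral {- real k..real k} (\<lambda>x. G (of_real x)) + integral {real k..real (Suc k)} (\<lambda>x. G (of_real x))"
      by (rule Henstock_Kurzweil_Integration.integral_combine[symmetric]) (auto intro!: integrable_continuous_real contG)
    finally show ?case using Suc.IH unfolding set by (simp add: algebra_simps)
  qed
  have ev: "(\<Sum>n\<in>N. \<bar>discrete_hilbert J a n\<bar> powr p) \<le> c * (poisson_sum powr p * (\<Sum>j\<in>J. a j powr p))
       - 2 powr p * B * Re (integral {- real k..real k} (\<lambda>x. G (of_real x)))"
    if "N \<subseteq> {- int k..<int k}" for k
  proof -
    have "(\<Sum>n\<in>N. \<bar>discrete_hilbert J a n\<bar> powr p) \<le> (\<Sum>n\<in>{- int k..<int k}. \<bar>discrete_hilbert J a n\<bar> powr p)"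
      by (intro sum_mono2 that) auto
    also have "\<dots> \<le> (\<Sum>n\<in>{- int k..<int k}. c * w n powr p - 2 powr p * B * Re (integral {real_of_int n..real_of_int n + 1} (\<lambda>x. G (of_real x))))"
      by (intro sum_mono step)
    also have "\<dots> = c * (\<Sum>n\<in>{- int k..<int k}. w n powr p) - 2 powr p * B * Re (integral {- real k..real k} (\<lambda>x. G (of_real x)))"
      by (simp add: sum_subtractf sum_distrib_left[symmetric] tele[symmetric])
    also have "(\<Sum>n\<in>{- int k..<int k}. w n powr p) \<le> poisson_sum powr p * (\<Sum>j\<in>J. a j powr p)"
      unfolding w_def using p J a by (intro poisson_convolution_bound) (auto simp: less_imp_le)
    finally show ?thesis using c0 by (simp add: mult_left_mono)
  qed
  have "((\<lambda>k. c * (poisson_sum powr p * (\<Sum>j\<in>J. a j powr p))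
       - 2 powr p * B * Re (integral {- real k..real k} (\<lambda>x. G (of_real x)))) \<longlongrightarrow>
     c * (poisson_sum powr p * (\<Sum>j\<in>J. a j powr p)) - 2 powr p * B * Re 0) sequentially"
    by (intro tendsto_intros filterlim_compose[OF lim] filterlim_real_sequentially)
  moreover have "\<forall>\<^sub>F k in sequentially. N \<subseteq> {- int k..<int k}"
  proof -
    define M where "M = (\<Sum>n\<in>N. \<bar>n\<bar>) + 1"
    have M: "\<forall>n\<in>N. \<bar>n\<bar> < M"
      using member_le_sum[of _ N "\<lambda>n. \<bar>n\<bar>"] N by (fastforce simp: M_def)
    show ?thesis using eventually_ge_at_top[of "nat M"]
      by eventually_elim (use M in fastforce)
  qed
  ultimately have "(\<Sum>n\<in>N. \<bar>discrete_hilbert J a n\<bar> powr p) \<le> c * (poisson_sum powr p * (\<Sum>j\<in>J. a j powr p)) - 2 powr p * B * Re 0"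
    by (intro tendsto_lowerbound[where F = sequentially]) (auto elim!: eventually_mono intro!: ev)
  then show ?thesis by (simp add: c_def mult_ac)
qed

section \<open>The discrete Hilbert transform\<close>

lemma discrete_hilbert_diff: "discrete_hilbert J (\<lambda>j. a j - b j) n = discrete_hilbert J a n - discrete_hilbert J b n"
  by (simp add: discrete_hilbert_def scaleR_diff_right sum_subtractf)

text \<open>Entries equal to 0 contribute nothing and are dropped, which leaves the strictly
  positive case; the constant is fixed before \<open>J\<close>, \<open>N\<close> and
  \<open>a\<close>.\<close>

lemma discrete_hilbert_nonneg:
  fixes p :: real
  assumes p: "1 < p" "p \<le> 2"
  shows "\<exists>C\<ge>0. \<forall>J N a. finite J \<longrightarrow> finite N \<longrightarrow> (\<forall>j. 0 \<le> a j) \<longrightarrow>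
    (\<Sum>n\<in>N. \<bar>discrete_hilbert J a n :: real\<bar> powr p) \<le> C * (\<Sum>j\<in>J. a j powr p)"
proof -
  obtain A B where AB: "0 \<le> A" "0 \<le> B"
    and ineq: "\<And>z. 0 < Re z \<Longrightarrow> \<bar>Im z\<bar> powr p \<le> A * Re z powr p - B * Re (z powr of_real p)"
    using complex_powr_conjugate_bound[OF p] by metis
  define C where "C = 2 powr p * (A * 3 powr p + 2 powr p) * poisson_sum powr p"
  have C: "0 \<le> C" using AB by (simp add: C_def)
  have "(\<Sum>n\<in>N. \<bar>discrete_hilbert J a n\<bar> powr p) \<le> C * (\<Sum>j\<in>J. a j powr p)"
    if J: "finite J" "finite N" and a: "\<forall>j. 0 \<le> a j" for J N and a :: "int \<Rightarrow> real"
  proof -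
    define J' where "J' = {j\<in>J. 0 < a j}"
    have J': "finite J'" "\<And>j. j \<in> J' \<Longrightarrow> 0 < a j" using J by (auto simp: J'_def)
    have z: "a j = 0" if "j \<in> J - J'" for j using that a by (auto simp: J'_def less_le)
    have d: "discrete_hilbert J a n = discrete_hilbert J' a n" for n
      unfolding discrete_hilbert_def by (rule sum.mono_neutral_right) (use J z in \<open>auto simp: J'_def\<close>)
    have s: "(\<Sum>j\<in>J. a j powr p) = (\<Sum>j\<in>J'. a j powr p)"
      by (rule sum.mono_neutral_right) (use J z in \<open>auto simp: J'_def\<close>)
    show ?thesis
    proof (cases "J' = {}")
      case True
      then show ?thesis using p C by (simp add: d s) (simp add: discrete_hilbert_def)
    next
      case False
      show ?thesis unfolding d s C_def
        using discrete_hilbert_nonneg_aux[OF p(1) J'(1) J(2) J'(2) False AB ineq] by simp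
    qed
  qed
  then show ?thesis using C by blast
qed

definition discrete_hilbert_bounded :: "real \<Rightarrow> bool" where
  "discrete_hilbert_bounded p \<longleftrightarrow> (\<exists>C\<ge>0. \<forall>J N a. finite J \<longrightarrow> finite N \<longrightarrow>
    (\<Sum>n\<in>N. \<bar>discrete_hilbert J a n :: real\<bar> powr p) \<le> C * (\<Sum>j\<in>J. \<bar>a j\<bar> powr p))"

lemma discrete_hilbert_bounded_le_2:
  assumes p: "1 < p" "p \<le> 2"
  shows "discrete_hilbert_bounded p"
proof -
  obtain C where C: "C \<ge> 0" and bd: "\<And>J N a. finite J \<Longrightarrow> finite N \<Longrightarrow> (\<forall>j. 0 \<le> a j) \<Longrightarrow>
    (\<Sum>n\<in>N. \<bar>discrete_hilbert J a n :: real\<bar> powr p) \<le> C * (\<Sum>j\<in>J. a j powr p)"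
    using discrete_hilbert_nonneg[OF p] by blast
  have "(\<Sum>n\<in>N. \<bar>discrete_hilbert J a n :: real\<bar> powr p) \<le> 2 powr p * (C + C) * (\<Sum>j\<in>J. \<bar>a j\<bar> powr p)"
    if J: "finite J" "finite N" for J N a
  proof -
    define b c where "b = (\<lambda>j. max (a j) 0)" and "c = (\<lambda>j. max (- a j) 0)"
    have a: "a = (\<lambda>j. b j - c j)" by (auto simp: b_def c_def)
    have "\<bar>discrete_hilbert J a n\<bar> powr p \<le> 2 powr p * (\<bar>discrete_hilbert J b n\<bar> powr p + \<bar>discrete_hilbert J c n\<bar> powr p)" for n
    proof -
      have "discrete_hilbert J a n = discrete_hilbert J b n - discrete_hilbert J c n" by (subst a) (rule discrete_hilbert_diff)
      then have "\<bar>discrete_hilbert J a n\<bar> powr p \<le> (\<bar>discrete_hilbert J b n\<bar> + \<bar>discrete_hilbert J c n\<bar>) powr p"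
        using p by (intro powr_mono2) auto
      also have "\<dots> \<le> 2 powr p * (\<bar>discrete_hilbert J b n\<bar> powr p + \<bar>discrete_hilbert J c n\<bar> powr p)"
        using p by (intro powr_sum_le) auto
      finally show ?thesis .
    qed
    then have "(\<Sum>n\<in>N. \<bar>discrete_hilbert J a n\<bar> powr p) \<le> (\<Sum>n\<in>N. 2 powr p * (\<bar>discrete_hilbert J b n\<bar> powr p + \<bar>discrete_hilbert J c n\<bar> powr p))"
      by (rule sum_mono)
    also have "\<dots> = 2 powr p * ((\<Sum>n\<in>N. \<bar>discrete_hilbert J b n\<bar> powr p) + (\<Sum>n\<in>N. \<bar>discrete_hilbert J c n\<bar> powr p))"
      by (simp add: sum_distrib_left[symmetric] sum.distrib)
    also have "\<dots> \<le> 2 powr p * (C * (\<Sum>j\<in>J. \<bar>a j\<bar> powr p) + C * (\<Sum>j\<in>J. \<bar>a j\<bar> powr p))"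
    proof (intro mult_left_mono add_mono)
      have "C * (\<Sum>j\<in>J. b j powr p) \<le> C * (\<Sum>j\<in>J. \<bar>a j\<bar> powr p)"
        using C p by (intro mult_left_mono sum_mono powr_mono2) (auto simp: b_def)
      then show "(\<Sum>n\<in>N. \<bar>discrete_hilbert J b n\<bar> powr p) \<le> C * (\<Sum>j\<in>J. \<bar>a j\<bar> powr p)"
        using bd[OF J, of b] by (auto simp: b_def)
      have "C * (\<Sum>j\<in>J. c j powr p) \<le> C * (\<Sum>j\<in>J. \<bar>a j\<bar> powr p)"
        using C p by (intro mult_left_mono sum_mono powr_mono2) (auto simp: c_def)
      then show "(\<Sum>n\<in>N. \<bar>discrete_hilbert J c n\<bar> powr p) \<le> C * (\<Sum>j\<in>J. \<bar>a j\<bar> powr p)"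
        using bd[OF J, of c] by (auto simp: c_def)
    qed auto
    finally show ?thesis by (simp add: algebra_simps)
  qed
  then show ?thesis unfolding discrete_hilbert_bounded_def using C by (intro exI[of _ "2 powr p * (C + C)"]) auto
qed

text \<open>The kernel is odd, so the transform is antisymmetric for the pairing over finite index
  sets.\<close>

lemma discrete_hilbert_adjoint:
  "(\<Sum>n\<in>N. b n * discrete_hilbert J a n) = - (\<Sum>j\<in>J. a j * discrete_hilbert N b j :: real)"
proof -
  have "(\<Sum>n\<in>N. b n * discrete_hilbert J a n) = (\<Sum>n\<in>N. \<Sum>j\<in>J. b n * a j * conj_poisson (of_int (n - j)))"
    by (simp add: discrete_hilbert_def sum_distrib_left mult_ac)
  also have "\<dots> = (\<Sum>j\<in>J. \<Sum>n\<in>N. b n * a j * conj_poisson (of_int (n - j)))"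
    by (rule sum.swap)
  also have "\<dots> = (\<Sum>j\<in>J. \<Sum>n\<in>N. - (b n * a j * conj_poisson (of_int (j - n))))"
  proof (intro sum.cong refl)
    fix j n
    show "b n * a j * conj_poisson (of_int (n - j)) = - (b n * a j * conj_poisson (of_int (j - n)))"
      using conj_poisson_minus[of "of_int (j - n)"] by simp
  qed
  also have "\<dots> = - (\<Sum>j\<in>J. a j * discrete_hilbert N b j)"
    by (simp add: discrete_hilbert_def sum_distrib_left mult_ac sum_negf)
  finally show ?thesis .
qed

text \<open>The sum \<open>X\<close> of p-th powers is tested against \<open>b\<close>, the q-th
  power of whose modulus is the p-th power of that of the transform. Antisymmetry moves the
  transform onto \<open>b\<close>, and Young's inequality with a parameter \<open>K\<close> makes
  the q-th power term at most X / 2, so it can be absorbed; \<open>X\<close> is finite because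
  \<open>N\<close> is.\<close>

lemma discrete_hilbert_bounded_dual:
  assumes q: "1 < q" and p: "1 < p" and pq: "1 / p + 1 / q = 1" and bd: "discrete_hilbert_bounded q"
  shows "discrete_hilbert_bounded p"
proof -
  obtain C where C: "C \<ge> 0" and bd: "\<And>J N a. finite J \<Longrightarrow> finite N \<Longrightarrow>
    (\<Sum>n\<in>N. \<bar>discrete_hilbert J a n :: real\<bar> powr q) \<le> C * (\<Sum>j\<in>J. \<bar>a j\<bar> powr q)"
    using bd unfolding discrete_hilbert_bounded_def by blast
  \<comment> \<open>Chosen so that \<open>K powr q * q = 2 * (C + 1)\<close>, which turns the q-th
    power term into at most half of X; \<open>C + 1\<close> keeps \<open>K\<close> positive if
    \<open>C = 0\<close>.\<close>
  define K where "K = (2 * (C + 1) / q) powr (1 / q)"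
  have K: "0 < K" using C q by (simp add: K_def)
  have Kq: "K powr q = 2 * (C + 1) / q" using C q by (simp add: K_def powr_powr)
  have pq': "(p - 1) * q = p" using p q pq by (simp add: field_simps)
  have "(\<Sum>n\<in>N. \<bar>discrete_hilbert J a n\<bar> powr p) \<le> 2 * K powr p / p * (\<Sum>j\<in>J. \<bar>a j\<bar> powr p)"
    if J: "finite J" "finite N" for J N and a :: "int \<Rightarrow> real"
  proof -
    define b where "b = (\<lambda>n. sgn (discrete_hilbert J a n) * \<bar>discrete_hilbert J a n\<bar> powr (p - 1))"
    define X where "X = (\<Sum>n\<in>N. \<bar>discrete_hilbert J a n\<bar> powr p)"
    have bq: "\<bar>b n\<bar> powr q = \<bar>discrete_hilbert J a n\<bar> powr p" for n
    proof (cases "discrete_hilbert J a n = 0")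
      case False
      then have "\<bar>b n\<bar> = \<bar>discrete_hilbert J a n\<bar> powr (p - 1)" by (simp add: b_def abs_mult abs_sgn_eq)
      then show ?thesis by (simp add: powr_powr pq')
    qed (simp add: b_def)
    have X: "X = (\<Sum>n\<in>N. b n * discrete_hilbert J a n)"
      unfolding X_def
    proof (rule sum.cong)
      fix n
      have "b n * discrete_hilbert J a n = \<bar>discrete_hilbert J a n\<bar> * \<bar>discrete_hilbert J a n\<bar> powr (p - 1)"
        by (simp add: b_def abs_sgn mult_ac)
      also have "\<dots> = \<bar>discrete_hilbert J a n\<bar> powr p" by (simp add: powr_mult_base)
      finally show "\<bar>discrete_hilbert J a n\<bar> powr p = b n * discrete_hilbert J a n" by simp
    qed simp
    also have "\<dots> = (\<Sum>j\<in>J. - (a j * discrete_hilbert N b j))" unfolding sum_negf by (rule discrete_hilbert_adjoint)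
    also have "\<dots> \<le> (\<Sum>j\<in>J. K powr p / p * \<bar>a j\<bar> powr p + \<bar>discrete_hilbert N b j\<bar> powr q / (K powr q * q))"
    proof (rule sum_mono)
      fix j
      have "- (a j * discrete_hilbert N b j) \<le> \<bar>a j * discrete_hilbert N b j\<bar>" by simp
      also have "\<dots> = (K * \<bar>a j\<bar>) * (\<bar>discrete_hilbert N b j\<bar> / K)" using K by (simp add: abs_mult)
      also have "\<dots> \<le> (K * \<bar>a j\<bar>) powr p / p + (\<bar>discrete_hilbert N b j\<bar> / K) powr q / q"
        using K p q pq by (intro Youngs_inequality) auto
      also have "\<dots> = K powr p / p * \<bar>a j\<bar> powr p + \<bar>discrete_hilbert N b j\<bar> powr q / (K powr q * q)"
        using K by (simp add: powr_mult powr_divide)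
      finally show "- (a j * discrete_hilbert N b j) \<le> K powr p / p * \<bar>a j\<bar> powr p + \<bar>discrete_hilbert N b j\<bar> powr q / (K powr q * q)" .
    qed
    also have "\<dots> = K powr p / p * (\<Sum>j\<in>J. \<bar>a j\<bar> powr p) + (\<Sum>j\<in>J. \<bar>discrete_hilbert N b j\<bar> powr q) / (K powr q * q)"
      by (simp add: sum.distrib sum_distrib_left sum_divide_distrib)
    finally have 1: "X \<le> K powr p / p * (\<Sum>j\<in>J. \<bar>a j\<bar> powr p) + (\<Sum>j\<in>J. \<bar>discrete_hilbert N b j\<bar> powr q) / (K powr q * q)" .
    have "(\<Sum>j\<in>J. \<bar>discrete_hilbert N b j\<bar> powr q) \<le> C * X"
      using bd[OF J(2,1), of b] by (simp only: bq X_def)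
    then have 2: "(\<Sum>j\<in>J. \<bar>discrete_hilbert N b j\<bar> powr q) / (K powr q * q) \<le> C * X / (K powr q * q)"
      using K q by (intro divide_right_mono) auto
    have 3: "C * X / (K powr q * q) \<le> X / 2"
    proof -
      have X0: "0 \<le> X" by (auto simp: X_def intro!: sum_nonneg)
      have "K powr q * q = 2 * (C + 1)" using q by (simp only: Kq) simp
      then have "C * X / (K powr q * q) = C / (C + 1) * (X / 2)" by (simp only: times_divide_times_eq) (simp add: mult.commute)
      also have "\<dots> \<le> 1 * (X / 2)" using C X0 by (intro mult_right_mono) auto
      finally show ?thesis by (simp only: mult_1_left)
    qed
    have "X \<le> 2 * (K powr p / p * (\<Sum>j\<in>J. \<bar>a j\<bar> powr p))"
    proof -
      have "x \<le> 2 * s" if "x \<le> s + t" "t \<le> u" "u \<le> x / 2" for x s t u :: real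
        using that by linarith
      from this[OF 1 2 3] show ?thesis .
    qed
    then show ?thesis unfolding X_def by (simp only: times_divide_eq_right mult.assoc times_divide_eq_left)
  qed
  moreover have "0 \<le> 2 * K powr p / p" using p by simp
  ultimately show ?thesis unfolding discrete_hilbert_bounded_def by blast
qed

lemma discrete_hilbert_bounded:
  assumes "1 < p"
  shows "discrete_hilbert_bounded p"
proof (cases "p \<le> 2")
  case True
  then show ?thesis using assms by (intro discrete_hilbert_bounded_le_2)
next
  case False
  then have "1 < p / (p - 1)" "p / (p - 1) \<le> 2" by (simp_all add: divide_le_eq)
  moreover have "1 / p + 1 / (p / (p - 1)) = 1" using False by (simp add: diff_divide_distrib)
  ultimately show ?thesis
    using assms discrete_hilbert_bounded_le_2 by (intro discrete_hilbert_bounded_dual[of "p / (p - 1)" p])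
qed

lemma discrete_hilbert_complex_bounded:
  fixes p :: real
  assumes p: "1 < p"
  shows "\<exists>C\<ge>0. \<forall>J N y. finite J \<longrightarrow> finite N \<longrightarrow>
    (\<Sum>n\<in>N. norm (discrete_hilbert J y n :: complex) powr p) \<le> C * (\<Sum>j\<in>J. norm (y j) powr p)"
proof -
  obtain C where C: "C \<ge> 0" and bd: "\<And>J N a. finite J \<Longrightarrow> finite N \<Longrightarrow>
    (\<Sum>n\<in>N. \<bar>discrete_hilbert J a n :: real\<bar> powr p) \<le> C * (\<Sum>j\<in>J. \<bar>a j\<bar> powr p)"
    using discrete_hilbert_bounded[OF p] unfolding discrete_hilbert_bounded_def by blast
  have "(\<Sum>n\<in>N. norm (discrete_hilbert J y n) powr p) \<le> 2 powr p * (C + C) * (\<Sum>j\<in>J. norm (y j) powr p)"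
    if J: "finite J" "finite N" for J N and y :: "int \<Rightarrow> complex"
  proof -
    define b c where "b = (\<lambda>j. Re (y j))" and "c = (\<lambda>j. Im (y j))"
    have "norm (discrete_hilbert J y n) powr p \<le> 2 powr p * (\<bar>discrete_hilbert J b n\<bar> powr p + \<bar>discrete_hilbert J c n\<bar> powr p)" for n
    proof -
      have "Re (discrete_hilbert J y n) = discrete_hilbert J b n" "Im (discrete_hilbert J y n) = discrete_hilbert J c n"
        by (simp_all add: discrete_hilbert_def b_def c_def)
      then have "norm (discrete_hilbert J y n) powr p \<le> (\<bar>discrete_hilbert J b n\<bar> + \<bar>discrete_hilbert J c n\<bar>) powr p"
        using p cmod_le[of "discrete_hilbert J y n"] by (intro powr_mono2) auto
      also have "\<dots> \<le> 2 powr p * (\<bar>discrete_hilbert J b n\<bar> powr p + \<bar>discrete_hilbert J c n\<bar> powr p)"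
        using p by (intro powr_sum_le) auto
      finally show ?thesis .
    qed
    then have "(\<Sum>n\<in>N. norm (discrete_hilbert J y n) powr p) \<le> (\<Sum>n\<in>N. 2 powr p * (\<bar>discrete_hilbert J b n\<bar> powr p + \<bar>discrete_hilbert J c n\<bar> powr p))"
      by (rule sum_mono)
    also have "\<dots> = 2 powr p * ((\<Sum>n\<in>N. \<bar>discrete_hilbert J b n\<bar> powr p) + (\<Sum>n\<in>N. \<bar>discrete_hilbert J c n\<bar> powr p))"
      by (simp add: sum_distrib_left[symmetric] sum.distrib)
    also have "\<dots> \<le> 2 powr p * (C * (\<Sum>j\<in>J. norm (y j) powr p) + C * (\<Sum>j\<in>J. norm (y j) powr p))"
    proof (intro mult_left_mono add_mono)
      have "C * (\<Sum>j\<in>J. \<bar>b j\<bar> powr p) \<le> C * (\<Sum>j\<in>J. norm (y j) powr p)"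
        using C p by (intro mult_left_mono sum_mono powr_mono2) (auto simp: b_def abs_Re_le_cmod)
      then show "(\<Sum>n\<in>N. \<bar>discrete_hilbert J b n\<bar> powr p) \<le> C * (\<Sum>j\<in>J. norm (y j) powr p)"
        using bd[OF J, of b] by auto
      have "C * (\<Sum>j\<in>J. \<bar>c j\<bar> powr p) \<le> C * (\<Sum>j\<in>J. norm (y j) powr p)"
        using C p by (intro mult_left_mono sum_mono powr_mono2) (auto simp: c_def abs_Im_le_cmod)
      then show "(\<Sum>n\<in>N. \<bar>discrete_hilbert J c n\<bar> powr p) \<le> C * (\<Sum>j\<in>J. norm (y j) powr p)"
        using bd[OF J, of c] by auto
    qed auto
    finally show ?thesis by (simp add: algebra_simps)
  qed
  then show ?thesis using C by (intro exI[of _ "2 powr p * (C + C)"]) auto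
qed

section \<open>Kernels acting on sequences\<close>

text \<open>Passes from sums over the integers to integrals over the line: on [n, n + 1) the
  integrand is dominated by a constant, and Fatou's lemma applies to the truncated step functions
  \<open>h k\<close>. Only finite sums need a bound, as the estimates on sequences provide
  it.\<close>

lemma nn_integral_floor_le:
  fixes f :: "int \<Rightarrow> ennreal" and g :: "real \<Rightarrow> ennreal"
  assumes "\<And>N. finite N \<Longrightarrow> (\<Sum>n\<in>N. f n) \<le> D" and "\<And>x. g x \<le> f \<lfloor>x\<rfloor>"
  shows "(\<integral>\<^sup>+x. g x \<partial>lborel) \<le> D"
proof -
  define h where "h k x = (\<Sum>n\<in>{- int k..<int k}. f n * indicator {real_of_int n..<real_of_int n + 1} x)" for k x
  have h: "(\<integral>\<^sup>+x. h k x \<partial>lborel) \<le> D" for k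
  proof -
    have "(\<integral>\<^sup>+x. h k x \<partial>lborel) = (\<Sum>n\<in>{- int k..<int k}. f n)"
      unfolding h_def by (subst nn_integral_sum) (auto simp: nn_integral_cmult_indicator)
    then show ?thesis using assms(1) by simp
  qed
  have "(\<integral>\<^sup>+x. g x \<partial>lborel) \<le> (\<integral>\<^sup>+x. liminf (\<lambda>k. h k x) \<partial>lborel)"
  proof (rule nn_integral_mono)
    fix x :: real
    have "\<forall>\<^sub>F k in sequentially. f \<lfloor>x\<rfloor> \<le> h k x"
      using eventually_ge_at_top[of "nat (\<bar>\<lfloor>x\<rfloor>\<bar> + 1)"]
    proof eventually_elim
      case (elim k)
      have "f \<lfloor>x\<rfloor> * indicator {real_of_int \<lfloor>x\<rfloor>..<real_of_int \<lfloor>x\<rfloor> + 1} x \<le> h k x"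
        unfolding h_def by (rule member_le_sum) (use elim in auto)
      then show ?case by simp
    qed
    then have "f \<lfloor>x\<rfloor> \<le> liminf (\<lambda>k. h k x)" by (rule Liminf_bounded)
    then show "g x \<le> liminf (\<lambda>k. h k x)" using assms(2) by (rule order_trans[rotated])
  qed
  also have "\<dots> \<le> liminf (\<lambda>k. \<integral>\<^sup>+x. h k x \<partial>lborel)"
    unfolding h_def by (intro nn_integral_liminf) measurable
  also have "\<dots> \<le> D"
    using h by (intro Liminf_le) auto
  finally show ?thesis .
qed

text \<open>Jensen's inequality again by the tangent at the mean, now for a measure of total mass V,
  whence the factor V^(p - 1). The right side may be infinite, and a null measure is separated since
  the mean divides by V.\<close>

lemma (in finite_measure) powr_integral_le:
  fixes h :: "'a \<Rightarrow> real" and p :: real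
  assumes p: "1 < p" and h: "integrable M h" "\<And>x. 0 \<le> h x"
  shows "ennreal ((LINT x|M. h x) powr p) \<le> ennreal (measure M (space M) powr (p - 1)) * (\<integral>\<^sup>+x. ennreal (h x powr p) \<partial>M)"
proof (cases "measure M (space M) = 0")
  case True
  then have "emeasure M (space M) = 0" by (simp add: emeasure_eq_measure)
  then have "AE x in M. h x = 0" by (intro AE_I[of _ _ "space M"]) auto
  then have "(LINT x|M. h x) = 0" by (simp add: integral_eq_zero_AE)
  then show ?thesis by simp
next
  case False
  define V where "V = measure M (space M)"
  have V: "0 < V" using False by (simp add: V_def less_le)
  show ?thesis
  proof (cases "(\<integral>\<^sup>+x. ennreal (h x powr p) \<partial>M) = \<infinity>")
    case True
    then show ?thesis using V by (simp add: V_def[symmetric] ennreal_mult_eq_top_iff)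
  next
    case False
    have int: "integrable M (\<lambda>x. h x powr p)"
      using h(1) False by (intro integrableI_nonneg) (auto simp: top.not_eq_extremum)
    define a where "a = (LINT x|M. h x) / V"
    have a: "0 \<le> a" using V h(2) by (auto simp: a_def intro!: divide_nonneg_pos integral_nonneg)
    have "V * a powr p = (LINT x|M. a powr p + p * a powr (p - 1) * (h x - a))"
      using h(1) V by (simp add: V_def[symmetric] right_diff_distrib) (simp add: a_def)
    also have "\<dots> \<le> (LINT x|M. h x powr p)"
      using h int p a by (intro integral_mono powr_tangent_le) auto
    finally have 1: "V powr (p - 1) * (V * a powr p) \<le> V powr (p - 1) * (LINT x|M. h x powr p)"
      by (intro mult_left_mono) auto
    have "V powr (p - 1) * (V * a powr p) = (V * a) powr p"
      using V a by (simp add: powr_mult powr_diff)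
    moreover have "V * a = (LINT x|M. h x)" using V by (simp add: a_def)
    ultimately have "(LINT x|M. h x) powr p \<le> V powr (p - 1) * (LINT x|M. h x powr p)"
      using 1 by simp
    then have "ennreal ((LINT x|M. h x) powr p) \<le> ennreal (V powr (p - 1)) * ennreal (LINT x|M. h x powr p)"
      by (simp add: ennreal_mult'[symmetric] ennreal_leI)
    also have "ennreal (LINT x|M. h x powr p) = (\<integral>\<^sup>+x. ennreal (h x powr p) \<partial>M)"
      using int by (simp add: nn_integral_eq_integral)
    finally show ?thesis by (simp add: V_def)
  qed
qed

section \<open>Operators from sequences to functions given by a kernel\<close>

definition finite_conv :: "(real \<Rightarrow> real) \<Rightarrow> int set \<Rightarrow> (int \<Rightarrow> complex) \<Rightarrow> real \<Rightarrow> complex" where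
  "finite_conv k J y x = (\<Sum>j\<in>J. k (x - of_int j) *\<^sub>R y j)"

text \<open>\<open>B\<close> bounds the p-th power of the operator norm, so no roots are taken.
  Restricting to finite \<open>J\<close> leaves no question of convergence; Fatou's lemma later
  extends the bound to whole sequences.\<close>

definition conv_bounded :: "real \<Rightarrow> (real \<Rightarrow> real) \<Rightarrow> real \<Rightarrow> bool" where
  "conv_bounded p k B \<longleftrightarrow> k \<in> borel_measurable borel \<and> 0 \<le> B \<and> (\<forall>J y. finite J \<longrightarrow>
     (\<integral>\<^sup>+x. ennreal (norm (finite_conv k J y x) powr p) \<partial>lborel) \<le> ennreal (B * (\<Sum>j\<in>J. norm (y j) powr p)))"

lemma conv_bounded_measurable: "conv_bounded p k B \<Longrightarrow> k \<in> borel_measurable borel"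
  by (simp add: conv_bounded_def)

lemma finite_conv_measurable [measurable (raw)]:
  assumes "k \<in> borel_measurable borel"
  shows "finite_conv k J y \<in> borel_measurable borel"
proof -
  note assms [measurable]
  show ?thesis unfolding finite_conv_def[abs_def] by measurable
qed

lemma conv_bounded_mono:
  assumes "conv_bounded p k B" "B \<le> B'"
  shows "conv_bounded p k B'"
proof -
  have "ennreal (B * (\<Sum>j\<in>J. norm (y j) powr p)) \<le> ennreal (B' * (\<Sum>j\<in>J. norm (y j) powr p))"
    for J and y :: "int \<Rightarrow> complex"
    using assms(2) by (intro ennreal_leI mult_right_mono) (auto simp: sum_nonneg)
  then show ?thesis using assms unfolding conv_bounded_def by (meson order_trans)
qed

lemma conv_bounded_cmult:
  assumes "conv_bounded p k B"
  shows "conv_bounded p (\<lambda>x. c * k x) (\<bar>c\<bar> powr p * B)"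
proof -
  have [measurable]: "k \<in> borel_measurable borel" using assms by (rule conv_bounded_measurable)
  have "(\<integral>\<^sup>+x. ennreal (norm (finite_conv (\<lambda>x. c * k x) J y x) powr p) \<partial>lborel) \<le> ennreal (\<bar>c\<bar> powr p * B * (\<Sum>j\<in>J. norm (y j) powr p))"
    if J: "finite J" for J y
  proof -
    have "finite_conv (\<lambda>x. c * k x) J y x = c *\<^sub>R finite_conv k J y x" for x
      by (simp add: finite_conv_def scaleR_sum_right)
    then have "(\<integral>\<^sup>+x. ennreal (norm (finite_conv (\<lambda>x. c * k x) J y x) powr p) \<partial>lborel) = (\<integral>\<^sup>+x. ennreal (\<bar>c\<bar> powr p) * ennreal (norm (finite_conv k J y x) powr p) \<partial>lborel)"
      by (simp add: powr_mult ennreal_mult')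
    also have "\<dots> = ennreal (\<bar>c\<bar> powr p) * (\<integral>\<^sup>+x. ennreal (norm (finite_conv k J y x) powr p) \<partial>lborel)"
      by (rule nn_integral_cmult) measurable
    also have "\<dots> \<le> ennreal (\<bar>c\<bar> powr p) * ennreal (B * (\<Sum>j\<in>J. norm (y j) powr p))"
      using assms J by (intro mult_left_mono) (auto simp: conv_bounded_def)
    also have "\<dots> = ennreal (\<bar>c\<bar> powr p * B * (\<Sum>j\<in>J. norm (y j) powr p))"
      by (simp add: ennreal_mult'[symmetric] mult.assoc)
    finally show ?thesis .
  qed
  then show ?thesis using assms unfolding conv_bounded_def by auto
qed

lemma conv_bounded_diff:
  assumes k: "conv_bounded p k B" "conv_bounded p k' B'" and p: "1 < p"
  shows "conv_bounded p (\<lambda>x. k x - k' x) (2 powr p * (B + B'))"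
proof -
  have [measurable]: "k \<in> borel_measurable borel" "k' \<in> borel_measurable borel" using k by (auto dest: conv_bounded_measurable)
  have B: "0 \<le> B" "0 \<le> B'" using k by (auto simp: conv_bounded_def)
  have "(\<integral>\<^sup>+x. ennreal (norm (finite_conv (\<lambda>x. k x - k' x) J y x) powr p) \<partial>lborel) \<le> ennreal (2 powr p * (B + B') * (\<Sum>j\<in>J. norm (y j) powr p))"
    if J: "finite J" for J y
  proof -
    let ?S = "\<Sum>j\<in>J. norm (y j) powr p"
    have S: "0 \<le> ?S" by (simp add: sum_nonneg)
    have "norm (finite_conv (\<lambda>x. k x - k' x) J y x) powr p \<le> 2 powr p * (norm (finite_conv k J y x) powr p + norm (finite_conv k' J y x) powr p)" for x
    proof -
      have "finite_conv (\<lambda>x. k x - k' x) J y x = finite_conv k J y x - finite_conv k' J y x"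
        by (simp add: finite_conv_def scaleR_diff_left sum_subtractf)
      then have "norm (finite_conv (\<lambda>x. k x - k' x) J y x) powr p \<le> (norm (finite_conv k J y x) + norm (finite_conv k' J y x)) powr p"
        using p by (intro powr_mono2) (auto simp: norm_triangle_ineq4)
      also have "\<dots> \<le> 2 powr p * (norm (finite_conv k J y x) powr p + norm (finite_conv k' J y x) powr p)"
        using p by (intro powr_sum_le) auto
      finally show ?thesis .
    qed
    then have "(\<integral>\<^sup>+x. ennreal (norm (finite_conv (\<lambda>x. k x - k' x) J y x) powr p) \<partial>lborel)
       \<le> (\<integral>\<^sup>+x. ennreal (2 powr p) * (ennreal (norm (finite_conv k J y x) powr p) + ennreal (norm (finite_conv k' J y x) powr p)) \<partial>lborel)"
      by (intro nn_integral_mono) (simp add: ennreal_mult'[symmetric] ennreal_plus[symmetric] ennreal_leI del: ennreal_plus)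
    also have "\<dots> = ennreal (2 powr p) * ((\<integral>\<^sup>+x. ennreal (norm (finite_conv k J y x) powr p) \<partial>lborel) + (\<integral>\<^sup>+x. ennreal (norm (finite_conv k' J y x) powr p) \<partial>lborel))"
      by (subst nn_integral_cmult, measurable) (subst nn_integral_add, auto)
    also have "\<dots> \<le> ennreal (2 powr p) * (ennreal (B * ?S) + ennreal (B' * ?S))"
      using k J by (intro mult_left_mono add_mono) (auto simp: conv_bounded_def)
    also have "\<dots> = ennreal (2 powr p * (B + B') * ?S)"
      using B S by (simp add: ennreal_mult'[symmetric] ennreal_plus[symmetric] distrib_right mult.assoc del: ennreal_plus)
    finally show ?thesis .
  qed
  then show ?thesis using B unfolding conv_bounded_def by auto
qed

text \<open>A form of Minkowski's integral inequality: Jensen in \<open>t\<close>, then Tonelli. The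
  mass V enters as V^(p - 1) from Jensen and as V from the outer integral, so averaging costs
  nothing beyond V^p.\<close>

lemma (in finite_measure) conv_bounded_integral:
  fixes K :: "'a \<Rightarrow> real \<Rightarrow> real"
  assumes p: "1 < p" and B: "0 \<le> B"
    and K [measurable]: "(\<lambda>(t, x). K t x) \<in> borel_measurable (M \<Otimes>\<^sub>M borel)"
    and op: "\<And>t. t \<in> space M \<Longrightarrow> conv_bounded p (K t) B"
    and int: "\<And>x. integrable M (\<lambda>t. K t x)"
  shows "conv_bounded p (\<lambda>x. LINT t|M. K t x) (measure M (space M) powr p * B)"
proof -
  let ?V = "measure M (space M)"
  have "(\<integral>\<^sup>+x. ennreal (norm (finite_conv (\<lambda>x. LINT t|M. K t x) J y x) powr p) \<partial>lborel) \<le> ennreal (?V powr p * B * (\<Sum>j\<in>J. norm (y j) powr p))"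
    if J: "finite J" for J y
  proof -
    let ?S = "\<Sum>j\<in>J. norm (y j) powr p"
    have intk: "integrable M (\<lambda>t. finite_conv (K t) J y x)" for x
      unfolding finite_conv_def using int by (intro Bochner_Integration.integrable_sum integrable_scaleR_left) auto
    have [measurable]: "(\<lambda>(t, x). finite_conv (K t) J y x) \<in> borel_measurable (M \<Otimes>\<^sub>M borel)"
      unfolding finite_conv_def by measurable
    have [measurable]: "(\<lambda>(t, x). finite_conv (K t) J y x) \<in> borel_measurable (M \<Otimes>\<^sub>M lborel)"
      using \<open>(\<lambda>(t, x). finite_conv (K t) J y x) \<in> borel_measurable (M \<Otimes>\<^sub>M borel)\<close> by (simp cong: measurable_cong_sets sets_pair_measure_cong)
    have "norm (finite_conv (\<lambda>x. LINT t|M. K t x) J y x) \<le> (LINT t|M. norm (finite_conv (K t) J y x))" for x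
    proof -
      have "finite_conv (\<lambda>x. LINT t|M. K t x) J y x = (LINT t|M. finite_conv (K t) J y x)"
        unfolding finite_conv_def using int by (subst Bochner_Integration.integral_sum) auto
      then show ?thesis by simp
    qed
    then have "ennreal (norm (finite_conv (\<lambda>x. LINT t|M. K t x) J y x) powr p) \<le> ennreal ((LINT t|M. norm (finite_conv (K t) J y x)) powr p)" for x
      using p by (intro ennreal_leI powr_mono2) auto
    also have "ennreal ((LINT t|M. norm (finite_conv (K t) J y x)) powr p) \<le> ennreal (?V powr (p - 1)) * (\<integral>\<^sup>+t. ennreal (norm (finite_conv (K t) J y x) powr p) \<partial>M)" for x
      using p intk by (intro powr_integral_le) auto
    finally have "(\<integral>\<^sup>+x. ennreal (norm (finite_conv (\<lambda>x. LINT t|M. K t x) J y x) powr p) \<partial>lborel) \<le>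
       (\<integral>\<^sup>+x. ennreal (?V powr (p - 1)) * (\<integral>\<^sup>+t. ennreal (norm (finite_conv (K t) J y x) powr p) \<partial>M) \<partial>lborel)"
      by (intro nn_integral_mono)
    also have "\<dots> = ennreal (?V powr (p - 1)) * (\<integral>\<^sup>+x. (\<integral>\<^sup>+t. ennreal (norm (finite_conv (K t) J y x) powr p) \<partial>M) \<partial>lborel)"
      by (intro nn_integral_cmult) measurable
    also have "(\<integral>\<^sup>+x. (\<integral>\<^sup>+t. ennreal (norm (finite_conv (K t) J y x) powr p) \<partial>M) \<partial>lborel) = (\<integral>\<^sup>+t. (\<integral>\<^sup>+x. ennreal (norm (finite_conv (K t) J y x) powr p) \<partial>lborel) \<partial>M)"
    proof -
      interpret L: pair_sigma_finite M lborel ..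
      show ?thesis by (rule L.Fubini') measurable
    qed
    also have "\<dots> \<le> (\<integral>\<^sup>+t. ennreal (B * ?S) \<partial>M)"
      using op J by (intro nn_integral_mono) (auto simp: conv_bounded_def)
    also have "\<dots> = ennreal (B * ?S) * ennreal ?V" by (simp add: emeasure_eq_measure)
    also have "ennreal (?V powr (p - 1)) * (ennreal (B * ?S) * ennreal ?V) = ennreal (?V powr p * B * ?S)"
    proof -
      have V: "?V powr (p - 1) * ?V = ?V powr p"
        using p by (cases "?V = 0") (auto simp: powr_diff)
      have eq: "?V powr p * B * ?S = ?V powr (p - 1) * (B * ?S * ?V)"
        unfolding V[symmetric] by (simp only: mult_ac)
      show ?thesis unfolding eq using B by (simp add: ennreal_mult sum_nonneg)
    qed
    finally show ?thesis by (simp add: mult_left_mono)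
  qed
  moreover have "(\<lambda>x. LINT t|M. K t x) \<in> borel_measurable borel" by measurable
  ultimately show ?thesis using B unfolding conv_bounded_def by auto
qed

text \<open>The series is an integral of \<open>K n / w n\<close> against the measure with mass
  \<open>w n\<close> at \<open>n\<close>: the rescaled kernels share the bound \<open>B\<close>, and
  the measure is finite. Adding kernels one by one would cost a factor \<open>2 powr p\<close> each
  time.\<close>

lemma conv_bounded_suminf:
  fixes K :: "nat \<Rightarrow> real \<Rightarrow> real"
  assumes p: "1 < p" and B: "0 \<le> B" and w: "\<And>n. 0 < w n" "summable w"
    and op: "\<And>n. conv_bounded p (K n) (B * w n powr p)"
    and int: "\<And>x. summable (\<lambda>n. \<bar>K n x\<bar>)"
  shows "conv_bounded p (\<lambda>x. \<Sum>n. K n x) ((\<Sum>n. w n) powr p * B)"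
proof -
  define M where "M = density (count_space UNIV) (\<lambda>n::nat. ennreal (w n))"
  have w0: "0 \<le> w n" for n using w(1) by (simp add: less_imp_le)
  have em: "emeasure M (space M) = ennreal (\<Sum>n. w n)"
    unfolding M_def using w w0
    by (simp add: emeasure_density nn_integral_count_space_nat suminf_ennreal2)
  interpret finite_measure M by standard (simp add: em)
  have meas: "measure M (space M) = (\<Sum>n. w n)"
    using em w0 w by (simp add: measure_def suminf_nonneg)
  have [measurable]: "K n \<in> borel_measurable borel" for n using op by (rule conv_bounded_measurable)
  define K' where "K' = (\<lambda>n x. K n x / w n)"
  have eq: "(LINT n|M. K' n x) = (\<Sum>n. K n x)" and int': "integrable M (\<lambda>n. K' n x)" for x
  proof -
    have "w n * K' n x = K n x" for n using w(1)[of n] by (simp add: K'_def)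
    moreover have "integrable (count_space UNIV) (\<lambda>n. K n x)"
      using int[of x] by (simp add: integrable_count_space_nat_iff)
    ultimately show "(LINT n|M. K' n x) = (\<Sum>n. K n x)" "integrable M (\<lambda>n. K' n x)"
      unfolding M_def using w0 by (simp_all add: integral_density integrable_density integral_count_space_nat)
  qed
  have "conv_bounded p (\<lambda>x. LINT n|M. K' n x) (measure M (space M) powr p * B)"
  proof (rule conv_bounded_integral[OF p B _ _ int'])
    have "(\<lambda>(n, x). K' n x) \<in> borel_measurable (count_space UNIV \<Otimes>\<^sub>M borel)"
      by (rule measurable_pair_measure_countable1) (auto simp: K'_def)
    then show "(\<lambda>(n, x). K' n x) \<in> borel_measurable (M \<Otimes>\<^sub>M borel)"
      unfolding M_def by (simp cong: measurable_cong_sets sets_pair_measure_cong)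
    fix n
    have "conv_bounded p (\<lambda>x. (1 / w n) * K n x) (\<bar>1 / w n\<bar> powr p * (B * w n powr p))"
      by (intro conv_bounded_cmult op)
    moreover have "\<bar>1 / w n\<bar> powr p * (B * w n powr p) = B" using w(1)[of n] by (simp add: powr_divide)
    moreover have "(\<lambda>x. (1 / w n) * K n x) = K' n" by (simp add: K'_def)
    ultimately show "conv_bounded p (K' n) B" by metis
  qed
  then show ?thesis by (simp add: eq meas)
qed

section \<open>Dirichlet kernels sin (t x) / x\<close>

definition dirichlet :: "real \<Rightarrow> real \<Rightarrow> real" where
  "dirichlet t x = t * sinc (t * x)"

lemma dirichlet_mult: "x * dirichlet t x = sin (t * x)"
  by (auto simp: dirichlet_def)

lemma abs_sinc_le: "\<bar>sinc x\<bar> \<le> 1"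
  using abs_sin_x_le_abs_x[of x] by (auto simp: divide_le_eq_1)

lemma dirichlet_bound: "0 \<le> t \<Longrightarrow> \<bar>dirichlet t x\<bar> \<le> t"
  unfolding dirichlet_def abs_mult using abs_sinc_le[of "t * x"] by (simp add: mult_left_le)

lemma dirichlet_measurable [measurable]: "(\<lambda>x. dirichlet t x) \<in> borel_measurable borel"
proof -
  have "continuous_on UNIV (\<lambda>x. t * sinc (t * x))" by (intro continuous_intros)
  then show ?thesis unfolding dirichlet_def[abs_def] by (rule borel_measurable_continuous_onI)
qed

text \<open>With n = floor x, the addition theorem writes sin(t (x - j)) as a combination of cos(t
  j) and sin(t j) whose coefficients have modulus at most 1 and do not depend on \<open>j\<close>.
  So up to a Poisson error the kernel acts as the discrete Hilbert transform of the modulated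
  sequences \<open>c\<close> and \<open>s\<close>, whose entries are no larger than those of
  \<open>y\<close>. Only the error grows with \<open>t\<close>.\<close>

lemma conv_bounded_dirichlet:
  fixes p :: real
  assumes p: "1 < p"
  shows "\<exists>C\<ge>0. \<forall>t\<ge>0. conv_bounded p (dirichlet t) (C * (1 + t) powr p)"
proof -
  obtain C where C: "C \<ge> 0" and bd: "\<And>J N y. finite J \<Longrightarrow> finite N \<Longrightarrow>
    (\<Sum>n\<in>N. norm (discrete_hilbert J y n :: complex) powr p) \<le> C * (\<Sum>j\<in>J. norm (y j) powr p)"
    using discrete_hilbert_complex_bounded[OF p] by blast
  \<comment> \<open>Two applications of \<open>powr_sum_le\<close> give the outer and the inner
    \<open>2 powr p\<close>; the last term belongs to the Poisson error.\<close>
  define C' where "C' = 2 powr p * (2 powr p * (C + C) + 3 powr p * poisson_sum powr p)"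
  have C'0: "0 \<le> C'" using C by (simp add: C'_def)
  have "conv_bounded p (dirichlet t) (C' * (1 + t) powr p)" if t: "0 \<le> t" for t
    unfolding conv_bounded_def
  proof (intro conjI allI impI)
    show "0 \<le> C' * (1 + t) powr p" using C'0 by simp
    show "dirichlet t \<in> borel_measurable borel" using dirichlet_measurable by simp
    fix J :: "int set" and y :: "int \<Rightarrow> complex"
    assume J: "finite J"
    let ?S = "\<Sum>j\<in>J. norm (y j) powr p"
    have S: "0 \<le> ?S" by (simp add: sum_nonneg)
    define c where "c = (\<lambda>j::int. cos (t * of_int j) *\<^sub>R y j)"
    define s where "s = (\<lambda>j::int. sin (t * of_int j) *\<^sub>R y j)"
    define w where "w = (\<lambda>n. \<Sum>j\<in>J. norm (y j) * poisson (of_int (n - j)))"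
    have w0: "0 \<le> w n" for n using poisson_pos by (auto simp: w_def less_imp_le intro!: sum_nonneg)
    define f where "f = (\<lambda>n. (norm (discrete_hilbert J c n) + norm (discrete_hilbert J s n) + 3 * (1 + t) * w n) powr p)"
    show "(\<integral>\<^sup>+x. ennreal (norm (finite_conv (dirichlet t) J y x) powr p) \<partial>lborel) \<le> ennreal (C' * (1 + t) powr p * ?S)"
    proof (rule nn_integral_floor_le[where f = "\<lambda>n. ennreal (f n)"])
      fix x :: real
      define n where "n = \<lfloor>x\<rfloor>"
      have d: "\<bar>(x - of_int j) - of_int (n - j)\<bar> \<le> 1" for j :: int unfolding n_def using floor_correct[of x] by simp linarith
      \<comment> \<open>Two errors: replacing 1 / u by \<open>conj_poisson u\<close> leaves exactly
        \<open>dirichlet t u * poisson u\<close>, and moving from \<open>u\<close> to the integer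
        \<open>v\<close> costs a Poisson term.\<close>
      have kb: "\<bar>dirichlet t (x - of_int j) - sin (t * (x - of_int j)) * conj_poisson (of_int (n - j))\<bar> \<le> 3 * (1 + t) * poisson (of_int (n - j))" for j :: int
      proof -
        define u v where "u = x - of_int j" and "v = real_of_int (n - j)"
        have uv: "\<bar>u - v\<bar> \<le> 1" using d[of j] by (simp add: u_def v_def)
        have "dirichlet t u - sin (t * u) * conj_poisson u = dirichlet t u * poisson u"
          using sq_plus_1_pos[of u, THEN less_imp_neq]
          by (simp add: dirichlet_mult[symmetric] conj_poisson_def poisson_def divide_simps) (simp add: algebra_simps power2_eq_square)
        then have "\<bar>dirichlet t u - sin (t * u) * conj_poisson u\<bar> = \<bar>dirichlet t u\<bar> * poisson u"
          using poisson_pos[of u] by (simp add: abs_mult)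
        also have "\<dots> \<le> t * (3 * poisson v)"
          using dirichlet_bound[OF t] poisson_le_shift[OF uv] poisson_pos[of u] t by (intro mult_mono) (auto simp: less_imp_le)
        finally have 1: "\<bar>dirichlet t u - sin (t * u) * conj_poisson u\<bar> \<le> t * (3 * poisson v)" .
        have "\<bar>sin (t * u) * (conj_poisson u - conj_poisson v)\<bar> \<le> 1 * (2 * poisson v)"
          unfolding abs_mult using conj_poisson_shift[OF uv] by (intro mult_mono) auto
        then have "\<bar>dirichlet t u - sin (t * u) * conj_poisson v\<bar> \<le> t * (3 * poisson v) + 2 * poisson v"
          using 1 by (simp add: right_diff_distrib)
        also have "\<dots> \<le> 3 * (1 + t) * poisson v" using poisson_pos[of v] by (simp add: algebra_simps)
        finally show ?thesis by (simp add: u_def v_def)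
      qed
      have rem: "norm (finite_conv (dirichlet t) J y x - (\<Sum>j\<in>J. (sin (t * (x - of_int j)) * conj_poisson (of_int (n - j))) *\<^sub>R y j)) \<le> 3 * (1 + t) * w n"
        unfolding finite_conv_def sum_subtractf[symmetric] scaleR_diff_left[symmetric] w_def sum_distrib_left
      proof (rule sum_norm_le)
        fix j
        show "norm ((dirichlet t (x - of_int j) - sin (t * (x - of_int j)) * conj_poisson (of_int (n - j))) *\<^sub>R y j)
            \<le> 3 * (1 + t) * (norm (y j) * poisson (of_int (n - j)))"
          unfolding norm_scaleR using mult_right_mono[OF kb[of j] norm_ge_zero[of "y j"]] by (simp only: mult_ac)
      qed
      have "(\<Sum>j\<in>J. (sin (t * (x - of_int j)) * conj_poisson (of_int (n - j))) *\<^sub>R y j) = sin (t * x) *\<^sub>R discrete_hilbert J c n - cos (t * x) *\<^sub>R discrete_hilbert J s n"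
        unfolding discrete_hilbert_def scaleR_sum_right sum_subtractf[symmetric] c_def s_def
      proof (intro sum.cong refl)
        fix j
        have "sin (t * (x - of_int j)) = sin (t * x) * cos (t * of_int j) - cos (t * x) * sin (t * of_int j)"
          by (simp add: right_diff_distrib sin_diff)
        show "(sin (t * (x - of_int j)) * conj_poisson (of_int (n - j))) *\<^sub>R y j =
            sin (t * x) *\<^sub>R conj_poisson (of_int (n - j)) *\<^sub>R cos (t * of_int j) *\<^sub>R y j -
            cos (t * x) *\<^sub>R conj_poisson (of_int (n - j)) *\<^sub>R sin (t * of_int j) *\<^sub>R y j"
          unfolding \<open>sin (t * (x - of_int j)) = _\<close> left_diff_distrib scaleR_diff_left scaleR_scaleR by (simp only: mult_ac)
      qed
      moreover have "norm (sin (t * x) *\<^sub>R discrete_hilbert J c n - cos (t * x) *\<^sub>R discrete_hilbert J s n) \<le> 1 * norm (discrete_hilbert J c n) + 1 * norm (discrete_hilbert J s n)"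
        by (rule order_trans[OF norm_triangle_ineq4], unfold norm_scaleR, intro add_mono mult_right_mono) auto
      ultimately have "norm (\<Sum>j\<in>J. (sin (t * (x - of_int j)) * conj_poisson (of_int (n - j))) *\<^sub>R y j)
          \<le> norm (discrete_hilbert J c n) + norm (discrete_hilbert J s n)" by (simp only: mult_1_left)
      from order_trans[OF norm_triangle_sub add_mono[OF this rem]]
      have "norm (finite_conv (dirichlet t) J y x) \<le> norm (discrete_hilbert J c n) + norm (discrete_hilbert J s n) + 3 * (1 + t) * w n" .
      then show "ennreal (norm (finite_conv (dirichlet t) J y x) powr p) \<le> ennreal (f \<lfloor>x\<rfloor>)"
        unfolding f_def n_def[symmetric] using p by (intro ennreal_leI powr_mono2) auto
    next
      fix N assume N: "finite (N :: int set)"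
      have "f n \<le> 2 powr p * (2 powr p * (norm (discrete_hilbert J c n) powr p + norm (discrete_hilbert J s n) powr p) + 3 powr p * (1 + t) powr p * w n powr p)" for n
      proof -
        have "f n \<le> 2 powr p * ((norm (discrete_hilbert J c n) + norm (discrete_hilbert J s n)) powr p + (3 * (1 + t) * w n) powr p)"
          unfolding f_def using p t w0 by (intro powr_sum_le) auto
        also have "\<dots> \<le> 2 powr p * (2 powr p * (norm (discrete_hilbert J c n) powr p + norm (discrete_hilbert J s n) powr p) + (3 * (1 + t) * w n) powr p)"
          using p by (intro mult_left_mono add_right_mono powr_sum_le) auto
        also have "(3 * (1 + t) * w n) powr p = 3 powr p * (1 + t) powr p * w n powr p"
          using t w0 by (simp add: powr_mult del: distrib_left_numeral)
        finally show ?thesis .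
      qed
      then have "(\<Sum>n\<in>N. f n) \<le> (\<Sum>n\<in>N. 2 powr p * (2 powr p * (norm (discrete_hilbert J c n) powr p + norm (discrete_hilbert J s n) powr p) + 3 powr p * (1 + t) powr p * w n powr p))"
        by (rule sum_mono)
      also have "\<dots> = 2 powr p * (2 powr p * ((\<Sum>n\<in>N. norm (discrete_hilbert J c n) powr p) + (\<Sum>n\<in>N. norm (discrete_hilbert J s n) powr p)) + 3 powr p * (1 + t) powr p * (\<Sum>n\<in>N. w n powr p))"
        by (simp add: sum_distrib_left[symmetric] sum.distrib)
      also have "\<dots> \<le> 2 powr p * (2 powr p * (C * ?S + C * ?S) + 3 powr p * (1 + t) powr p * (poisson_sum powr p * ?S))"
      proof (intro mult_left_mono add_mono)
        have "C * (\<Sum>j\<in>J. norm (c j) powr p) \<le> C * ?S"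
          using C p by (intro mult_left_mono sum_mono powr_mono2) (auto simp: c_def mult_left_le_one_le)
        then show "(\<Sum>n\<in>N. norm (discrete_hilbert J c n) powr p) \<le> C * ?S" using bd[OF J N, of c] by linarith
        have "C * (\<Sum>j\<in>J. norm (s j) powr p) \<le> C * ?S"
          using C p by (intro mult_left_mono sum_mono powr_mono2) (auto simp: s_def mult_left_le_one_le)
        then show "(\<Sum>n\<in>N. norm (discrete_hilbert J s n) powr p) \<le> C * ?S" using bd[OF J N, of s] by linarith
        show "(\<Sum>n\<in>N. w n powr p) \<le> poisson_sum powr p * ?S"
          unfolding w_def using p J N by (intro poisson_convolution_bound) auto
      qed (use t in auto)
      also have "\<dots> \<le> C' * (1 + t) powr p * ?S"
      proof -
        have "1 \<le> (1 + t) powr p" using t p by (simp add: ge_one_powr_ge_zero)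
        then have "1 * (2 powr p * (2 powr p * (C + C)) * ?S) \<le> (1 + t) powr p * (2 powr p * (2 powr p * (C + C)) * ?S)"
          using S C by (intro mult_right_mono) auto
        then show ?thesis by (simp add: C'_def algebra_simps)
      qed
      finally have "(\<Sum>n\<in>N. f n) \<le> C' * (1 + t) powr p * ?S" .
      then show "(\<Sum>n\<in>N. ennreal (f n)) \<le> ennreal (C' * (1 + t) powr p * ?S)"
        by (subst sum_ennreal) (auto simp: f_def ennreal_leI)
    qed
  qed
  then show ?thesis using C'0 by blast
qed

section \<open>Cosine integrals of monotone functions\<close>

lemma dirichlet_decay: "\<bar>x\<bar> * \<bar>dirichlet t x\<bar> \<le> 1"
  by (metis abs_mult abs_sin_le_one dirichlet_mult)

text \<open>For fixed \<open>x\<close>, cos (x \<xi>) is the \<xi>-derivative of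
  \<open>dirichlet \<xi> x\<close>, also at x = 0: the Dirichlet kernel is the cosine transform of
  the indicator of [0, t].\<close>

lemma integral_cos_dirichlet:
  assumes "s \<le> t"
  shows "(LINT \<xi>|lborel. cos (x * \<xi>) * indicator {s..t} \<xi>) = dirichlet t x - dirichlet s x"
proof (rule integral_FTC_Icc_real[OF assms])
  fix \<xi>
  show "((\<lambda>\<xi>. dirichlet \<xi> x) has_real_derivative cos (x * \<xi>)) (at \<xi>)"
  proof (cases "x = 0")
    case True
    then show ?thesis by (simp add: dirichlet_def)
  next
    case False
    then have "(\<lambda>\<xi>. dirichlet \<xi> x) = (\<lambda>\<xi>. sin (\<xi> * x) / x)" by (auto simp: dirichlet_def fun_eq_iff)
    moreover have "((\<lambda>\<xi>. sin (\<xi> * x) / x) has_real_derivative cos (x * \<xi>)) (at \<xi>)"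
      using False by (auto intro!: derivative_eq_intros simp: mult.commute)
    ultimately show ?thesis by simp
  qed
  show "isCont (\<lambda>\<xi>. cos (x * \<xi>)) \<xi>" by (intro continuous_intros)
qed

definition coskern :: "real \<Rightarrow> real \<Rightarrow> (real \<Rightarrow> real) \<Rightarrow> real \<Rightarrow> real" where
  "coskern a b f x = (LINT \<xi>:{a<..<b}|lborel. f \<xi> * cos (x * \<xi>))"

lemma coskern_cong:
  assumes "\<And>\<xi>. a < \<xi> \<Longrightarrow> \<xi> < b \<Longrightarrow> f \<xi> = g \<xi>"
  shows "coskern a b f = coskern a b g"
  unfolding coskern_def using assms by (intro ext set_lebesgue_integral_cong) auto

lemma monotone_extension_measurable:
  fixes f :: "real \<Rightarrow> real"
  assumes "(\<forall>x y. a < x \<longrightarrow> x \<le> y \<longrightarrow> y < b \<longrightarrow> f y \<le> f x) \<or> (\<forall>x y. a < x \<longrightarrow> x \<le> y \<longrightarrow> y < b \<longrightarrow> f x \<le> f y)"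
  shows "(\<lambda>\<xi>. indicator {a<..<b} \<xi> * f \<xi>) \<in> borel_measurable borel"
proof -
  have "f \<in> borel_measurable (restrict_space borel {a<..<b})"
    using assms
  proof
    assume "\<forall>x y. a < x \<longrightarrow> x \<le> y \<longrightarrow> y < b \<longrightarrow> f y \<le> f x"
    then have "(\<lambda>x. - f x) \<in> borel_measurable (restrict_space borel {a<..<b})"
      by (intro borel_measurable_mono_on_fnc) (auto simp: mono_on_def)
    then show ?thesis using borel_measurable_uminus_eq by blast
  next
    assume "\<forall>x y. a < x \<longrightarrow> x \<le> y \<longrightarrow> y < b \<longrightarrow> f x \<le> f y"
    then show ?thesis by (intro borel_measurable_mono_on_fnc) (auto simp: mono_on_def)
  qed
  then show ?thesis
    by (subst (asm) borel_measurable_restrict_space_iff) auto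
qed

text \<open>The set where a decreasing function exceeds \<open>u\<close> is an interval starting at
  \<open>a\<close>, up to endpoints; \<open>s\<close> is its other end, equal to \<open>a\<close> if
  the set is empty. Its cosine integral is a difference of two Dirichlet kernels.\<close>

lemma indicator_level_set_integral:
  fixes f :: "real \<Rightarrow> real"
  assumes ab: "a < b" and dec: "\<And>x y. a < x \<Longrightarrow> x \<le> y \<Longrightarrow> y < b \<Longrightarrow> f y \<le> f x"
    and [measurable]: "f \<in> borel_measurable borel"
  obtains s where "a \<le> s" "s \<le> b"
    "\<And>x. (LINT \<xi>|restrict_space lborel {a<..<b}. (if u < f \<xi> then 1 else 0) * cos (x * \<xi>)) = dirichlet s x - dirichlet a x"
proof -
  define E where "E = {\<xi>\<in>{a<..<b}. u < f \<xi>}"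
  have eqE: "(LINT \<xi>|restrict_space lborel {a<..<b}. (if u < f \<xi> then 1 else 0) * cos (x * \<xi>)) = (LINT \<xi>|lborel. cos (x * \<xi>) * indicator E \<xi>)" for x
    by (subst integral_restrict_space) (auto simp: E_def intro!: Bochner_Integration.integral_cong split: split_indicator)
  have bdd: "bdd_above E" by (auto simp: E_def intro!: bdd_aboveI[of _ b])
  define s where "s = (if E = {} then a else Sup E)"
  have s: "a \<le> s" "s \<le> b"
  proof -
    show "s \<le> b" using ab by (auto simp: s_def E_def intro!: cSup_least)
    show "a \<le> s"
    proof (cases "E = {}")
      case False
      then obtain e where "e \<in> E" by auto
      then have "a < e" "e \<le> Sup E" using bdd by (auto simp: E_def[symmetric] intro!: cSup_upper) (auto simp: E_def)
      then show ?thesis using False by (simp add: s_def)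
    qed (simp add: s_def)
  qed
  have "AE \<xi> in lborel. indicator E \<xi> = (indicator {a..s} \<xi> :: real)"
    using AE_lborel_singleton[of a] AE_lborel_singleton[of s]
  proof eventually_elim
    case (elim \<xi>)
    have "\<xi> \<in> E \<longleftrightarrow> \<xi> \<in> {a..s}"
    proof
      assume "\<xi> \<in> E"
      then show "\<xi> \<in> {a..s}" using cSup_upper[OF _ bdd] by (auto simp: s_def E_def)
    next
      assume x: "\<xi> \<in> {a..s}"
      then have lt: "a < \<xi>" "\<xi> < s" using elim by auto
      then have "E \<noteq> {}" by (auto simp: s_def)
      then obtain e where e: "e \<in> E" "\<xi> < e" using lt(2) less_cSup_iff[OF _ bdd] by (auto simp: s_def)
      then show "\<xi> \<in> E" using lt dec[of \<xi> e] by (auto simp: E_def)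
    qed
    then show ?case by (simp add: indicator_def)
  qed
  then have "(LINT \<xi>|lborel. cos (x * \<xi>) * indicator E \<xi>) = (LINT \<xi>|lborel. cos (x * \<xi>) * indicator {a..s} \<xi>)" for x
    by (intro integral_cong_AE) (auto simp: E_def)
  then show ?thesis
    using that[OF s] eqE integral_cos_dirichlet[OF s(1)] by simp
qed

text \<open>By Fubini's theorem the cosine transform is the integral over levels u in [0, m] of
  kernels \<open>dirichlet s - dirichlet a\<close>, with \<open>s\<close> \<le> \<open>b\<close>
  depending on u. The mass \<open>m\<close> gives \<open>m powr p\<close>, the difference of two
  kernels the rest; since each Dirichlet kernel is at most 1/|x|, the decay has constant 2
  m.\<close>

lemma coskern_antimono:
  fixes f :: "real \<Rightarrow> real" and p C m :: real
  assumes p: "1 < p" and C: "0 \<le> C" "\<And>t. 0 \<le> t \<Longrightarrow> conv_bounded p (dirichlet t) (C * (1 + t) powr p)"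
    and ab: "0 \<le> a" "a < b" and m: "0 \<le> m"
    and f: "\<And>x. a < x \<Longrightarrow> x < b \<Longrightarrow> 0 \<le> f x \<and> f x \<le> m"
    and dec: "\<And>x y. a < x \<Longrightarrow> x \<le> y \<Longrightarrow> y < b \<Longrightarrow> f y \<le> f x"
  shows "conv_bounded p (coskern a b f) (m powr p * (2 powr p * (2 * C * (1 + b) powr p)))"
    and "\<bar>x\<bar> * \<bar>coskern a b f x\<bar> \<le> 2 * m"
proof -
  define g where "g = (\<lambda>\<xi>. indicator {a<..<b} \<xi> * f \<xi>)"
  have [measurable]: "g \<in> borel_measurable borel"
    unfolding g_def using dec by (intro monotone_extension_measurable) blast
  have g: "\<And>x. a < x \<Longrightarrow> x < b \<Longrightarrow> 0 \<le> g x \<and> g x \<le> m" and gdec: "\<And>x y. a < x \<Longrightarrow> x \<le> y \<Longrightarrow> y < b \<Longrightarrow> g y \<le> g x"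
    using f dec by (auto simp: g_def)
  have fg: "coskern a b f = coskern a b g" by (rule coskern_cong) (simp add: g_def)
  define M1 where "M1 = restrict_space lborel {0..m}"
  define M2 where "M2 = restrict_space lborel {a<..<b}"
  interpret M1: finite_measure M1
    by (rule finite_measureI) (use ab m in \<open>simp add: M1_def emeasure_restrict_space space_restrict_space\<close>)
  interpret M2: finite_measure M2
    by (rule finite_measureI) (use ab m in \<open>simp add: M2_def emeasure_restrict_space space_restrict_space\<close>)
  interpret P: pair_sigma_finite M1 M2 ..
  interpret P': finite_measure "M1 \<Otimes>\<^sub>M M2" by (rule finite_measure_pair_measure) unfold_locales
  have meas1: "measure M1 (space M1) = m" using m by (simp add: M1_def measure_restrict_space space_restrict_space)
  have sp: "space M1 = {0..m}" "space M2 = {a<..<b}" by (simp_all add: M1_def M2_def space_restrict_space)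
  have [measurable]: "(\<lambda>u. u) \<in> borel_measurable M1" "(\<lambda>u. u) \<in> borel_measurable M2"
    by (auto simp: M1_def M2_def intro!: measurable_restrict_space1)
  define K where "K u x = (LINT \<xi>|M2. (if u < g \<xi> then 1 else 0) * cos (x * \<xi>))" for u x
  have gm [measurable]: "g \<in> borel_measurable M2" by (simp add: M2_def measurable_restrict_space1)
  have Keq: "\<exists>s\<ge>a. s \<le> b \<and> (\<forall>x. K u x = dirichlet s x - dirichlet a x)" for u
  proof -
    have gb: "g \<in> borel_measurable borel" by measurable
    show ?thesis
    proof (rule indicator_level_set_integral[where f = g and u = u, OF ab(2) gdec gb])
      fix s
      assume "a \<le> s" "s \<le> b"
        "\<And>x. (LINT \<xi>|restrict_space lborel {a<..<b}. (if u < g \<xi> then 1 else 0) * cos (x * \<xi>)) = dirichlet s x - dirichlet a x"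
      then show ?thesis unfolding K_def M2_def by blast
    qed
  qed
  \<comment> \<open>The layer-cake identity: \<open>g \<xi>\<close> is the length of the set of
    levels u in [0, m] below it.\<close>
  have inner: "(LINT u|M1. (if u < g \<xi> then 1 else 0) * cos (x * \<xi>)) = g \<xi> * cos (x * \<xi>)" if "\<xi> \<in> {a<..<b}" for \<xi> x
  proof -
    have "(LINT u|M1. (if u < g \<xi> then 1 else 0 :: real))
        = (LINT u|lborel. indicat_real {0..m} u *\<^sub>R (if u < g \<xi> then 1 else 0))"
      unfolding M1_def by (rule integral_restrict_space) simp
    also have "(\<lambda>u. indicat_real {0..m} u *\<^sub>R (if u < g \<xi> then 1 else 0)) = indicat_real {0..<g \<xi>}"
      using g[of \<xi>] that by (auto simp: fun_eq_iff indicator_def)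
    also have "(LINT u|lborel. indicat_real {0..<g \<xi>} u) = g \<xi>" using g[of \<xi>] that by simp
    finally show ?thesis by simp
  qed
  have int2: "integrable (M1 \<Otimes>\<^sub>M M2) (\<lambda>(u, \<xi>). (if u < g \<xi> then 1 else 0) * cos (x * \<xi>))" for x
  proof (rule P'.integrable_const_bound[of _ 1])
    show "(\<lambda>(u, \<xi>). (if u < g \<xi> then 1 else 0) * cos (x * \<xi>)) \<in> borel_measurable (M1 \<Otimes>\<^sub>M M2)" by measurable
  qed (auto simp: abs_mult)
  have cosk: "coskern a b g x = (LINT u|M1. K u x)" for x
  proof -
    have "coskern a b g x = (LINT \<xi>|M2. g \<xi> * cos (x * \<xi>))"
      unfolding coskern_def M2_def set_lebesgue_integral_def by (subst integral_restrict_space) auto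
    also have "\<dots> = (LINT \<xi>|M2. (LINT u|M1. (if u < g \<xi> then 1 else 0) * cos (x * \<xi>)))"
      by (intro Bochner_Integration.integral_cong refl inner[symmetric]) (simp add: sp)
    also have "\<dots> = (LINT u|M1. K u x)" unfolding K_def
      by (rule P.Fubini_integral) (use int2 in simp)
    finally show ?thesis .
  qed
  have intK: "integrable M1 (\<lambda>u. K u x)" for x
    using P.integrable_fst[OF int2[of x]] by (simp add: K_def)
  have "conv_bounded p (\<lambda>x. LINT u|M1. K u x) (measure M1 (space M1) powr p * (2 powr p * (2 * C * (1 + b) powr p)))"
  proof (rule M1.conv_bounded_integral[OF p _ _ _ intK])
    show "0 \<le> 2 powr p * (2 * C * (1 + b) powr p)" using C by simp
    show "(\<lambda>(u, x). K u x) \<in> borel_measurable (M1 \<Otimes>\<^sub>M borel)" unfolding K_def by measurable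
    fix u
    obtain s where s: "a \<le> s" "s \<le> b" "K u = (\<lambda>x. dirichlet s x - dirichlet a x)" using Keq[of u] by (auto simp: fun_eq_iff)
    have "conv_bounded p (\<lambda>x. dirichlet s x - dirichlet a x) (2 powr p * (C * (1 + s) powr p + C * (1 + a) powr p))"
      using s ab by (intro conv_bounded_diff C p) auto
    moreover have "2 powr p * (C * (1 + s) powr p + C * (1 + a) powr p) \<le> 2 powr p * (C * (1 + b) powr p + C * (1 + b) powr p)"
      using s ab p C(1) by (intro mult_left_mono add_mono powr_mono2) auto
    ultimately show "conv_bounded p (K u) (2 powr p * (2 * C * (1 + b) powr p))"
      unfolding s(3) by (elim conv_bounded_mono) (simp add: mult.assoc)
  qed
  then show "conv_bounded p (coskern a b f) (m powr p * (2 powr p * (2 * C * (1 + b) powr p)))"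
    by (simp add: fg cosk[abs_def] meas1)
  have "\<bar>x\<bar> * \<bar>K u x\<bar> \<le> 2" for u
  proof -
    obtain s where s: "K u x = dirichlet s x - dirichlet a x" using Keq[of u] by auto
    have "\<bar>x\<bar> * \<bar>K u x\<bar> \<le> \<bar>x\<bar> * (\<bar>dirichlet s x\<bar> + \<bar>dirichlet a x\<bar>)" unfolding s by (intro mult_left_mono abs_triangle_ineq4) auto
    also have "\<dots> \<le> 2" using dirichlet_decay[of x s] dirichlet_decay[of x a] by (simp add: distrib_left)
    finally show ?thesis .
  qed
  then have "(LINT u|M1. \<bar>x\<bar> * \<bar>K u x\<bar>) \<le> (LINT u|M1. 2)" using intK by (intro integral_mono) auto
  then have "\<bar>x\<bar> * (LINT u|M1. \<bar>K u x\<bar>) \<le> 2 * m" by (simp add: meas1)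
  moreover have "\<bar>coskern a b f x\<bar> \<le> (LINT u|M1. \<bar>K u x\<bar>)" unfolding fg cosk by (rule integral_abs_bound)
  ultimately show "\<bar>x\<bar> * \<bar>coskern a b f x\<bar> \<le> 2 * m" by (meson abs_ge_zero mult_left_mono order_trans)
qed

lemma coskern_diff:
  assumes f: "f \<in> borel_measurable borel" "\<And>x. a < x \<Longrightarrow> x < b \<Longrightarrow> \<bar>f x\<bar> \<le> m"
    and g: "g \<in> borel_measurable borel" "\<And>x. a < x \<Longrightarrow> x < b \<Longrightarrow> \<bar>g x\<bar> \<le> m'"
  shows "coskern a b (\<lambda>\<xi>. f \<xi> - g \<xi>) x = coskern a b f x - coskern a b g x"
proof -
  have int: "set_integrable lborel {a<..<b} (\<lambda>\<xi>. f \<xi> * cos (x * \<xi>))"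
    if [measurable]: "f \<in> borel_measurable borel" and b: "\<And>x. a < x \<Longrightarrow> x < b \<Longrightarrow> \<bar>f x\<bar> \<le> m" for f :: "real \<Rightarrow> real" and m
    unfolding set_integrable_def
  proof (rule integrableI_bounded_set[where A = "{a<..<b}" and B = "\<bar>m\<bar>"])
    show "AE \<xi> in lborel. \<xi> \<in> {a<..<b} \<longrightarrow> norm (indicat_real {a<..<b} \<xi> *\<^sub>R (f \<xi> * cos (x * \<xi>))) \<le> \<bar>m\<bar>"
    proof (intro AE_I2 impI)
      fix \<xi> assume "\<xi> \<in> {a<..<b}"
      then have "\<bar>f \<xi>\<bar> * \<bar>cos (x * \<xi>)\<bar> \<le> \<bar>m\<bar> * 1" using b[of \<xi>] by (intro mult_mono) auto
      then show "norm (indicat_real {a<..<b} \<xi> *\<^sub>R (f \<xi> * cos (x * \<xi>))) \<le> \<bar>m\<bar>" using \<open>\<xi> \<in> {a<..<b}\<close> by (simp add: abs_mult)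
    qed
    show "emeasure lborel {a<..<b} < \<infinity>" by (cases "a \<le> b") auto
  qed auto
  show ?thesis unfolding coskern_def left_diff_distrib
    by (rule set_integral_diff(2)[OF int[OF f] int[OF g]])
qed

text \<open>A product of a decreasing and an increasing function is the difference of two decreasing ones:
  \<open>D I = M D - D (M - I)\<close>.\<close>
lemma coskern_monotone_product:
  fixes D I :: "real \<Rightarrow> real" and p C :: real
  assumes p: "1 < p" and C: "0 \<le> C" "\<And>t. 0 \<le> t \<Longrightarrow> conv_bounded p (dirichlet t) (C * (1 + t) powr p)"
    and ab: "0 \<le> a" "a < b" and m: "0 \<le> m1" "0 \<le> m2"
    and D: "\<And>x. a < x \<Longrightarrow> x < b \<Longrightarrow> 0 \<le> D x \<and> D x \<le> m1"
    and I: "\<And>x. a < x \<Longrightarrow> x < b \<Longrightarrow> 0 \<le> I x \<and> I x \<le> m2"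
    and dec: "\<And>x y. a < x \<Longrightarrow> x \<le> y \<Longrightarrow> y < b \<Longrightarrow> D y \<le> D x"
    and inc: "\<And>x y. a < x \<Longrightarrow> x \<le> y \<Longrightarrow> y < b \<Longrightarrow> I x \<le> I y"
  shows "conv_bounded p (coskern a b (\<lambda>\<xi>. D \<xi> * I \<xi>)) (2 powr p * (2 * ((m1 * m2) powr p * (2 powr p * (2 * C * (1 + b) powr p)))))" (is ?A)
    and "\<bar>x\<bar> * \<bar>coskern a b (\<lambda>\<xi>. D \<xi> * I \<xi>) x\<bar> \<le> 4 * (m1 * m2)" (is ?B)
proof -
  define f1 f2 where "f1 = (\<lambda>\<xi>. m2 * D \<xi>)" and "f2 = (\<lambda>\<xi>. D \<xi> * (m2 - I \<xi>))"
  have f1: "0 \<le> f1 x \<and> f1 x \<le> m1 * m2" if "a < x" "x < b" for x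
    using D[OF that] m mult_left_mono[of "D x" m1 m2] by (auto simp: f1_def mult.commute)
  have f2: "0 \<le> f2 x \<and> f2 x \<le> m1 * m2" if "a < x" "x < b" for x
    using D[OF that] I[OF that] m by (auto simp: f2_def intro!: mult_mono)
  have d1: "f1 y \<le> f1 x" if "a < x" "x \<le> y" "y < b" for x y
    using dec[OF that] m by (auto simp: f1_def mult_left_mono)
  have d2: "f2 y \<le> f2 x" if "a < x" "x \<le> y" "y < b" for x y
    unfolding f2_def using dec[OF that] inc[OF that] D[of x] D[of y] I[of y] that by (intro mult_mono) auto
  have mm: "0 \<le> m1 * m2" using m by simp
  let ?i = "indicator {a<..<b} :: real \<Rightarrow> real"
  have "coskern a b (\<lambda>\<xi>. D \<xi> * I \<xi>) = coskern a b (\<lambda>\<xi>. ?i \<xi> * f1 \<xi> - ?i \<xi> * f2 \<xi>)"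
    by (rule coskern_cong) (simp add: f1_def f2_def algebra_simps)
  also have "\<dots> = (\<lambda>x. coskern a b (\<lambda>\<xi>. ?i \<xi> * f1 \<xi>) x - coskern a b (\<lambda>\<xi>. ?i \<xi> * f2 \<xi>) x)"
    using f1 f2 d1 d2
    by (intro ext coskern_diff[where m = "m1 * m2" and m' = "m1 * m2"] monotone_extension_measurable) (blast | force)+
  also have "coskern a b (\<lambda>\<xi>. ?i \<xi> * f1 \<xi>) = coskern a b f1" by (rule coskern_cong) simp
  also have "coskern a b (\<lambda>\<xi>. ?i \<xi> * f2 \<xi>) = coskern a b f2" by (rule coskern_cong) simp
  finally have eq: "coskern a b (\<lambda>\<xi>. D \<xi> * I \<xi>) = (\<lambda>x. coskern a b f1 x - coskern a b f2 x)" .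
  note c1 = coskern_antimono[where f = f1, OF p C ab mm f1 d1]
  note c2 = coskern_antimono[where f = f2, OF p C ab mm f2 d2]
  show ?A unfolding eq using conv_bounded_diff[OF c1(1) c2(1) p] by (simp only: mult_2)
  have "\<bar>x\<bar> * \<bar>coskern a b f1 x - coskern a b f2 x\<bar> \<le> \<bar>x\<bar> * (\<bar>coskern a b f1 x\<bar> + \<bar>coskern a b f2 x\<bar>)"
    by (intro mult_left_mono abs_triangle_ineq4) auto
  then show ?B unfolding eq using c1(2)[of x] c2(2)[of x] by (simp add: distrib_left)
qed

section \<open>Quotients by periodizations\<close>

text \<open>The factor in the decay estimate of \<open>G\<close> for r = \<pi> and c = 1, hence a
  bound for \<open>G s / G pi\<close> shared by all c \<ge> 1.\<close>

definition tail_profile :: "real \<Rightarrow> real \<Rightarrow> real" where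
  "tail_profile m s = (s / pi) powr m * exp (pi - s)"

lemma tail_profile_nonneg: "0 \<le> tail_profile m s"
  by (simp add: tail_profile_def)

lemma tail_profile_le_inverse_square:
  obtains S where "\<And>s. S \<le> s \<Longrightarrow> tail_profile m s \<le> 1 / s\<^sup>2"
proof -
  have "((\<lambda>s::real. s\<^sup>2 * tail_profile m s) \<longlongrightarrow> 0) at_top"
    unfolding tail_profile_def by real_asymp
  then have "\<forall>\<^sub>F s in at_top. s\<^sup>2 * tail_profile m s < 1" by (rule order_tendstoD) simp
  then obtain S where S: "\<And>s. S \<le> s \<Longrightarrow> s\<^sup>2 * tail_profile m s < 1" unfolding eventually_at_top_linorder by blast
  show ?thesis
  proof (rule that[of "max S 1"])
    fix s assume "max S 1 \<le> s"
    then show "tail_profile m s \<le> 1 / s\<^sup>2" using S[of s] by (simp add: pos_le_divide_eq mult.commute)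
  qed
qed

text \<open>A profile may be unbounded near 0, so no upper bound is asked of the finitely many terms
  with |\<xi> + 2\<pi>j| < \<pi>; terms with large |j| are compared with 1 / j^2.\<close>

lemma summable_on_tail_profile_comparison:
  fixes f :: "int \<Rightarrow> real" and \<xi> :: real
  assumes f0: "\<And>j. 0 \<le> f j" and C: "0 \<le> C"
    and f: "\<And>j. pi \<le> \<bar>\<xi> + 2 * pi * of_int j\<bar> \<Longrightarrow> f j \<le> C * tail_profile m \<bar>\<xi> + 2 * pi * of_int j\<bar>"
  shows "f summable_on UNIV"
proof -
  obtain S where S: "\<And>s. S \<le> s \<Longrightarrow> tail_profile m s \<le> 1 / s\<^sup>2" using tail_profile_le_inverse_square by blast
  \<comment> \<open>For |j| \<ge> |\<xi>| the shifted point has modulus at least |j|, because 2\<pi>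
    > 6; 4 serves as a number above \<pi>.\<close>
  have est: "f j \<le> C * (1 / (of_int j)\<^sup>2)" if j: "max (max S 4) (\<bar>\<xi>\<bar>) \<le> of_int \<bar>j\<bar>" for j
  proof -
    have "2 * 3 * \<bar>real_of_int j\<bar> \<le> 2 * pi * \<bar>of_int j\<bar>" using pi_gt3 by (intro mult_right_mono) auto
    moreover have "\<bar>2 * pi * of_int j\<bar> = 2 * pi * \<bar>of_int j\<bar>" by (simp add: abs_mult)
    ultimately have le: "\<bar>of_int j\<bar> \<le> \<bar>\<xi> + 2 * pi * of_int j\<bar>" using j by linarith
    have "pi \<le> \<bar>\<xi> + 2 * pi * of_int j\<bar>" "S \<le> \<bar>\<xi> + 2 * pi * of_int j\<bar>" using le j pi_less_4 by auto
    then have fj: "f j \<le> C * tail_profile m \<bar>\<xi> + 2 * pi * of_int j\<bar>"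
      and "tail_profile m \<bar>\<xi> + 2 * pi * of_int j\<bar> \<le> 1 / \<bar>\<xi> + 2 * pi * of_int j\<bar>\<^sup>2"
      using f S by blast+
    note this(2)
    also have "1 / \<bar>\<xi> + 2 * pi * of_int j\<bar>\<^sup>2 \<le> 1 / \<bar>of_int j\<bar>\<^sup>2"
      using le j by (intro divide_left_mono power_mono mult_pos_pos zero_less_power) auto
    finally have "C * tail_profile m \<bar>\<xi> + 2 * pi * of_int j\<bar> \<le> C * (1 / \<bar>of_int j\<bar>\<^sup>2)"
      using C by (intro mult_left_mono)
    with fj show ?thesis unfolding power2_abs by (rule order_trans)
  qed
  have sm: "summable (\<lambda>n. C * (1 / (real n)\<^sup>2))"
    using inverse_power_summable[of 2, where 'a = real] by (intro summable_mult) (simp add: inverse_eq_divide)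
  show ?thesis
  proof (rule summable_on_int_abs[OF _ _ f0])
    have ev: "\<forall>\<^sub>F n in sequentially. max (max S 4) \<bar>\<xi>\<bar> \<le> real n"
      using filterlim_real_sequentially unfolding filterlim_at_top by blast
    show "summable (\<lambda>n. f (int n))"
    proof (rule summable_comparison_test_ev[OF _ sm])
      show "\<forall>\<^sub>F n in sequentially. norm (f (int n)) \<le> C * (1 / (real n)\<^sup>2)"
        using ev by eventually_elim (use est[of "int _"] f0 in auto)
    qed
    show "summable (\<lambda>n. f (- int n))"
    proof (rule summable_comparison_test_ev[OF _ sm])
      show "\<forall>\<^sub>F n in sequentially. norm (f (- int n)) \<le> C * (1 / (real n)\<^sup>2)"
        using ev by eventually_elim (use est[of "- int _"] f0 in auto)
    qed
  qed
qed

lemma tail_profile_summable_on: "(\<lambda>j::int. tail_profile m \<bar>\<xi> + 2 * pi * of_int j\<bar>) summable_on UNIV"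
  by (rule summable_on_tail_profile_comparison[of _ 1]) (auto simp: tail_profile_nonneg)

section \<open>Quotients of an even profile by its periodization\<close>

definition period_sum :: "(real \<Rightarrow> real) \<Rightarrow> real \<Rightarrow> real" where
  "period_sum G \<xi> = (\<Sum>\<^sub>\<infinity>j\<in>(UNIV::int set). G \<bar>\<xi> + 2 * pi * of_int j\<bar>)"

definition symb :: "(real \<Rightarrow> real) \<Rightarrow> real \<Rightarrow> real" where
  "symb G \<xi> = G \<bar>\<xi>\<bar> / period_sum G \<xi>"

lemma period_sum_minus: "period_sum G (- \<xi>) = period_sum G \<xi>"
proof -
  have "period_sum G \<xi> = (\<Sum>\<^sub>\<infinity>j\<in>(UNIV::int set). G \<bar>\<xi> + 2 * pi * of_int (- j)\<bar>)"
    unfolding period_sum_def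
    by (rule infsum_reindex_bij_betw[symmetric]) (auto intro!: o_bij[of uminus])
  also have "\<dots> = period_sum G (- \<xi>)"
    unfolding period_sum_def by (intro infsum_cong) (metis abs_minus_cancel add.inverse_inverse minus_add_distrib mult_minus_right of_int_minus)
  finally show ?thesis by simp
qed

lemma symb_minus: "symb G (- \<xi>) = symb G \<xi>"
  by (simp add: symb_def period_sum_minus)

text \<open>Excludes the multiples of 2\<pi>, where some term of the periodization would be
  evaluated at 0. They form a null set.\<close>

definition generic :: "real \<Rightarrow> bool" where "generic \<xi> \<longleftrightarrow> (\<forall>j::int. \<xi> + 2 * pi * of_int j \<noteq> 0)"

text \<open>Only the product of the two bounds enters the later estimates. The factors are left
  existential because they differ with the parity of the interval.\<close>

definition monotone_product :: "real \<Rightarrow> real \<Rightarrow> real \<Rightarrow> (real \<Rightarrow> real) \<Rightarrow> bool" where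
  "monotone_product a b M f \<longleftrightarrow> (\<exists>D I m1 m2. 0 \<le> m1 \<and> 0 \<le> m2 \<and> m1 * m2 = M \<and>
     (\<forall>x. a < x \<longrightarrow> x < b \<longrightarrow> (0 \<le> D x \<and> D x \<le> m1) \<and> (0 \<le> I x \<and> I x \<le> m2) \<and> f x = D x * I x) \<and>
     (\<forall>x y. a < x \<longrightarrow> x \<le> y \<longrightarrow> y < b \<longrightarrow> D y \<le> D x \<and> I x \<le> I y))"

lemma monotone_productI:
  assumes "0 \<le> m1" "0 \<le> m2" "m1 * m2 = M"
    and "\<And>x. a < x \<Longrightarrow> x < b \<Longrightarrow> 0 \<le> D x" "\<And>x. a < x \<Longrightarrow> x < b \<Longrightarrow> D x \<le> m1"
    and "\<And>x. a < x \<Longrightarrow> x < b \<Longrightarrow> 0 \<le> I x" "\<And>x. a < x \<Longrightarrow> x < b \<Longrightarrow> I x \<le> m2"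
    and "\<And>x. a < x \<Longrightarrow> x < b \<Longrightarrow> f x = D x * I x"
    and "\<And>x y. a < x \<Longrightarrow> x \<le> y \<Longrightarrow> y < b \<Longrightarrow> D y \<le> D x"
    and "\<And>x y. a < x \<Longrightarrow> x \<le> y \<Longrightarrow> y < b \<Longrightarrow> I x \<le> I y"
  shows "monotone_product a b M f"
  unfolding monotone_product_def
  by (rule exI[of _ D], rule exI[of _ I], rule exI[of _ m1], rule exI[of _ m2]) (use assms in auto)

text \<open>Bounds, relative to \<open>G pi\<close>, the sum of the terms with j \<ge> 1 on (0,
  \<pi>). The summand with \<open>0 +\<close> is the case \<xi> = 0 of the general summability
  statement.\<close>

definition tail_const :: "real \<Rightarrow> real" where "tail_const m = (\<Sum>\<^sub>\<infinity>j\<in>{1::int..}. tail_profile m \<bar>0 + 2 * pi * of_int j\<bar>)"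

lemma tail_const_nonneg: "0 \<le> tail_const m"
  unfolding tail_const_def by (intro infsum_nonneg tail_profile_nonneg)

text \<open>The exponent \<open>m\<close> is a parameter separate from \<open>c\<close>: bounds that
  depend on \<open>m\<close> alone are uniform in \<open>c\<close>.\<close>

locale cardinal_symbol =
  fixes G :: "real \<Rightarrow> real" and m c :: real
  assumes m: "0 \<le> m" and c: "1 \<le> c"
    and pos: "\<And>r. 0 < r \<Longrightarrow> 0 < G r"
    and anti: "\<And>r s. 0 < r \<Longrightarrow> r \<le> s \<Longrightarrow> G s \<le> G r"
    and decay: "\<And>r s. 0 < r \<Longrightarrow> r \<le> s \<Longrightarrow> G s \<le> (s / r) powr m * exp (- c * (s - r)) * G r"
begin

lemma G_le_tail_profile_c: "pi \<le> s \<Longrightarrow> G s \<le> (s / pi) powr m * exp (- c * (s - pi)) * G pi"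
  by (rule decay) auto

text \<open>Since c \<ge> 1 and s \<ge> \<pi>, lowering the rate from \<open>c\<close> to 1 only
  weakens the bound and removes \<open>c\<close> from it.\<close>

lemma G_le_tail_profile:
  assumes "pi \<le> s"
  shows "G s \<le> tail_profile m s * G pi"
proof -
  have "1 * (s - pi) \<le> c * (s - pi)" using c assms by (intro mult_right_mono) auto
  then have "(s / pi) powr m * exp (- c * (s - pi)) \<le> tail_profile m s"
    unfolding tail_profile_def by (intro mult_left_mono) auto
  then have "(s / pi) powr m * exp (- c * (s - pi)) * G pi \<le> tail_profile m s * G pi"
    using pos[of pi] by (intro mult_right_mono) auto
  then show ?thesis using G_le_tail_profile_c[OF assms] by linarith
qed

lemma term_pos: "generic \<xi> \<Longrightarrow> 0 < G \<bar>\<xi> + 2 * pi * of_int j\<bar>"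
  by (rule pos) (simp add: generic_def)

lemma terms_summable:
  assumes "generic \<xi>"
  shows "(\<lambda>j. G \<bar>\<xi> + 2 * pi * of_int j\<bar>) summable_on A"
proof -
  have "(\<lambda>j. G \<bar>\<xi> + 2 * pi * of_int j\<bar>) summable_on UNIV"
  proof (rule summable_on_tail_profile_comparison[of _ "G pi" \<xi> m])
    fix j :: int
    show "0 \<le> G \<bar>\<xi> + 2 * pi * of_int j\<bar>" using term_pos[OF assms] by (simp add: less_imp_le)
    assume "pi \<le> \<bar>\<xi> + 2 * pi * of_int j\<bar>"
    then show "G \<bar>\<xi> + 2 * pi * of_int j\<bar> \<le> G pi * tail_profile m \<bar>\<xi> + 2 * pi * of_int j\<bar>"
      using G_le_tail_profile by (simp add: mult.commute)
  qed (use pos[of pi] in simp)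
  then show ?thesis by (rule summable_on_subset) auto
qed

lemma term_le_infsum:
  assumes "generic \<xi>" "j \<in> A"
  shows "G \<bar>\<xi> + 2 * pi * of_int j\<bar> \<le> (\<Sum>\<^sub>\<infinity>j\<in>A. G \<bar>\<xi> + 2 * pi * of_int j\<bar>)"
proof -
  have "(\<Sum>j\<in>{j}. G \<bar>\<xi> + 2 * pi * of_int j\<bar>) \<le> (\<Sum>\<^sub>\<infinity>j\<in>A. G \<bar>\<xi> + 2 * pi * of_int j\<bar>)"
    using assms term_pos[OF assms(1)] by (intro finite_sum_le_infsum terms_summable) (auto simp: less_imp_le)
  then show ?thesis by simp
qed

lemma period_sum_ge: "generic \<xi> \<Longrightarrow> G \<bar>\<xi> + 2 * pi * of_int j\<bar> \<le> period_sum G \<xi>"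
  unfolding period_sum_def by (rule term_le_infsum) auto

lemma period_sum_pos: "generic \<xi> \<Longrightarrow> 0 < period_sum G \<xi>"
  using period_sum_ge[of \<xi> 0] term_pos[of \<xi> 0] by linarith

lemma symb_nonneg: "generic \<xi> \<Longrightarrow> 0 \<le> symb G \<xi>"
  using period_sum_pos[of \<xi>] term_pos[of \<xi> 0] by (simp add: symb_def)

lemma symb_le_1: "generic \<xi> \<Longrightarrow> symb G \<xi> \<le> 1"
  using period_sum_pos[of \<xi>] period_sum_ge[of \<xi> 0] by (simp add: symb_def)

text \<open>Rounding \<xi> / (2\<pi>) finds a translate in [-\<pi>, \<pi>], whose term alone is at
  least \<open>G pi\<close>. This lower bound of the denominator turns the decay of \<open>G\<close>
  beyond \<pi> into decay of \<open>symb G\<close>.\<close>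

lemma period_sum_ge_pi:
  assumes "generic \<xi>"
  shows "G pi \<le> period_sum G \<xi>"
proof -
  define j where "j = - round (\<xi> / (2 * pi))"
  have "\<bar>of_int (round (\<xi> / (2 * pi))) - \<xi> / (2 * pi)\<bar> \<le> 1 / 2" by (rule of_int_round_abs_le)
  then have "2 * pi * \<bar>of_int (round (\<xi> / (2 * pi))) - \<xi> / (2 * pi)\<bar> \<le> 2 * pi * (1 / 2)" by (intro mult_left_mono) auto
  moreover have "2 * pi * \<bar>of_int (round (\<xi> / (2 * pi))) - \<xi> / (2 * pi)\<bar> = \<bar>\<xi> + 2 * pi * of_int j\<bar>"
  proof -
    have "2 * pi * (of_int (round (\<xi> / (2 * pi))) - \<xi> / (2 * pi)) = - (\<xi> + 2 * pi * of_int j)"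
      by (simp add: j_def right_diff_distrib)
    then show ?thesis by (metis abs_minus_cancel abs_mult abs_of_pos mult_pos_pos pi_gt_zero zero_less_numeral)
  qed
  ultimately have "\<bar>\<xi> + 2 * pi * of_int j\<bar> \<le> pi" by simp
  then have "G pi \<le> G \<bar>\<xi> + 2 * pi * of_int j\<bar>" using assms by (intro anti) (auto simp: generic_def)
  then show ?thesis using period_sum_ge[OF assms, of j] by linarith
qed

lemma symb_decay:
  assumes "generic \<xi>" "pi \<le> \<xi>"
  shows "symb G \<xi> \<le> (\<xi> / pi) powr m * exp (- c * (\<xi> - pi))"
proof -
  have x: "0 < \<xi>" using assms pi_gt_zero by linarith
  have "symb G \<xi> \<le> G \<xi> / G pi"
    unfolding symb_def using period_sum_ge_pi[OF assms(1)] pos[of pi] pos[OF x] x by (auto intro!: divide_left_mono)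
  also have "\<dots> \<le> (\<xi> / pi) powr m * exp (- c * (\<xi> - pi))"
    using G_le_tail_profile_c[OF assms(2)] pos[of pi] by (simp add: divide_le_eq)
  finally show ?thesis .
qed

lemma symb_decay_tail_profile:
  assumes "generic \<xi>" "pi \<le> \<xi>"
  shows "symb G \<xi> \<le> tail_profile m \<xi>"
proof -
  have x: "0 < \<xi>" using assms pi_gt_zero by linarith
  have "symb G \<xi> \<le> G \<xi> / G pi"
    unfolding symb_def using period_sum_ge_pi[OF assms(1)] pos[of pi] pos[OF x] x by (auto intro!: divide_left_mono)
  also have "\<dots> \<le> tail_profile m \<xi>"
    using G_le_tail_profile[OF assms(2)] pos[of pi] by (simp add: divide_le_eq)
  finally show ?thesis .
qed

text \<open>The defect is the share of the translates with j \<noteq> 0. They lie at distance s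
  \<ge> 2\<pi> - \<xi> from 0, so the rate \<open>c\<close> splits into \<open>c - 1\<close>, which
  yields a factor exp(-2 (c - 1) (\<pi> - \<xi>)) common to all terms, and a rate 1 kept for
  summability. The remaining factor does not involve \<open>c\<close>.\<close>

lemma one_minus_symb:
  assumes g: "generic \<xi>" and x: "0 < \<xi>" "\<xi> < pi"
  shows "1 - symb G \<xi> \<le> exp (- (c - 1) * (2 * (pi - \<xi>))) * ((pi / \<xi>) powr m * exp (\<xi> - pi) * (\<Sum>\<^sub>\<infinity>j\<in>-{0::int}. tail_profile m \<bar>\<xi> + 2 * pi * of_int j\<bar>))"
proof -
  let ?T = "\<lambda>j. G \<bar>\<xi> + 2 * pi * of_int j\<bar>"
  let ?K = "exp (- (c - 1) * (2 * (pi - \<xi>))) * ((pi / \<xi>) powr m * exp (\<xi> - pi))"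
  let ?S = "\<Sum>\<^sub>\<infinity>j\<in>-{0::int}. tail_profile m \<bar>\<xi> + 2 * pi * of_int j\<bar>"
  have Gx: "0 < G \<xi>" using pos x by simp
  have sp: "period_sum G \<xi> = G \<xi> + infsum ?T (- {0})"
  proof -
    have "period_sum G \<xi> = infsum ?T ({0} \<union> - {0})" by (simp add: period_sum_def)
    also have "\<dots> = infsum ?T {0} + infsum ?T (- {0})"
      by (rule infsum_Un_disjoint) (auto intro!: terms_summable g)
    finally show ?thesis using x by simp
  qed
  have "infsum ?T (- {0}) \<le> (\<Sum>\<^sub>\<infinity>j\<in>-{0::int}. ?K * G \<xi> * tail_profile m \<bar>\<xi> + 2 * pi * of_int j\<bar>)"
  proof (rule infsum_mono)
    show "?T summable_on - {0}" by (rule terms_summable[OF g])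
    show "(\<lambda>j. ?K * G \<xi> * tail_profile m \<bar>\<xi> + 2 * pi * of_int j\<bar>) summable_on - {0}"
      by (intro summable_on_cmult_right summable_on_subset[OF tail_profile_summable_on]) auto
    fix j :: int assume j: "j \<in> - {0}"
    define s where "s = \<bar>\<xi> + 2 * pi * of_int j\<bar>"
    have "2 * pi * 1 \<le> 2 * pi * \<bar>real_of_int j\<bar>" using j by (intro mult_left_mono) auto
    moreover have "\<bar>2 * pi * real_of_int j\<bar> = 2 * pi * \<bar>of_int j\<bar>" by (simp add: abs_mult)
    ultimately have s: "2 * pi - \<xi> \<le> s" using x unfolding s_def by linarith
    then have s': "\<xi> \<le> s" "0 < s" using x by auto
    have "(c - 1) * (2 * (pi - \<xi>)) \<le> (c - 1) * (s - \<xi>)" using s c by (intro mult_left_mono) auto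
    then have e: "exp (- c * (s - \<xi>)) \<le> exp (- (c - 1) * (2 * (pi - \<xi>))) * exp (- (s - \<xi>))"
      by (simp add: exp_add[symmetric] algebra_simps)
    have "G s \<le> (s / \<xi>) powr m * exp (- c * (s - \<xi>)) * G \<xi>" using s' x by (intro decay) auto
    also have "\<dots> \<le> (s / \<xi>) powr m * (exp (- (c - 1) * (2 * (pi - \<xi>))) * exp (- (s - \<xi>))) * G \<xi>"
      using e Gx by (intro mult_right_mono mult_left_mono) auto
    also have "\<dots> = ?K * G \<xi> * tail_profile m s"
    proof -
      have 1: "(s / \<xi>) powr m = (pi / \<xi>) powr m * (s / pi) powr m" using s' x by (simp add: powr_divide)
      have 2: "exp (- (s - \<xi>)) = exp (\<xi> - pi) * exp (pi - s)" by (simp add: exp_add[symmetric])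
      show ?thesis unfolding tail_profile_def 1 2 by (simp only: mult_ac)
    qed
    finally show "?T j \<le> ?K * G \<xi> * tail_profile m \<bar>\<xi> + 2 * pi * of_int j\<bar>" by (simp only: s_def)
  qed
  also have "\<dots> = ?K * G \<xi> * ?S"
    by (intro infsum_cmult_right summable_on_subset[OF tail_profile_summable_on]) auto
  finally have R: "infsum ?T (- {0}) \<le> ?K * ?S * G \<xi>" by (simp only: mult_ac)
  have R0: "0 \<le> infsum ?T (- {0})" using term_pos[OF g] by (intro infsum_nonneg) (simp add: less_imp_le)
  have "1 - symb G \<xi> = infsum ?T (- {0}) / period_sum G \<xi>"
    using period_sum_pos[OF g] sp x by (simp add: symb_def field_simps)
  also have "\<dots> \<le> infsum ?T (- {0}) / G \<xi>"
    using R0 Gx sp by (intro divide_left_mono) auto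
  also have "\<dots> \<le> ?K * ?S" using R Gx by (simp add: divide_le_eq)
  finally show ?thesis by (simp only: mult_ac)
qed

section \<open>Decreasing and increasing parts of the periodization\<close>

definition Usum :: "nat \<Rightarrow> real \<Rightarrow> real" where
  "Usum k \<xi> = (\<Sum>\<^sub>\<infinity>j\<in>{- int k..}. G \<bar>\<xi> + 2 * pi * of_int j\<bar>)"

definition Vsum :: "nat \<Rightarrow> real \<Rightarrow> real" where
  "Vsum k \<xi> = (\<Sum>\<^sub>\<infinity>j\<in>{..<- int k}. G \<bar>\<xi> + 2 * pi * of_int j\<bar>)"

definition strip :: "nat \<Rightarrow> real set" where "strip k = {2 * pi * real k<..<2 * pi * real k + 2 * pi}"

lemma strip_pos: "\<xi> \<in> strip k \<Longrightarrow> - int k \<le> j \<Longrightarrow> 0 < \<xi> + 2 * pi * of_int j"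
proof -
  assume x: "\<xi> \<in> strip k" and "- int k \<le> j"
  then have "2 * pi * (- real k) \<le> 2 * pi * of_int j" by (intro mult_left_mono) auto
  then show ?thesis using x by (auto simp: strip_def)
qed

lemma strip_neg: "\<xi> \<in> strip k \<Longrightarrow> j < - int k \<Longrightarrow> \<xi> + 2 * pi * of_int j < 0"
proof -
  assume x: "\<xi> \<in> strip k" and "j < - int k"
  then have "2 * pi * of_int j \<le> 2 * pi * (- real k - 1)" by (intro mult_left_mono) auto
  then show ?thesis using x by (auto simp: strip_def algebra_simps)
qed

lemma strip_generic: "\<xi> \<in> strip k \<Longrightarrow> generic \<xi>"
  unfolding generic_def using strip_pos strip_neg by (metis less_irrefl not_le)

lemma strip_positive: "\<xi> \<in> strip k \<Longrightarrow> 0 < \<xi>"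
  using strip_pos[of \<xi> k 0] by simp

lemma period_sum_split:
  assumes "\<xi> \<in> strip k"
  shows "period_sum G \<xi> = Usum k \<xi> + Vsum k \<xi>"
proof -
  have "period_sum G \<xi> = infsum (\<lambda>j. G \<bar>\<xi> + 2 * pi * of_int j\<bar>) ({- int k..} \<union> {..<- int k})"
    unfolding period_sum_def by (rule arg_cong[where f = "infsum _"]) auto
  also have "\<dots> = Usum k \<xi> + Vsum k \<xi>" unfolding Usum_def Vsum_def
    by (intro infsum_Un_disjoint terms_summable strip_generic[OF assms]) auto
  finally show ?thesis .
qed

text \<open>In \<open>strip k\<close> the translates with j \<ge> -k are positive and move away from
  0 as the point grows, those with j < -k are negative and move towards 0; hence the cut at -k in
  \<open>Usum\<close> and \<open>Vsum\<close>.\<close>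

lemma Usum_antimono:
  assumes "x \<in> strip k" "y \<in> strip k" "x \<le> y"
  shows "Usum k y \<le> Usum k x"
  unfolding Usum_def
proof (intro infsum_mono terms_summable)
  fix j assume "j \<in> {- int k..}"
  then show "G \<bar>y + 2 * pi * of_int j\<bar> \<le> G \<bar>x + 2 * pi * of_int j\<bar>"
    using strip_pos[OF assms(1), of j] strip_pos[OF assms(2), of j] assms(3) by (intro anti) auto
qed (use assms strip_generic in auto)

lemma Vsum_mono:
  assumes "x \<in> strip k" "y \<in> strip k" "x \<le> y"
  shows "Vsum k x \<le> Vsum k y"
  unfolding Vsum_def
proof (intro infsum_mono terms_summable)
  fix j assume "j \<in> {..<- int k}"
  then show "G \<bar>x + 2 * pi * of_int j\<bar> \<le> G \<bar>y + 2 * pi * of_int j\<bar>"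
    using strip_neg[OF assms(1), of j] strip_neg[OF assms(2), of j] assms(3) by (intro anti) auto
qed (use assms strip_generic in auto)

lemma Usum_ge: "\<xi> \<in> strip k \<Longrightarrow> - int k \<le> j \<Longrightarrow> G (\<xi> + 2 * pi * of_int j) \<le> Usum k \<xi>"
  using term_le_infsum[OF strip_generic, of \<xi> k j "{- int k..}"] strip_pos[of \<xi> k j] by (simp add: Usum_def)

lemma Vsum_ge: "\<xi> \<in> strip k \<Longrightarrow> j < - int k \<Longrightarrow> G (- (\<xi> + 2 * pi * of_int j)) \<le> Vsum k \<xi>"
  using term_le_infsum[OF strip_generic, of \<xi> k j "{..<- int k}"] strip_neg[of \<xi> k j] by (simp add: Vsum_def)

lemma Usum_pos: "\<xi> \<in> strip k \<Longrightarrow> 0 < Usum k \<xi>"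
  using Usum_ge[of \<xi> k 0] pos[OF strip_positive] by fastforce

lemma Vsum_pos: "\<xi> \<in> strip k \<Longrightarrow> 0 < Vsum k \<xi>"
  using Vsum_ge[of \<xi> k "- int k - 1"] pos[of "- (\<xi> + 2 * pi * of_int (- int k - 1))"] strip_neg[of \<xi> k "- int k - 1"] by simp

lemma U_ratio_antimono:
  assumes "x \<in> strip k" "y \<in> strip k" "x \<le> y"
  shows "Usum k y / period_sum G y \<le> Usum k x / period_sum G x"
proof -
  have "Usum k y * Vsum k x \<le> Usum k x * Vsum k y"
    using Usum_antimono[OF assms] Vsum_mono[OF assms] Usum_pos assms Vsum_pos by (intro mult_mono) (auto simp: less_imp_le)
  then show ?thesis
    unfolding period_sum_split[OF assms(1)] period_sum_split[OF assms(2)]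
    using Usum_pos[OF assms(1)] Usum_pos[OF assms(2)] Vsum_pos[OF assms(1)] Vsum_pos[OF assms(2)]
    by (simp add: divide_simps) (simp add: algebra_simps)
qed

lemma V_ratio_mono:
  assumes "x \<in> strip k" "y \<in> strip k" "x \<le> y"
  shows "Vsum k x / period_sum G x \<le> Vsum k y / period_sum G y"
proof -
  have "Vsum k z / period_sum G z = 1 - Usum k z / period_sum G z" if "z \<in> strip k" for z
    using period_sum_split[OF that] period_sum_pos[OF strip_generic[OF that]] by (simp add: field_simps)
  then show ?thesis using U_ratio_antimono[OF assms] assms by simp
qed

lemma U_ratio_bounds: "\<xi> \<in> strip k \<Longrightarrow> 0 \<le> Usum k \<xi> / period_sum G \<xi> \<and> Usum k \<xi> / period_sum G \<xi> \<le> 1"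
  using period_sum_split[of \<xi> k] Usum_pos[of \<xi> k] Vsum_pos[of \<xi> k] by simp

lemma V_ratio_bounds: "\<xi> \<in> strip k \<Longrightarrow> 0 \<le> Vsum k \<xi> / period_sum G \<xi> \<and> Vsum k \<xi> / period_sum G \<xi> \<le> 1"
  using period_sum_split[of \<xi> k] Usum_pos[of \<xi> k] Vsum_pos[of \<xi> k] by simp

text \<open>On the nth interval \<open>G\<close> decreases. The translate closest to 0 belongs to
  \<open>Usum\<close> for even n and to \<open>Vsum\<close> for odd n, so that part is at least
  \<open>G pi\<close> and may be divided by. With P the whole sum, L = (G U / P) (1 / U) in the even
  case and L = (G / V) (V / P) in the odd case. The bound uses \<open>G\<close> at the left
  endpoint, which is why n > 0.\<close>

lemma symb_monotone_product:
  assumes n: "0 < n"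
  shows "monotone_product (pi * real n) (pi * real (n + 1)) (G (pi * real n) / G pi) (symb G)"
proof -
  let ?a = "pi * real n" and ?b = "pi * real (n + 1)"
  define k where "k = n div 2"
  have pn: "0 < ?a" using n by simp
  have Gn: "0 < G ?a" "0 < G pi" using pos pn by auto
  have Gle: "0 \<le> G x \<and> G x \<le> G ?a" if "?a < x" for x
    using that pn anti[of ?a x] pos[of x] by auto
  show ?thesis
  proof (cases "even n")
    case True
    then have nk: "real n = 2 * real k" by (auto simp: k_def elim!: evenE)
    have strip: "x \<in> strip k" if "?a < x" "x < ?b" for x
      using that by (auto simp: strip_def nk algebra_simps)
    have U: "G pi \<le> Usum k x" if "?a < x" "x < ?b" for x
    proof -
      have "G (x + 2 * pi * of_int (- int k)) \<le> Usum k x" by (rule Usum_ge[OF strip[OF that]]) simp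
      moreover have "G pi \<le> G (x + 2 * pi * of_int (- int k))"
        using that by (intro anti) (auto simp: nk algebra_simps)
      ultimately show ?thesis by linarith
    qed
    show ?thesis
    proof (rule monotone_productI[where D = "\<lambda>x. G x * (Usum k x / period_sum G x)" and I = "\<lambda>x. 1 / Usum k x" and ?m1.0 = "G ?a" and ?m2.0 = "1 / G pi"])
      fix x assume x: "?a < x" "x < ?b"
      note s = strip[OF x]
      show "0 \<le> G x * (Usum k x / period_sum G x)" using Gle[OF x(1)] U_ratio_bounds[OF s] by (intro mult_nonneg_nonneg) auto
      have "G x * (Usum k x / period_sum G x) \<le> G ?a * 1"
        using Gle[OF x(1)] U_ratio_bounds[OF s] Gn by (intro mult_mono) auto
      then show "G x * (Usum k x / period_sum G x) \<le> G ?a" by simp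
      show "0 \<le> 1 / Usum k x" using Usum_pos[OF s] by simp
      show "1 / Usum k x \<le> 1 / G pi" using U[OF x] Gn Usum_pos[OF s] by (intro divide_left_mono) auto
      show "symb G x = G x * (Usum k x / period_sum G x) * (1 / Usum k x)"
        using Usum_pos[OF s] strip_positive[OF s] by (simp add: symb_def)
    next
      fix x y assume xy: "?a < x" "x \<le> y" "y < ?b"
      then have s: "x \<in> strip k" "y \<in> strip k" using strip by auto
      show "G y * (Usum k y / period_sum G y) \<le> G x * (Usum k x / period_sum G x)"
        using Gle[of x] xy U_ratio_bounds[OF s(2)] U_ratio_antimono[OF s xy(2)] anti[OF strip_positive[OF s(1)] xy(2)]
        by (intro mult_mono) auto
      show "1 / Usum k x \<le> 1 / Usum k y"
        using Usum_antimono[OF s xy(2)] Usum_pos s by (intro divide_left_mono) auto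
    qed (use Gn in auto)
  next
    case False
    then have nk: "real n = 2 * real k + 1" by (auto simp: k_def elim!: oddE)
    have strip: "x \<in> strip k" if "?a < x" "x < ?b" for x
    proof -
      have "2 * pi * real k < ?a" by (simp add: nk algebra_simps)
      then have "2 * pi * real k < x" using that by linarith
      moreover have "x < 2 * pi * real k + 2 * pi" using that nk by (simp add: algebra_simps)
      ultimately show ?thesis by (simp add: strip_def)
    qed
    have V: "G pi \<le> Vsum k x" if "?a < x" "x < ?b" for x
    proof -
      have "G (- (x + 2 * pi * of_int (- int k - 1))) \<le> Vsum k x" by (rule Vsum_ge[OF strip[OF that]]) simp
      moreover have "G pi \<le> G (- (x + 2 * pi * of_int (- int k - 1)))"
        using that strip_neg[OF strip[OF that], of "- int k - 1"] by (intro anti) (auto simp: nk algebra_simps)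
      ultimately show ?thesis by linarith
    qed
    show ?thesis
    proof (rule monotone_productI[where D = "\<lambda>x. G x / Vsum k x" and I = "\<lambda>x. Vsum k x / period_sum G x" and ?m1.0 = "G ?a / G pi" and ?m2.0 = "1::real"])
      fix x assume x: "?a < x" "x < ?b"
      note s = strip[OF x]
      show "0 \<le> G x / Vsum k x" using Gle[OF x(1)] Vsum_pos[OF s] by simp
      show "G x / Vsum k x \<le> G ?a / G pi" using Gle[OF x(1)] V[OF x] Gn by (intro frac_le) auto
      show "0 \<le> Vsum k x / period_sum G x" "Vsum k x / period_sum G x \<le> 1" using V_ratio_bounds[OF s] by auto
      show "symb G x = G x / Vsum k x * (Vsum k x / period_sum G x)"
        using Vsum_pos[OF s] strip_positive[OF s] by (simp add: symb_def)
    next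
      fix x y assume xy: "?a < x" "x \<le> y" "y < ?b"
      then have s: "x \<in> strip k" "y \<in> strip k" using strip by auto
      show "G y / Vsum k y \<le> G x / Vsum k x"
        using Gle[of x] Gle[of y] xy anti[OF strip_positive[OF s(1)] xy(2)] Vsum_mono[OF s xy(2)] Vsum_pos[OF s(1)]
        by (intro frac_le) auto
      show "Vsum k x / period_sum G x \<le> Vsum k y / period_sum G y" by (rule V_ratio_mono[OF s xy(2)])
    qed (use Gn in auto)
  qed
qed

text \<open>The factorization used for n > 0 gives no bound at 0, where \<open>G\<close> may be
  unbounded. With \<open>R\<close> the sum over j \<ge> 1, one has G = U - R, hence L = U / P - (R U
  / P) (1 / U): the first term is decreasing and at most 1, and in the second \<open>R\<close> stays
  bounded near 0.\<close>

lemma symb_first_piece: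
  "\<exists>f g. (\<forall>x. 0 < x \<longrightarrow> x < pi \<longrightarrow> 0 \<le> f x \<and> f x \<le> 1 \<and> symb G x = f x - g x) \<and>
     (\<forall>x y. 0 < x \<longrightarrow> x \<le> y \<longrightarrow> y < pi \<longrightarrow> f y \<le> f x) \<and> monotone_product 0 pi (tail_const m) g"
proof -
  have strip: "x \<in> strip 0" if "0 < x" "x < pi" for x using that by (auto simp: strip_def)
  define R where "R x = (\<Sum>\<^sub>\<infinity>j\<in>{1::int..}. G \<bar>x + 2 * pi * of_int j\<bar>)" for x
  have UR: "Usum 0 x = G x + R x" if "0 < x" "x < pi" for x
  proof -
    have "{- int 0..} = {0} \<union> {1..}" by auto
    then have "Usum 0 x = infsum (\<lambda>j. G \<bar>x + 2 * pi * of_int j\<bar>) ({0} \<union> {1..})" by (simp add: Usum_def)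
    also have "\<dots> = infsum (\<lambda>j. G \<bar>x + 2 * pi * of_int j\<bar>) {0} + R x" unfolding R_def
      by (intro infsum_Un_disjoint terms_summable strip_generic[OF strip[OF that]]) auto
    finally show ?thesis using that by simp
  qed
  have R0: "0 \<le> R x" if "0 < x" "x < pi" for x
    unfolding R_def using term_pos[OF strip_generic[OF strip[OF that]]] by (intro infsum_nonneg) (simp add: less_imp_le)
  have Rdec: "R y \<le> R x" if "0 < x" "x \<le> y" "y < pi" for x y
    unfolding R_def
  proof (intro infsum_mono terms_summable)
    fix j :: int assume j: "j \<in> {1..}"
    have "0 \<le> 2 * pi * of_int j" using j by (intro mult_nonneg_nonneg) auto
    then show "G \<bar>y + 2 * pi * of_int j\<bar> \<le> G \<bar>x + 2 * pi * of_int j\<bar>" using that by (intro anti) auto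
  qed (use that in \<open>auto intro!: strip_generic strip\<close>)
  \<comment> \<open>Monotonicity compares \<open>R x\<close> with its terms at 0, where every
    argument 2\<pi>j is at least \<pi>.\<close>
  have Rle: "R x \<le> G pi * (tail_const m)" if "0 < x" "x < pi" for x
  proof -
    have "R x \<le> (\<Sum>\<^sub>\<infinity>j\<in>{1::int..}. G pi * tail_profile m \<bar>0 + 2 * pi * of_int j\<bar>)"
      unfolding R_def
    proof (intro infsum_mono terms_summable)
      show "(\<lambda>j::int. G pi * tail_profile m \<bar>0 + 2 * pi * of_int j\<bar>) summable_on {1..}"
        by (intro summable_on_cmult_right summable_on_subset[OF tail_profile_summable_on]) auto
      fix j :: int assume j: "j \<in> {1..}"
      have jj: "2 * pi * 1 \<le> 2 * pi * of_int j" using j by (intro mult_left_mono) auto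
      have jp: "pi \<le> \<bar>0 + 2 * pi * of_int j\<bar>" using jj pi_gt_zero by linarith
      have "G \<bar>x + 2 * pi * of_int j\<bar> \<le> G \<bar>0 + 2 * pi * of_int j\<bar>" using that jj pi_gt_zero by (intro anti) auto
      also have "\<dots> \<le> tail_profile m \<bar>0 + 2 * pi * of_int j\<bar> * G pi" by (rule G_le_tail_profile[OF jp])
      finally show "G \<bar>x + 2 * pi * of_int j\<bar> \<le> G pi * tail_profile m \<bar>0 + 2 * pi * of_int j\<bar>" by (simp only: mult.commute)
    qed (use that in \<open>auto intro!: strip_generic strip\<close>)
    also have "\<dots> = G pi * (tail_const m)" unfolding tail_const_def
      by (intro infsum_cmult_right summable_on_subset[OF tail_profile_summable_on]) auto
    finally show ?thesis .
  qed
  have Gpi: "0 < G pi" using pos by simp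
  have U: "G pi \<le> Usum 0 x" if "0 < x" "x < pi" for x
    using Usum_ge[OF strip[OF that], of 0] anti[of x pi] that by simp
  have "0 \<le> Usum 0 x / period_sum G x \<and> Usum 0 x / period_sum G x \<le> 1" if "0 < x" "x < pi" for x
      by (rule U_ratio_bounds[OF strip[OF that]])
  moreover have "Usum 0 y / period_sum G y \<le> Usum 0 x / period_sum G x" if "0 < x" "x \<le> y" "y < pi" for x y
      using that by (intro U_ratio_antimono strip) auto
  moreover have "symb G x = Usum 0 x / period_sum G x - R x * (Usum 0 x / period_sum G x) * (1 / Usum 0 x)" if "0 < x" "x < pi" for x
      using UR[OF that] Usum_pos[OF strip[OF that]] that by (simp add: symb_def diff_divide_distrib[symmetric])
  moreover have "monotone_product 0 pi (tail_const m) (\<lambda>x. (R x * (Usum 0 x / period_sum G x)) * (1 / Usum 0 x))"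
      proof (rule monotone_productI[where D = "\<lambda>x. R x * (Usum 0 x / period_sum G x)" and I = "\<lambda>x. 1 / Usum 0 x" and ?m1.0 = "G pi * (tail_const m)" and ?m2.0 = "1 / G pi"])
      fix x assume x: "0 < x" "x < pi"
      note s = strip[OF x]
      show "0 \<le> R x * (Usum 0 x / period_sum G x)" using R0[OF x] U_ratio_bounds[OF s] by (intro mult_nonneg_nonneg) auto
      have "R x * (Usum 0 x / period_sum G x) \<le> G pi * (tail_const m) * 1"
        using Rle[OF x] U_ratio_bounds[OF s] Gpi tail_const_nonneg by (intro mult_mono) auto
      then show "R x * (Usum 0 x / period_sum G x) \<le> G pi * (tail_const m)" by simp
      show "0 \<le> 1 / Usum 0 x" using Usum_pos[OF s] by simp
      show "1 / Usum 0 x \<le> 1 / G pi" using U[OF x] Gpi Usum_pos[OF s] by (intro divide_left_mono) auto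
    next
      fix x y assume xy: "0 < x" "x \<le> y" "y < pi"
      then have s: "x \<in> strip 0" "y \<in> strip 0" using strip by auto
      show "R y * (Usum 0 y / period_sum G y) \<le> R x * (Usum 0 x / period_sum G x)"
        using R0[of x] Rdec[OF xy] xy U_ratio_bounds[OF s(2)] U_ratio_antimono[OF s xy(2)]
        by (intro mult_mono) auto
      show "1 / Usum 0 x \<le> 1 / Usum 0 y"
        using Usum_antimono[OF s xy(2)] Usum_pos s by (intro divide_left_mono) auto
    qed (use Gpi tail_const_nonneg in auto)
  ultimately show ?thesis
    by - (rule exI[of _ "\<lambda>x. Usum 0 x / period_sum G x"], rule exI[of _ "\<lambda>x. (R x * (Usum 0 x / period_sum G x)) * (1 / Usum 0 x)"], blast)
qed

end

section \<open>Integrable majorants independent of c\<close>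

lemma set_integrable_exp_tail:
  fixes l a :: real
  assumes "0 < l"
  shows "set_integrable lborel {a..} (\<lambda>s. exp (- l * s))"
proof -
  have "(\<integral>\<^sup>+s. ennreal (exp (- l * s)) * indicator {a..} s \<partial>lborel) = ennreal (0 - - (exp (- l * a) / l))"
  proof (rule nn_integral_FTC_atLeast)
    show "((\<lambda>s. - (exp (- l * s) / l)) has_real_derivative exp (- l * s)) (at s)" for s
      using assms by (auto intro!: derivative_eq_intros)
    have "((\<lambda>s. exp (- l * s)) \<longlongrightarrow> 0) at_top" using assms by real_asymp
    from tendsto_minus[OF tendsto_divide[OF this tendsto_const[of l]]]
    show "((\<lambda>s. - (exp (- l * s) / l)) \<longlongrightarrow> 0) at_top" using assms by simp
  qed auto
  then have "(\<integral>\<^sup>+s. ennreal (indicator {a..} s * exp (- l * s)) \<partial>lborel) < \<infinity>"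
    by (simp add: mult.commute ennreal_mult' ennreal_indicator)
  then show ?thesis unfolding set_integrable_def real_scaleR_def
    by (intro integrableI_nonneg) auto
qed

text \<open>Half of the exponential absorbs the power, by ln x \<le> x - 1 applied to \<epsilon> s /
  \<pi>.\<close>

lemma tail_profile_le_exp:
  assumes "0 \<le> m"
  obtains K where "0 \<le> K" "\<And>s. 0 < s \<Longrightarrow> tail_profile m s \<le> K * exp (- (1 / 2) * s)"
proof -
  \<comment> \<open>This makes m \<epsilon> / \<pi> = m / (2 (m + 1)), which is at most 1/2.\<close>
  define \<epsilon> where "\<epsilon> = pi / (2 * (m + 1))"
  have e: "0 < \<epsilon>" using assms by (simp add: \<epsilon>_def)
  show ?thesis
  proof (rule that[of "exp (pi - m * ln \<epsilon>)"])
    fix s :: real assume s: "0 < s"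
    have "ln (\<epsilon> * (s / pi)) \<le> \<epsilon> * (s / pi) - 1" using e s by (intro ln_le_minus_one) auto
    moreover have "ln (\<epsilon> * (s / pi)) = ln \<epsilon> + ln (s / pi)" using e s by (intro ln_mult_pos) auto
    ultimately have "ln (s / pi) \<le> \<epsilon> * (s / pi) - ln \<epsilon>" by linarith
    then have "m * ln (s / pi) \<le> m * (\<epsilon> * (s / pi) - ln \<epsilon>)" using assms by (intro mult_left_mono)
    also have "\<dots> = (m / (m + 1)) * (s / 2) - m * ln \<epsilon>" using assms by (simp add: \<epsilon>_def right_diff_distrib)
    also have "\<dots> \<le> 1 * (s / 2) - m * ln \<epsilon>" using assms s by (intro diff_right_mono mult_right_mono) auto
    finally have "m * ln (s / pi) + (pi - s) \<le> (pi - m * ln \<epsilon>) + - (1 / 2) * s" by simp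
    then have "exp (m * ln (s / pi)) * exp (pi - s) \<le> exp (pi - m * ln \<epsilon>) * exp (- (1 / 2) * s)"
      by (simp only: exp_add[symmetric] exp_le_cancel_iff)
    then show "tail_profile m s \<le> exp (pi - m * ln \<epsilon>) * exp (- (1 / 2) * s)"
      using s by (simp add: tail_profile_def powr_def)
  qed simp
qed

text \<open>Dominates \<open>L\<close> on the positive half-line for every c \<ge> 1: by 1 up to
  \<pi>, by the decay of \<open>G\<close> beyond. It vanishes for \<xi> \<le> 0 to match
  \<open>symb_pos\<close>.\<close>

definition majorant :: "real \<Rightarrow> real \<Rightarrow> real" where
  "majorant m \<xi> = (if \<xi> \<le> 0 then 0 else if \<xi> \<le> pi then 1 else tail_profile m \<xi>)"

lemma majorant_measurable [measurable]: "majorant m \<in> borel_measurable borel"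
  unfolding majorant_def[abs_def] tail_profile_def by measurable

lemma majorant_nonneg: "0 \<le> majorant m \<xi>"
  by (simp add: majorant_def tail_profile_nonneg)

lemma majorant_integrable:
  assumes "0 \<le> m"
  shows "integrable lborel (majorant m)"
proof -
  obtain K where K: "0 \<le> K" "\<And>s. 0 < s \<Longrightarrow> tail_profile m s \<le> K * exp (- (1 / 2) * s)"
    using tail_profile_le_exp[OF assms] by blast
  have "integrable lborel (\<lambda>s. indicator {0..pi} s + K * (indicator {0..} s *\<^sub>R exp (- (1 / 2) * s)))"
    using set_integrable_exp_tail[of "1 / 2" 0] unfolding set_integrable_def
    by (intro Bochner_Integration.integrable_add integrable_mult_right) auto
  then show ?thesis
  proof (rule Bochner_Integration.integrable_bound)
    show "AE s in lborel. norm (majorant m s) \<le> norm (indicator {0..pi} s + K * (indicator {0..} s *\<^sub>R exp (- (1 / 2) * s)))"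
      using K by (intro AE_I2) (auto simp: majorant_def tail_profile_nonneg indicator_def abs_of_nonneg)
  qed simp
qed

section \<open>Intervals between consecutive multiples of pi\<close>

definition piece :: "nat \<Rightarrow> real set" where "piece n = {pi * real n<..<pi * real (n + 1)}"

lemma piece_disjoint: "i \<noteq> j \<Longrightarrow> piece i \<inter> piece j = {}"
proof -
  have *: "piece i \<inter> piece j = {}" if "i < j" for i j
  proof -
    have "pi * real (i + 1) \<le> pi * real j" using that by (intro mult_left_mono) auto
    then show ?thesis by (auto simp: piece_def)
  qed
  show "i \<noteq> j \<Longrightarrow> piece i \<inter> piece j = {}" using *[of i j] *[of j i] by (auto simp: neq_iff)
qed

lemma piece_cover:
  assumes "0 < \<xi>" "\<xi> \<notin> range (\<lambda>n. pi * real n)"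
  shows "\<xi> \<in> (\<Union>n. piece n)"
proof -
  define n where "n = nat \<lfloor>\<xi> / pi\<rfloor>"
  have n: "real n = of_int \<lfloor>\<xi> / pi\<rfloor>" using assms by (simp add: n_def)
  have "real n \<le> \<xi> / pi" "\<xi> / pi < real n + 1" unfolding n by linarith+
  then have "pi * real n \<le> \<xi>" "\<xi> < pi * real (n + 1)" by (simp_all add: field_simps)
  moreover have "pi * real n \<noteq> \<xi>" using assms(2) by auto
  ultimately have "\<xi> \<in> piece n" by (auto simp: piece_def)
  then show ?thesis by blast
qed

lemma piece_generic:
  assumes "\<xi> \<in> piece n"
  shows "generic \<xi>"
  unfolding generic_def
proof
  fix j :: int
  show "\<xi> + 2 * pi * of_int j \<noteq> 0"
  proof
    assume "\<xi> + 2 * pi * of_int j = 0"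
    then have "\<xi> = pi * of_int (- 2 * j)" by simp
    moreover have "pi * real n < \<xi>" "\<xi> < pi * real (n + 1)"
      using assms by (simp_all only: piece_def greaterThanLessThan_iff)
    ultimately have "real n < of_int (- 2 * j)" "of_int (- 2 * j) < real (n + 1)"
      by (simp_all only: mult_less_cancel_left_pos[OF pi_gt_zero])
    then have "real_of_int (int n) < of_int (- 2 * j)" "real_of_int (- 2 * j) < of_int (int n + 1)"
      by simp_all
    then have "int n < - 2 * j" "- 2 * j < int n + 1" by (simp_all only: of_int_less_iff)
    then show False by linarith
  qed
qed

lemma piece_pos: "\<xi> \<in> piece n \<Longrightarrow> 0 < \<xi>"
  unfolding piece_def greaterThanLessThan_iff
  by (rule le_less_trans[of 0 "pi * real n"]) auto

text \<open>For n > 0 a bound for \<open>G (pi * n) / G pi\<close>; for n = 0 the bound 1 of the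
  decreasing part plus that of the subtracted product.\<close>

definition piece_bound :: "real \<Rightarrow> nat \<Rightarrow> real" where
  "piece_bound m n = (if n = 0 then 1 + tail_const m else tail_profile m (pi * real n))"

text \<open>The second factor is 1 + b with b the right end of the interval; it comes from the
  growth of the Dirichlet bound \<open>C * (1 + t) powr p\<close> for t \<le> b.\<close>

definition piece_weight :: "real \<Rightarrow> nat \<Rightarrow> real" where
  "piece_weight m n = piece_bound m n * (1 + pi * real (n + 1))"

lemma piece_bound_pos: "0 < piece_bound m n"
  using tail_const_nonneg[of m] by (auto simp: piece_bound_def tail_profile_def)

lemma piece_weight_pos: "0 < piece_weight m n"
  unfolding piece_weight_def by (intro mult_pos_pos piece_bound_pos add_pos_nonneg) auto

lemma piece_weight_summable: "summable (piece_weight m)"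
proof (rule summable_comparison_test_ev)
  have "((\<lambda>n. (real n)\<^sup>2 * (tail_profile m (pi * real n) * (1 + pi * real (n + 1)))) \<longlongrightarrow> 0) sequentially"
    unfolding tail_profile_def by real_asymp
  then have "\<forall>\<^sub>F n in sequentially. (real n)\<^sup>2 * (tail_profile m (pi * real n) * (1 + pi * real (n + 1))) < 1"
    by (rule order_tendstoD) simp
  then show "\<forall>\<^sub>F n in sequentially. norm (piece_weight m n) \<le> 1 / (real n)\<^sup>2"
    using eventually_gt_at_top[of 0]
    by eventually_elim (use piece_weight_pos in \<open>auto simp: piece_weight_def piece_bound_def abs_of_pos pos_le_divide_eq mult.commute tail_profile_nonneg\<close>)
  show "summable (\<lambda>n. 1 / (real n)\<^sup>2)"
    using inverse_power_summable[of 2, where 'a = real] by (simp add: inverse_eq_divide)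
qed

lemma piece_bound_summable: "summable (piece_bound m)"
proof (rule summable_comparison_test[OF _ piece_weight_summable])
  have "piece_bound m n * 1 \<le> piece_bound m n * (1 + pi * real (n + 1))" for n
    using piece_bound_pos[of m n] by (intro mult_left_mono) auto
  then show "\<exists>N. \<forall>n\<ge>N. norm (piece_bound m n) \<le> piece_weight m n"
    using piece_bound_pos by (auto simp: piece_weight_def abs_of_pos)
qed

section \<open>The fundamental kernel as a sum over the intervals\<close>

context cardinal_symbol
begin

text \<open>\<open>L\<close> on the positive half-line, set to 0 at the multiples of \<pi>. Between
  them it is built from monotone functions, which gives measurability.\<close>

definition symb_pos :: "real \<Rightarrow> real" where "symb_pos \<xi> = indicator (\<Union>n. piece n) \<xi> * symb G \<xi>"

lemma monotone_product_measurable: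
  assumes "monotone_product a b M f"
  shows "(\<lambda>\<xi>. indicator {a<..<b} \<xi> * f \<xi>) \<in> borel_measurable borel"
proof -
  obtain D I m1 m2 where
    DI: "\<forall>x. a < x \<longrightarrow> x < b \<longrightarrow> (0 \<le> D x \<and> D x \<le> m1) \<and> (0 \<le> I x \<and> I x \<le> m2) \<and> f x = D x * I x"
    "\<forall>x y. a < x \<longrightarrow> x \<le> y \<longrightarrow> y < b \<longrightarrow> D y \<le> D x \<and> I x \<le> I y"
    using assms unfolding monotone_product_def by (elim exE conjE)
  have "(\<lambda>\<xi>. indicator {a<..<b} \<xi> * D \<xi>) \<in> borel_measurable borel" "(\<lambda>\<xi>. indicator {a<..<b} \<xi> * I \<xi>) \<in> borel_measurable borel"
    using DI(2) by (intro monotone_extension_measurable; blast)+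
  then have "(\<lambda>\<xi>. (indicator {a<..<b} \<xi> * D \<xi>) * (indicator {a<..<b} \<xi> * I \<xi>)) \<in> borel_measurable borel" by measurable
  moreover have "(\<lambda>\<xi>. (indicator {a<..<b} \<xi> * D \<xi>) * (indicator {a<..<b} \<xi> * I \<xi>)) = (\<lambda>\<xi>. indicator {a<..<b} \<xi> * f \<xi>)"
    using DI(1) by (auto simp: fun_eq_iff indicator_def)
  ultimately show ?thesis by simp
qed

lemma symb_piece_measurable: "(\<lambda>\<xi>. indicator (piece n) \<xi> * symb G \<xi>) \<in> borel_measurable borel"
proof (cases "n = 0")
  case True
  obtain f g where F: "\<forall>x. 0 < x \<longrightarrow> x < pi \<longrightarrow> 0 \<le> f x \<and> f x \<le> 1 \<and> symb G x = f x - g x"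
      "\<forall>x y. 0 < x \<longrightarrow> x \<le> y \<longrightarrow> y < pi \<longrightarrow> f y \<le> f x"
    and g: "monotone_product 0 pi (tail_const m) g"
    using symb_first_piece by (elim exE conjE)
  have f: "\<And>x y. 0 < x \<Longrightarrow> x \<le> y \<Longrightarrow> y < pi \<Longrightarrow> f y \<le> f x"
    and fg: "\<And>x. 0 < x \<Longrightarrow> x < pi \<Longrightarrow> symb G x = f x - g x"
    using F by blast+
  have "(\<lambda>\<xi>. indicator {0<..<pi} \<xi> * f \<xi> - indicator {0<..<pi} \<xi> * g \<xi>) \<in> borel_measurable borel"
  proof -
    have "(\<lambda>\<xi>. indicator {0<..<pi} \<xi> * f \<xi>) \<in> borel_measurable borel"
      using f by (intro monotone_extension_measurable) blast
    then show ?thesis using monotone_product_measurable[OF g] by (intro borel_measurable_diff)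
  qed
  moreover have "(\<lambda>\<xi>. indicator {0<..<pi} \<xi> * f \<xi> - indicator {0<..<pi} \<xi> * g \<xi>) = (\<lambda>\<xi>. indicator (piece n) \<xi> * symb G \<xi>)"
    using fg True by (auto simp: fun_eq_iff indicator_def piece_def)
  ultimately show ?thesis by simp
next
  case False
  then show ?thesis unfolding piece_def
    by (intro monotone_product_measurable[OF symb_monotone_product]) simp
qed

lemma symb_pos_measurable [measurable]: "symb_pos \<in> borel_measurable borel"
proof -
  have "(\<lambda>n. indicator (piece n) \<xi> * symb G \<xi>) sums symb_pos \<xi>" for \<xi>
    unfolding symb_pos_def by (intro sums_mult2 indicator_sums piece_disjoint)
  then have "symb_pos = (\<lambda>\<xi>. \<Sum>n. indicator (piece n) \<xi> * symb G \<xi>)" by (auto simp: fun_eq_iff sums_iff)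
  then show ?thesis using symb_piece_measurable by simp
qed

lemma symb_pos_bounds: "0 \<le> symb_pos \<xi> \<and> symb_pos \<xi> \<le> majorant m \<xi>"
proof (cases "\<xi> \<in> (\<Union>n. piece n)")
  case True
  then have g: "generic \<xi>" "0 < \<xi>" using piece_generic piece_pos by auto
  then show ?thesis using True symb_nonneg[OF g(1)] symb_le_1[OF g(1)] symb_decay_tail_profile[OF g(1)]
    by (auto simp: symb_pos_def majorant_def)
qed (simp add: symb_pos_def majorant_nonneg)

lemma symb_pos_integrable: "integrable lborel (\<lambda>\<xi>. symb_pos \<xi> * cos (x * \<xi>))"
proof (rule Bochner_Integration.integrable_bound[OF majorant_integrable[OF m]])
  have "\<bar>symb_pos \<xi>\<bar> * \<bar>cos (x * \<xi>)\<bar> \<le> \<bar>majorant m \<xi>\<bar> * 1" for \<xi>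
    using symb_pos_bounds[of \<xi>] by (intro mult_mono) auto
  then show "AE \<xi> in lborel. norm (symb_pos \<xi> * cos (x * \<xi>)) \<le> norm (majorant m \<xi>)"
    by (simp add: abs_mult)
qed measurable

text \<open>The inverse Fourier integral of the even function \<open>L\<close>: 1/(2\<pi>) times two
  equal halves, hence a real cosine integral.\<close>

definition fundamental_kernel :: "real \<Rightarrow> real" where
  "fundamental_kernel x = (1 / pi) * (LINT \<xi>|lborel. symb_pos \<xi> * cos (x * \<xi>))"

text \<open>The first bound feeds the uniform operator estimate, the second the domination by 1/|x|.
  One constant must serve all n in \<open>conv_bounded_suminf\<close>; its outer factors
  \<open>2 powr p\<close> and 2 are what the subtraction in the case n = 0 costs.\<close>

lemma piece_decay:
  assumes p: "1 < p" and C: "0 \<le> C" "\<And>t. 0 \<le> t \<Longrightarrow> conv_bounded p (dirichlet t) (C * (1 + t) powr p)"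
  shows "conv_bounded p (coskern (pi * real n) (pi * real (n + 1)) (symb G))
      (2 powr p * (2 * (2 powr p * (2 * (2 powr p * (2 * C))))) * piece_weight m n powr p)" (is ?A)
    and "\<bar>x\<bar> * \<bar>coskern (pi * real n) (pi * real (n + 1)) (symb G) x\<bar> \<le> 4 * piece_bound m n" (is ?B)
proof -
  let ?a = "pi * real n" and ?b = "pi * real (n + 1)"
  \<comment> \<open>The constant of \<open>coskern_monotone_product\<close> with the factor
    \<open>(M * (1 + b)) powr p\<close> taken out.\<close>
  define E where "E = 2 powr p * (2 * (2 powr p * (2 * C)))"
  have E0: "0 \<le> E" using C by (simp add: E_def)
  have two: "1 \<le> 2 powr p" using p by (simp add: ge_one_powr_ge_zero)
  have prod: "conv_bounded p (coskern a b f) (E * (M * (1 + b)) powr p) \<and> \<bar>x\<bar> * \<bar>coskern a b f x\<bar> \<le> 4 * M"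
    if mp: "monotone_product a b M f" and ab: "0 \<le> a" "a < b" for a b M f
  proof -
    obtain D I m1 m2 where mm: "0 \<le> m1" "0 \<le> m2" "m1 * m2 = M" and
      DI: "\<forall>x. a < x \<longrightarrow> x < b \<longrightarrow> (0 \<le> D x \<and> D x \<le> m1) \<and> (0 \<le> I x \<and> I x \<le> m2) \<and> f x = D x * I x"
      "\<forall>x y. a < x \<longrightarrow> x \<le> y \<longrightarrow> y < b \<longrightarrow> D y \<le> D x \<and> I x \<le> I y"
      using mp unfolding monotone_product_def by (elim exE conjE)
    have f: "coskern a b f = coskern a b (\<lambda>\<xi>. D \<xi> * I \<xi>)" using DI(1) by (intro coskern_cong) auto
    have M: "0 \<le> M" using mm by auto
    note c = coskern_monotone_product[where D = D and I = I, OF p C ab mm(1,2)]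
    have 1: "conv_bounded p (coskern a b f) (2 powr p * (2 * ((m1 * m2) powr p * (2 powr p * (2 * C * (1 + b) powr p)))))"
      unfolding f by (rule c(1)) (use DI in auto)
    have 2: "\<bar>x\<bar> * \<bar>coskern a b f x\<bar> \<le> 4 * (m1 * m2)"
      unfolding f by (rule c(2)) (use DI in auto)
    have "(M * (1 + b)) powr p = M powr p * (1 + b) powr p" using M ab by (simp add: powr_mult)
    then have "2 powr p * (2 * ((m1 * m2) powr p * (2 powr p * (2 * C * (1 + b) powr p)))) = E * (M * (1 + b)) powr p"
      unfolding mm(3) E_def by (simp only: mult_ac)
    then show ?thesis using 1 2 mm(3) by (simp only:)
  qed
  have mono: "E * u powr p \<le> 2 powr p * (2 * E) * piece_weight m n powr p" if "0 \<le> u" "u \<le> piece_weight m n" for u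
  proof -
    have "1 * E \<le> 2 powr p * (2 * E)" using two E0 by (intro mult_mono) auto
    then have "E \<le> 2 powr p * (2 * E)" by (simp only: mult_1_left)
    then show ?thesis using that p E0 by (intro mult_mono powr_mono2) auto
  qed
  have "?A \<and> ?B"
  proof (cases "n = 0")
    case False
    define M where "M = G ?a / G pi"
    have na: "pi * 1 \<le> ?a" using False by (intro mult_left_mono) auto
    have M: "0 \<le> M" "M \<le> piece_bound m n"
      using G_le_tail_profile[of ?a] na pos[of ?a] pos[of pi] pi_gt_zero False by (auto simp: M_def piece_bound_def divide_le_eq)
    note P = prod[OF symb_monotone_product[of n], folded M_def]
    have u: "0 \<le> M * (1 + ?b)" "M * (1 + ?b) \<le> piece_weight m n"
      using M unfolding piece_weight_def by (auto intro!: mult_right_mono mult_nonneg_nonneg)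
    have "conv_bounded p (coskern ?a ?b (symb G)) (E * (M * (1 + ?b)) powr p)" using P False by simp
    then have A: ?A using mono[OF u] unfolding E_def[symmetric] by (rule conv_bounded_mono)
    have "\<bar>x\<bar> * \<bar>coskern ?a ?b (symb G) x\<bar> \<le> 4 * M" using P False by simp
    then have ?B using M by linarith
    with A show ?thesis ..
  next
    case True
    obtain f g where F: "\<forall>x. 0 < x \<longrightarrow> x < pi \<longrightarrow> 0 \<le> f x \<and> f x \<le> 1 \<and> symb G x = f x - g x"
        "\<forall>x y. 0 < x \<longrightarrow> x \<le> y \<longrightarrow> y < pi \<longrightarrow> f y \<le> f x"
      and g: "monotone_product 0 pi (tail_const m) g"
      using symb_first_piece by (elim exE conjE)
    have f: "\<And>x. 0 < x \<Longrightarrow> x < pi \<Longrightarrow> 0 \<le> f x \<and> f x \<le> 1"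
        "\<And>x y. 0 < x \<Longrightarrow> x \<le> y \<Longrightarrow> y < pi \<Longrightarrow> f y \<le> f x"
      and fg: "\<And>x. 0 < x \<Longrightarrow> x < pi \<Longrightarrow> symb G x = f x - g x"
      using F by blast+
    have ab: "?a = 0" "?b = pi" using True by auto
    let ?i = "indicator {0<..<pi} :: real \<Rightarrow> real"
    have g_bd: "\<bar>g x\<bar> \<le> tail_const m" if "0 < x" "x < pi" for x
    proof -
      obtain D I m1 m2 where mm: "0 \<le> m1" "0 \<le> m2" "m1 * m2 = tail_const m"
        and DI: "\<forall>x. 0 < x \<longrightarrow> x < pi \<longrightarrow> (0 \<le> D x \<and> D x \<le> m1) \<and> (0 \<le> I x \<and> I x \<le> m2) \<and> g x = D x * I x"
        using g unfolding monotone_product_def by (elim exE conjE)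
      from DI that have "0 \<le> D x" "D x \<le> m1" "0 \<le> I x" "I x \<le> m2" "g x = D x * I x" by simp_all
      with mm show ?thesis using mult_mono[of "D x" m1 "I x" m2] by simp
    qed
    have "coskern 0 pi (symb G) = coskern 0 pi (\<lambda>\<xi>. ?i \<xi> * f \<xi> - ?i \<xi> * g \<xi>)"
      by (rule coskern_cong) (simp add: fg)
    also have "\<dots> = (\<lambda>x. coskern 0 pi (\<lambda>\<xi>. ?i \<xi> * f \<xi>) x - coskern 0 pi (\<lambda>\<xi>. ?i \<xi> * g \<xi>) x)"
    proof (rule ext, rule coskern_diff[where m = 1 and m' = "tail_const m"])
      show "(\<lambda>\<xi>. ?i \<xi> * f \<xi>) \<in> borel_measurable borel" using f(2) by (intro monotone_extension_measurable) blast
      show "(\<lambda>\<xi>. ?i \<xi> * g \<xi>) \<in> borel_measurable borel" by (rule monotone_product_measurable[OF g])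
    qed (use f(1) g_bd in auto)
    also have "coskern 0 pi (\<lambda>\<xi>. ?i \<xi> * f \<xi>) = coskern 0 pi f" by (rule coskern_cong) simp
    also have "coskern 0 pi (\<lambda>\<xi>. ?i \<xi> * g \<xi>) = coskern 0 pi g" by (rule coskern_cong) simp
    finally have eq: "coskern 0 pi (symb G) = (\<lambda>x. coskern 0 pi f x - coskern 0 pi g x)" .
    have c1: "conv_bounded p (coskern 0 pi f) (1 powr p * (2 powr p * (2 * C * (1 + pi) powr p)))"
      by (rule coskern_antimono(1)[OF p C]) (use f in auto)
    have c2: "\<bar>x\<bar> * \<bar>coskern 0 pi f x\<bar> \<le> 2 * 1"
      by (rule coskern_antimono(2)[OF p C]) (use f in auto)
    have pg: "conv_bounded p (coskern 0 pi g) (E * (tail_const m * (1 + pi)) powr p)" "\<bar>x\<bar> * \<bar>coskern 0 pi g x\<bar> \<le> 4 * tail_const m"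
      using prod[OF g] by auto
    have "conv_bounded p (coskern ?a ?b (symb G)) (2 powr p * (1 powr p * (2 powr p * (2 * C * (1 + pi) powr p)) + E * (tail_const m * (1 + pi)) powr p))"
      unfolding ab eq by (rule conv_bounded_diff[OF c1 pg(1) p])
    moreover have "2 powr p * (1 powr p * (2 powr p * (2 * C * (1 + pi) powr p)) + E * (tail_const m * (1 + pi)) powr p)
       \<le> 2 powr p * (2 * E) * piece_weight m n powr p"
    proof -
      have w: "piece_weight m n = (1 + tail_const m) * (1 + pi)" by (simp add: piece_weight_def piece_bound_def True)
      have "1 * (1 + pi) \<le> piece_weight m n" unfolding w using tail_const_nonneg by (intro mult_right_mono) auto
      then have a: "(1 + pi) powr p \<le> piece_weight m n powr p" using p by (intro powr_mono2) auto
      have "tail_const m * (1 + pi) \<le> piece_weight m n" unfolding w by (intro mult_right_mono) auto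
      then have b: "(tail_const m * (1 + pi)) powr p \<le> piece_weight m n powr p" using p tail_const_nonneg by (intro powr_mono2) auto
      have "1 * (2 * C) \<le> 2 powr p * (2 * C)" using C two by (intro mult_right_mono) auto
      moreover have "0 \<le> 2 powr p * (2 * C)" using C by simp
      ultimately have "2 * C \<le> 2 * (2 powr p * (2 * C))" by linarith
      then have "2 powr p * (2 * C) \<le> E" unfolding E_def by (rule mult_left_mono) simp
      then have "2 powr p * (2 * C) * (1 + pi) powr p \<le> E * piece_weight m n powr p" using a E0 by (intro mult_mono) auto
      moreover have "E * (tail_const m * (1 + pi)) powr p \<le> E * piece_weight m n powr p" using b E0 by (intro mult_left_mono)
      ultimately have "2 powr p * (2 * C) * (1 + pi) powr p + E * (tail_const m * (1 + pi)) powr p \<le> 2 * E * piece_weight m n powr p"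
        by linarith
      then have "2 powr p * (2 powr p * (2 * C) * (1 + pi) powr p + E * (tail_const m * (1 + pi)) powr p) \<le> 2 powr p * (2 * E * piece_weight m n powr p)"
        by (intro mult_left_mono) auto
      then show ?thesis by (simp only: powr_one_eq_one mult_1_left mult.assoc)
    qed
    ultimately have A: ?A unfolding E_def[symmetric] by (rule conv_bounded_mono)
    have "\<bar>x\<bar> * \<bar>coskern 0 pi f x - coskern 0 pi g x\<bar> \<le> \<bar>x\<bar> * (\<bar>coskern 0 pi f x\<bar> + \<bar>coskern 0 pi g x\<bar>)"
      by (intro mult_left_mono abs_triangle_ineq4) auto
    then have ?B unfolding ab eq using c2 pg(2) True by (simp add: distrib_left piece_bound_def)
    with A show ?thesis ..
  qed
  then show ?A and ?B by blast+
qed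

text \<open>Countable additivity over the disjoint intervals, outside of which
  \<open>symb_pos\<close> vanishes; absolute convergence holds since the nth term is at most the
  length \<pi> times \<open>piece_bound m n\<close>.\<close>

lemma fundamental_kernel_eq_suminf: "fundamental_kernel x = (1 / pi) * (\<Sum>n. coskern (pi * real n) (pi * real (n + 1)) (symb G) x)"
  and coskern_summable: "summable (\<lambda>n. \<bar>coskern (pi * real n) (pi * real (n + 1)) (symb G) x\<bar>)"
proof -
  have eq: "indicator (\<Union>n. piece n) \<xi> *\<^sub>R (symb G \<xi> * cos (x * \<xi>)) = symb_pos \<xi> * cos (x * \<xi>)" for \<xi>
    by (simp add: symb_pos_def)
  have ck: "coskern (pi * real n) (pi * real (n + 1)) (symb G) x = (LINT \<xi>:piece n|lborel. symb G \<xi> * cos (x * \<xi>))" for n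
    by (simp only: coskern_def piece_def)
  have "(LINT \<xi>|lborel. symb_pos \<xi> * cos (x * \<xi>)) = (LINT \<xi>:(\<Union>n. piece n)|lborel. symb G \<xi> * cos (x * \<xi>))"
    by (simp only: set_lebesgue_integral_def eq)
  also have "\<dots> = (\<Sum>n. (LINT \<xi>:piece n|lborel. symb G \<xi> * cos (x * \<xi>)))"
  proof (rule lebesgue_integral_countable_add)
    show "piece n \<in> sets lborel" for n by (simp add: piece_def)
    show "set_integrable lborel (\<Union>n. piece n) (\<lambda>\<xi>. symb G \<xi> * cos (x * \<xi>))"
      unfolding set_integrable_def eq by (rule symb_pos_integrable)
  qed (rule piece_disjoint)
  finally show "fundamental_kernel x = (1 / pi) * (\<Sum>n. coskern (pi * real n) (pi * real (n + 1)) (symb G) x)"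
    by (simp only: fundamental_kernel_def ck)
  show "summable (\<lambda>n. \<bar>coskern (pi * real n) (pi * real (n + 1)) (symb G) x\<bar>)"
  proof (rule summable_comparison_test)
    show "summable (\<lambda>n. pi * piece_bound m n)" by (intro summable_mult piece_bound_summable)
    have "\<bar>coskern (pi * real n) (pi * real (n + 1)) (symb G) x\<bar> \<le> pi * piece_bound m n" for n
    proof -
      have bd: "\<bar>symb G \<xi> * cos (x * \<xi>)\<bar> \<le> piece_bound m n" if xi: "\<xi> \<in> piece n" for \<xi>
      proof -
        have g: "generic \<xi>" by (rule piece_generic[OF xi])
        have "symb G \<xi> \<le> piece_bound m n"
        proof (cases "n = 0")
          case True
          then show ?thesis using symb_le_1[OF g] tail_const_nonneg[of m] by (simp add: piece_bound_def)
        next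
          case False
          have lt: "pi * real n < \<xi>" using xi by (simp add: piece_def)
          have na: "pi * 1 \<le> pi * real n" using False by (intro mult_left_mono) auto
          have np: "0 < pi * real n" "0 < \<xi>" using na lt pi_gt_zero by linarith+
          have "symb G \<xi> \<le> G \<xi> / G pi"
            unfolding symb_def using period_sum_ge_pi[OF g] pos[of pi] pos[OF np(2)] np by (auto intro!: divide_left_mono)
          also have "\<dots> \<le> G (pi * real n) / G pi" using anti[of "pi * real n" \<xi>] lt np pos[of pi] by (intro divide_right_mono) auto
          also have "\<dots> \<le> tail_profile m (pi * real n)" using G_le_tail_profile[of "pi * real n"] na pos[of pi] by (simp add: divide_le_eq)
          finally show ?thesis using False by (simp add: piece_bound_def)
        qed
        then have "\<bar>symb G \<xi>\<bar> * \<bar>cos (x * \<xi>)\<bar> \<le> piece_bound m n * 1" using symb_nonneg[OF g] piece_bound_pos[of m n] by (intro mult_mono) auto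
        then show ?thesis by (simp add: abs_mult)
      qed
      have "\<bar>coskern (pi * real n) (pi * real (n + 1)) (symb G) x\<bar> \<le> (LINT \<xi>|lborel. \<bar>indicator (piece n) \<xi> *\<^sub>R (symb G \<xi> * cos (x * \<xi>))\<bar>)"
        unfolding ck set_lebesgue_integral_def by (rule integral_abs_bound)
      also have "\<dots> \<le> (LINT \<xi>|lborel. piece_bound m n * indicator (piece n) \<xi>)"
      proof (rule integral_mono')
        show "integrable lborel (\<lambda>\<xi>. piece_bound m n * indicator (piece n) \<xi>)"
          by (intro integrable_mult_right integrable_real_indicator) (auto simp: piece_def)
      qed (use bd in \<open>auto simp: indicator_def piece_bound_pos less_imp_le\<close>)
      also have "\<dots> = pi * piece_bound m n" by (simp add: piece_def algebra_simps)
      finally show ?thesis .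
    qed
    then show "\<exists>N. \<forall>n\<ge>N. norm \<bar>coskern (pi * real n) (pi * real (n + 1)) (symb G) x\<bar> \<le> pi * piece_bound m n" by simp
  qed
qed

text \<open>The parameter \<open>c\<close> does not occur in the constant: this is the uniform bound
  for the interpolation operators.\<close>

lemma fundamental_kernel_conv_bounded:
  assumes p: "1 < p" and C: "0 \<le> C" "\<And>t. 0 \<le> t \<Longrightarrow> conv_bounded p (dirichlet t) (C * (1 + t) powr p)"
  shows "conv_bounded p fundamental_kernel (\<bar>1 / pi\<bar> powr p * ((\<Sum>n. piece_weight m n) powr p * (2 powr p * (2 * (2 powr p * (2 * (2 powr p * (2 * C))))))))"
proof -
  have "conv_bounded p (\<lambda>x. \<Sum>n. coskern (pi * real n) (pi * real (n + 1)) (symb G) x)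
    ((\<Sum>n. piece_weight m n) powr p * (2 powr p * (2 * (2 powr p * (2 * (2 powr p * (2 * C)))))))"
    using C by (intro conv_bounded_suminf p piece_weight_pos piece_weight_summable piece_decay(1) coskern_summable) auto
  from conv_bounded_cmult[OF this, of "1 / pi"] show ?thesis by (simp only: fundamental_kernel_eq_suminf[abs_def])
qed

lemma fundamental_kernel_decay:
  assumes p: "1 < p" and C: "0 \<le> C" "\<And>t. 0 \<le> t \<Longrightarrow> conv_bounded p (dirichlet t) (C * (1 + t) powr p)"
  shows "\<bar>x\<bar> * \<bar>fundamental_kernel x\<bar> \<le> (1 / pi) * (4 * (\<Sum>n. piece_bound m n))"
proof -
  let ?k = "\<lambda>n. coskern (pi * real n) (pi * real (n + 1)) (symb G) x"
  have "\<bar>x\<bar> * \<bar>fundamental_kernel x\<bar> = (1 / pi) * (\<bar>x\<bar> * \<bar>\<Sum>n. ?k n\<bar>)" by (simp add: fundamental_kernel_eq_suminf abs_mult)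
  also have "\<bar>\<Sum>n. ?k n\<bar> \<le> (\<Sum>n. \<bar>?k n\<bar>)" using coskern_summable by (intro summable_rabs)
  also have "\<bar>x\<bar> * (\<Sum>n. \<bar>?k n\<bar>) = (\<Sum>n. \<bar>x\<bar> * \<bar>?k n\<bar>)" using coskern_summable by (intro suminf_mult[symmetric])
  also have "\<dots> \<le> (\<Sum>n. 4 * piece_bound m n)"
    using piece_decay(2)[OF p C] by (intro suminf_le summable_mult coskern_summable piece_bound_summable) auto
  also have "\<dots> = 4 * (\<Sum>n. piece_bound m n)" by (intro suminf_mult piece_bound_summable)
  finally show ?thesis by (simp add: mult_left_mono divide_right_mono)
qed

section \<open>Distance to the sinc kernel\<close>

definition symb_error :: real where
  "symb_error = (LINT \<xi>|lborel. \<bar>symb_pos \<xi> - indicator {0..pi} \<xi>\<bar>)"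

text \<open>The function sinc (\<pi> x) is the same cosine integral with the indicator of [0, \<pi>]
  in place of \<open>symb_pos\<close>, so the L_1 distance of the two controls the difference
  uniformly in x.\<close>

lemma fundamental_kernel_sinc_error: "\<bar>fundamental_kernel x - sinc (pi * x)\<bar> \<le> (1 / pi) * symb_error"
proof -
  have int_i: "integrable lborel (\<lambda>\<xi>. cos (x * \<xi>) * indicat_real {0..pi} \<xi>)"
    by (rule borel_integrable_atLeastAtMost) (intro continuous_intros)
  have "sinc (pi * x) = (1 / pi) * (LINT \<xi>|lborel. cos (x * \<xi>) * indicator {0..pi} \<xi>)"
    unfolding integral_cos_dirichlet[OF pi_ge_zero] by (simp add: dirichlet_def)
  then have "fundamental_kernel x - sinc (pi * x) = (1 / pi) * (LINT \<xi>|lborel. symb_pos \<xi> * cos (x * \<xi>) - cos (x * \<xi>) * indicator {0..pi} \<xi>)"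
    using symb_pos_integrable int_i by (simp add: fundamental_kernel_def right_diff_distrib diff_divide_distrib)
  also have "\<bar>\<dots>\<bar> \<le> (1 / pi) * (LINT \<xi>|lborel. \<bar>symb_pos \<xi> * cos (x * \<xi>) - cos (x * \<xi>) * indicator {0..pi} \<xi>\<bar>)"
    unfolding abs_mult using integral_abs_bound[of lborel] by (intro mult_mono) auto
  also have "\<dots> \<le> (1 / pi) * symb_error"
  proof (intro mult_left_mono)
    show "(LINT \<xi>|lborel. \<bar>symb_pos \<xi> * cos (x * \<xi>) - cos (x * \<xi>) * indicator {0..pi} \<xi>\<bar>) \<le> symb_error"
      unfolding symb_error_def
    proof (rule integral_mono')
      show "integrable lborel (\<lambda>\<xi>. \<bar>symb_pos \<xi> - indicator {0..pi} \<xi>\<bar>)"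
      proof -
        have "integrable lborel symb_pos" using symb_pos_integrable[of 0] by (simp only: mult_zero_left cos_zero mult_1_right)
        moreover have "integrable lborel (indicat_real {0..pi})" by (rule integrable_real_indicator) auto
        ultimately show ?thesis by (rule integrable_abs[OF Bochner_Integration.integrable_diff])
      qed
      fix \<xi>
      have "\<bar>(symb_pos \<xi> - indicator {0..pi} \<xi>) * cos (x * \<xi>)\<bar> \<le> \<bar>symb_pos \<xi> - indicator {0..pi} \<xi>\<bar> * 1"
        unfolding abs_mult by (intro mult_left_mono) auto
      then show "\<bar>symb_pos \<xi> * cos (x * \<xi>) - cos (x * \<xi>) * indicator {0..pi} \<xi>\<bar> \<le> \<bar>symb_pos \<xi> - indicator {0..pi} \<xi>\<bar>"
        by (simp only: left_diff_distrib mult_1_right mult.commute[of "cos (x * \<xi>)"])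
    qed auto
  qed auto
  finally show ?thesis .
qed

end

section \<open>The multiquadric profile\<close>

lemma cosh_borel_measurable [measurable]: "(cosh :: real \<Rightarrow> real) \<in> borel_measurable borel"
  by (intro borel_measurable_continuous_onI continuous_intros)

lemma cosh_ge_sq:
  fixes t :: real
  assumes "0 \<le> t" shows "t\<^sup>2 / 4 \<le> cosh t"
proof -
  have "t\<^sup>2 / 4 \<le> exp t / 2" using exp_lower_Taylor_quadratic[OF assms] assms by simp
  also have "\<dots> \<le> cosh t" by (simp add: cosh_field_def)
  finally show ?thesis .
qed

text \<open>For t \<ge> 0, cosh t \<ge> t^2 / 4, and the square of r t / 2 - (b + 1), divided by r,
  absorbs the linear exponent while leaving exp(-t) for integrability.\<close>

lemma exp_cosh_tail:
  fixes r b t :: real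
  assumes r: "0 < r" and t: "0 \<le> t"
  shows "exp (- r * cosh t) * exp (b * t) \<le> exp ((b + 1)\<^sup>2 / r) * exp (- 1 * t)"
proof -
  have "r * (t\<^sup>2 / 4) \<le> r * cosh t" using r cosh_ge_sq[OF t] by (intro mult_left_mono) auto
  moreover have "0 \<le> (r * t / 2 - (b + 1))\<^sup>2 / r" using r by simp
  then have "(b + 1) * t \<le> r * (t\<^sup>2 / 4) + (b + 1)\<^sup>2 / r"
    using r by (simp add: power2_eq_square field_simps)
  ultimately have "- r * cosh t + b * t \<le> (b + 1)\<^sup>2 / r + - 1 * t" by (simp add: algebra_simps)
  then show ?thesis by (simp only: exp_add[symmetric] exp_le_cancel_iff)
qed

lemma exp_cosh_integrable:
  fixes r b :: real
  assumes r: "0 < r"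
  shows "set_integrable lborel {0..} (\<lambda>t. exp (- r * cosh t) * exp (b * t))"
  unfolding set_integrable_def
proof (rule Bochner_Integration.integrable_bound)
  show "integrable lborel (\<lambda>t. exp ((b + 1)\<^sup>2 / r) * (indicator {0..} t *\<^sub>R exp (- 1 * t)))"
    using set_integrable_exp_tail[of 1 0] unfolding set_integrable_def by (intro integrable_mult_right) auto
  show "(\<lambda>t. indicat_real {0..} t *\<^sub>R (exp (- r * cosh t) * exp (b * t))) \<in> borel_measurable lborel"
    by measurable
  show "AE t in lborel. norm (indicat_real {0..} t *\<^sub>R (exp (- r * cosh t) * exp (b * t))) \<le> norm (exp ((b + 1)\<^sup>2 / r) * (indicator {0..} t *\<^sub>R exp (- 1 * t)))"
    using exp_cosh_tail[OF r] by (intro AE_I2) (auto simp: indicator_def abs_mult)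
qed

lemma bessel_integrand_eq:
  fixes r \<nu> t :: real
  shows "exp (- r * cosh t) * cosh (\<nu> * t) = (exp (- r * cosh t) * exp (\<nu> * t) + exp (- r * cosh t) * exp (- \<nu> * t)) / 2"
  by (simp add: cosh_field_def[of "\<nu> * t"] distrib_left)

lemma bessel_integrable:
  fixes r \<nu> :: real
  assumes r: "0 < r"
  shows "set_integrable lborel {0..} (\<lambda>t. exp (- r * cosh t) * cosh (\<nu> * t))"
  unfolding bessel_integrand_eq
  by (intro set_integral_add(1) set_integrable_divide exp_cosh_integrable r)

lemma bessel_K_pos:
  assumes r: "0 < r"
  shows "0 < bessel_K \<nu> r"
proof -
  have "0 < exp (- r * cosh (1::real))" by simp
  also have "exp (- r * cosh (1::real)) = (LINT t|lborel. exp (- r * cosh 1) * indicat_real {0..1::real} t)" by simp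
  also have "\<dots> \<le> bessel_K \<nu> r"
    unfolding bessel_K_def set_lebesgue_integral_def
  proof (rule integral_mono)
    show "integrable lborel (\<lambda>t. exp (- r * cosh 1) * indicat_real {0..1::real} t)"
      by (intro integrable_mult_right integrable_real_indicator) auto
    show "integrable lborel (\<lambda>t. indicat_real {0..} t *\<^sub>R (exp (- r * cosh t) * cosh (\<nu> * t)))"
      using bessel_integrable[OF r] unfolding set_integrable_def .
    fix t :: real
    have "exp (- r * cosh 1) * 1 \<le> exp (- r * cosh t) * cosh (\<nu> * t)" if "0 \<le> t" "t \<le> 1"
    proof (rule mult_mono)
      have "r * cosh t \<le> r * cosh 1" using r that by (intro mult_left_mono) (auto simp: cosh_real_nonneg_le_iff)
      then show "exp (- r * cosh 1) \<le> exp (- r * cosh t)" by simp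
    qed (auto simp: cosh_real_ge_1)
    then show "exp (- r * cosh 1) * indicat_real {0..1} t \<le> indicat_real {0..} t *\<^sub>R (exp (- r * cosh t) * cosh (\<nu> * t))"
      by (auto simp: indicator_def)
  qed
  finally show ?thesis .
qed

lemma bessel_K_decay:
  assumes r: "0 < r" and s: "r \<le> s"
  shows "bessel_K \<nu> s \<le> exp (- (s - r)) * bessel_K \<nu> r"
proof -
  have "bessel_K \<nu> s \<le> (LBINT t:{0..}. exp (- (s - r)) * (exp (- r * cosh t) * cosh (\<nu> * t)))"
    unfolding bessel_K_def
  proof (rule set_integral_mono)
    show "set_integrable lborel {0..} (\<lambda>t. exp (- s * cosh t) * cosh (\<nu> * t))" using r s by (intro bessel_integrable) auto
    show "set_integrable lborel {0..} (\<lambda>t. exp (- (s - r)) * (exp (- r * cosh t) * cosh (\<nu> * t)))"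
      using r by (intro set_integrable_mult_right bessel_integrable)
    fix t :: real
    have "(s - r) * 1 \<le> (s - r) * cosh t" using s by (intro mult_left_mono) (auto simp: cosh_real_ge_1)
    then have "- s * cosh t \<le> - (s - r) + - r * cosh t" by (simp add: algebra_simps)
    then have "exp (- s * cosh t) \<le> exp (- (s - r)) * exp (- r * cosh t)" by (simp only: exp_add[symmetric] exp_le_cancel_iff)
    from mult_right_mono[OF this, of "cosh (\<nu> * t)"]
    show "exp (- s * cosh t) * cosh (\<nu> * t) \<le> exp (- (s - r)) * (exp (- r * cosh t) * cosh (\<nu> * t))"
      by (simp add: mult.assoc)
  qed
  also have "\<dots> = exp (- (s - r)) * bessel_K \<nu> r" unfolding bessel_K_def by simp
  finally show ?thesis .
qed

text \<open>The factor cosh (\<mu> t) is split into two exponentials, and the half with the negative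
  one is reflected onto the negative axis. On the whole line the integral may then be
  translated.\<close>

lemma bessel_K_full_line:
  fixes r \<mu> :: real
  assumes r: "0 < r"
  shows "integrable lborel (\<lambda>t. exp (- r * cosh t) * exp (\<mu> * t))"
    and "bessel_K \<mu> r = (LINT t|lborel. exp (- r * cosh t) * exp (\<mu> * t)) / 2"
proof -
  define g h where "g b t = indicat_real {0..} t *\<^sub>R (exp (- r * cosh t) * exp (b * t))" and "h t = g (- \<mu>) (0 + - 1 * t)" for b t
  have g: "integrable lborel (g b)" for b
    using exp_cosh_integrable[OF r, of b] unfolding set_integrable_def g_def .
  have h: "integrable lborel h" unfolding h_def by (subst lborel_integrable_real_affine_iff) (auto intro: g)
  have hI: "(LINT t|lborel. h t) = (LINT t|lborel. g (- \<mu>) t)"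
    using lborel_integral_real_affine[of "-1" "g (- \<mu>)" 0] by (simp add: h_def)
  have ae: "AE t in lborel. g \<mu> t + h t = exp (- r * cosh t) * exp (\<mu> * t)"
    using AE_lborel_singleton[of 0] by eventually_elim (auto simp: g_def h_def indicator_def)
  have [measurable]: "(\<lambda>t. exp (- r * cosh t) * exp (\<mu> * t)) \<in> borel_measurable borel"
    by measurable
  have gh: "integrable lborel (\<lambda>t. g \<mu> t + h t)" using g h by (rule Bochner_Integration.integrable_add)
  show "integrable lborel (\<lambda>t. exp (- r * cosh t) * exp (\<mu> * t))"
    by (rule integrable_cong_AE_imp[OF gh _ ae]) measurable
  have "(LINT t|lborel. exp (- r * cosh t) * exp (\<mu> * t)) = (LINT t|lborel. g \<mu> t + h t)"
  proof (rule integral_cong_AE)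
    show "AE t in lborel. exp (- r * cosh t) * exp (\<mu> * t) = g \<mu> t + h t" using ae by eventually_elim (rule sym)
    show "(\<lambda>t. g \<mu> t + h t) \<in> borel_measurable lborel" using gh by (rule borel_measurable_integrable)
  qed measurable
  also have "\<dots> = (LINT t|lborel. g \<mu> t) + (LINT t|lborel. g (- \<mu>) t)"
    using g h by (simp add: hI)
  also have "\<dots> = (LINT t|lborel. g \<mu> t + g (- \<mu>) t)" using g by simp
  also have "\<dots> = (LINT t|lborel. 2 * (indicat_real {0..} t *\<^sub>R (exp (- r * cosh t) * cosh (\<mu> * t))))"
    unfolding bessel_integrand_eq g_def by (intro Bochner_Integration.integral_cong) (auto simp: indicator_def)
  also have "\<dots> = 2 * bessel_K \<mu> r" unfolding bessel_K_def set_lebesgue_integral_def by simp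
  finally show "bessel_K \<mu> r = (LINT t|lborel. exp (- r * cosh t) * exp (\<mu> * t)) / 2" by simp
qed

text \<open>The shift \<open>t \<mapsto> t - ln r\<close> turns \<open>r powr \<mu> * bessel_K \<mu> (c * r)\<close> into an integral over the line
  whose integrand is decreasing in \<open>r\<close>.\<close>
lemma powr_bessel_K_antimono:
  fixes r s \<mu> c :: real
  assumes c: "0 < c" and r: "0 < r" "r \<le> s"
  shows "s powr \<mu> * bessel_K \<mu> (c * s) \<le> r powr \<mu> * bessel_K \<mu> (c * r)"
proof -
  \<comment> \<open>The integrand after the shift: r cosh (t - ln r) = (exp t + r^2 exp(-t)) / 2, so
    \<open>r\<close> survives only in one decreasing factor.\<close>
  define F where "F r t = exp (- (c / 2) * (exp t + r\<^sup>2 * exp (- t))) * exp (\<mu> * t)" for r t :: real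
  have F: "r powr \<mu> * bessel_K \<mu> (c * r) = (LINT t|lborel. F r t) / 2 \<and> integrable lborel (F r)" if r: "0 < r" for r
  proof -
    let ?f = "\<lambda>t. exp (- (c * r) * cosh t) * exp (\<mu> * t)"
    have cr: "0 < c * r" using c r by simp
    have shift: "r powr \<mu> * ?f (- ln r + 1 * t) = F r t" for t
    proof -
      have "exp (- ln r + 1 * t) = exp t / r" "exp (- (- ln r + 1 * t)) = r * exp (- t)"
        using r by (simp_all add: exp_add exp_minus exp_diff field_simps)
      then have "- (c * r) * cosh (- ln r + 1 * t) = - (c / 2) * (exp t + r\<^sup>2 * exp (- t))"
        unfolding cosh_field_def using r by (simp add: field_simps power2_eq_square)
      moreover have "r powr \<mu> * exp (\<mu> * (- ln r + 1 * t)) = exp (\<mu> * t)"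
        using r by (simp add: powr_def exp_add[symmetric] algebra_simps)
      ultimately show ?thesis unfolding F_def by (metis mult.left_commute)
    qed
    have int: "integrable lborel (\<lambda>t. ?f (- ln r + 1 * t))"
      by (rule lborel_integrable_real_affine[of ?f 1 "- ln r", OF bessel_K_full_line(1)[OF cr]]) simp
    have "r powr \<mu> * (LINT t|lborel. ?f t) = r powr \<mu> * (LINT t|lborel. ?f (- ln r + 1 * t))"
      using lborel_integral_real_affine[of 1 ?f "- ln r"] by simp
    also have "\<dots> = (LINT t|lborel. r powr \<mu> * ?f (- ln r + 1 * t))" by (rule integral_mult_right_zero[symmetric])
    also have "\<dots> = (LINT t|lborel. F r t)" by (simp only: shift)
    finally have 1: "r powr \<mu> * bessel_K \<mu> (c * r) = (LINT t|lborel. F r t) / 2"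
      by (simp add: bessel_K_full_line(2)[OF cr])
    have "integrable lborel (\<lambda>t. r powr \<mu> * ?f (- ln r + 1 * t))" by (intro integrable_mult_right int)
    then have "integrable lborel (F r)" by (simp only: shift)
    with 1 show ?thesis by simp
  qed
  have "(LINT t|lborel. F s t) \<le> (LINT t|lborel. F r t)"
  proof (rule integral_mono)
    fix t :: real
    have "r\<^sup>2 \<le> s\<^sup>2" using r by (intro power_mono) auto
    then have "(c / 2) * (exp t + r\<^sup>2 * exp (- t)) \<le> (c / 2) * (exp t + s\<^sup>2 * exp (- t))"
      using c by (intro mult_left_mono add_left_mono mult_right_mono) auto
    then show "F s t \<le> F r t" unfolding F_def by (intro mult_right_mono) auto
  qed (use F r in auto)
  then show ?thesis using F[of r] F[of s] r by simp
qed

section \<open>The profile of the multiquadric\<close>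

definition mq_profile :: "real \<Rightarrow> real \<Rightarrow> real \<Rightarrow> real" where
  "mq_profile \<nu> c r = r powr (- \<nu>) * bessel_K \<nu> (c * r)"

lemma bessel_K_uminus: "bessel_K (- \<nu>) r = bessel_K \<nu> r"
  by (simp add: bessel_K_def)

text \<open>The shift argument applies with order -\<nu>, and \<open>bessel_K\<close> is even in its
  order. In the decay estimate the ratio of powers is (s / r)^(-\<nu>), at most 1 for \<nu> \<ge> 0;
  the exponent max 0 (-\<nu>) covers both signs and does not depend on \<open>c\<close>.\<close>

lemma mq_profile_cardinal_symbol:
  assumes c: "1 \<le> c"
  shows "cardinal_symbol (mq_profile \<nu> c) (max 0 (- \<nu>)) c"
proof
  have c0: "0 < c" using c by simp
  show "0 \<le> max 0 (- \<nu>)" "1 \<le> c" using c by auto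
  show "0 < mq_profile \<nu> c r" if "0 < r" for r
    using bessel_K_pos[of "c * r" \<nu>] c0 that by (simp add: mq_profile_def)
  show "mq_profile \<nu> c s \<le> mq_profile \<nu> c r" if r: "0 < r" "r \<le> s" for r s
    using powr_bessel_K_antimono[OF c0 r, of "- \<nu>"] by (simp add: mq_profile_def bessel_K_uminus)
  show "mq_profile \<nu> c s \<le> (s / r) powr max 0 (- \<nu>) * exp (- c * (s - r)) * mq_profile \<nu> c r" if r: "0 < r" "r \<le> s" for r s
  proof -
    have "c * r \<le> c * s" using c0 r by simp
    then have "bessel_K \<nu> (c * s) \<le> exp (- (c * s - c * r)) * bessel_K \<nu> (c * r)"
      using c0 r by (intro bessel_K_decay) auto
    also have "- (c * s - c * r) = - c * (s - r)" by (simp add: algebra_simps)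
    finally have 1: "bessel_K \<nu> (c * s) \<le> exp (- c * (s - r)) * bessel_K \<nu> (c * r)" .
    have "s powr (- \<nu>) = (s / r) powr (- \<nu>) * r powr (- \<nu>)" using r by (simp add: powr_divide)
    also have "\<dots> \<le> (s / r) powr max 0 (- \<nu>) * r powr (- \<nu>)"
      using r by (intro mult_right_mono powr_mono) auto
    finally have "mq_profile \<nu> c s \<le> ((s / r) powr max 0 (- \<nu>) * r powr (- \<nu>)) * (exp (- c * (s - r)) * bessel_K \<nu> (c * r))"
      unfolding mq_profile_def using 1 bessel_K_pos[of "c * s" \<nu>] c0 r by (intro mult_mono) auto
    then show ?thesis by (simp add: mq_profile_def mult_ac)
  qed
qed

lemma multiquadric_hat_profile:
  assumes "0 < c" "\<xi> \<noteq> 0"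
  shows "multiquadric_hat \<alpha> c \<xi> = 2 powr (1 + \<alpha>) / Gamma (- \<alpha>) * c powr (\<alpha> + 1/2) * mq_profile (\<alpha> + 1/2) c \<bar>\<xi>\<bar>"
proof -
  have "(c / \<bar>\<xi>\<bar>) powr (\<alpha> + 1/2) = c powr (\<alpha> + 1/2) * \<bar>\<xi>\<bar> powr (- (\<alpha> + 1/2))"
    unfolding powr_minus divide_inverse[symmetric] by (rule powr_divide)
  then show ?thesis unfolding multiquadric_hat_def mq_profile_def by (simp only: mult_ac)
qed

section \<open>The fundamental function and its kernel\<close>

lemma Gamma_minus_nonzero:
  fixes \<alpha> :: real
  assumes "\<alpha> \<notin> \<nat>"
  shows "Gamma (- \<alpha>) \<noteq> 0"
proof -
  have "- \<alpha> \<notin> \<int>\<^sub>\<le>\<^sub>0"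
  proof
    assume "- \<alpha> \<in> \<int>\<^sub>\<le>\<^sub>0"
    then obtain n where "- \<alpha> = - of_nat n" by (elim nonpos_Ints_cases')
    then show False using assms by simp
  qed
  then show ?thesis by (simp add: Gamma_eq_zero_iff)
qed

text \<open>The constant \<kappa> is independent of \<xi>. It may be negative, as Gamma (-\<alpha>)
  may be; being nonzero it cancels between numerator and periodization.\<close>

lemma fundamental_hat_symb:
  assumes "0 < c" "\<alpha> \<notin> \<nat>" "generic \<xi>"
  shows "fundamental_hat \<alpha> c \<xi> = symb (mq_profile (\<alpha> + 1/2) c) \<xi>"
proof -
  define \<kappa> where "\<kappa> = 2 powr (1 + \<alpha>) / Gamma (- \<alpha>) * c powr (\<alpha> + 1/2)"
  have k: "\<kappa> \<noteq> 0" using assms Gamma_minus_nonzero by (simp add: \<kappa>_def)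
  have hat: "multiquadric_hat \<alpha> c (\<xi> + 2 * pi * of_int j) = \<kappa> * mq_profile (\<alpha> + 1/2) c \<bar>\<xi> + 2 * pi * of_int j\<bar>" for j
    unfolding \<kappa>_def using assms by (intro multiquadric_hat_profile) (auto simp: generic_def)
  have "\<xi> \<notin> range (\<lambda>k::int. 2 * pi * of_int k)"
  proof
    assume "\<xi> \<in> range (\<lambda>k::int. 2 * pi * of_int k)"
    then obtain k :: int where "\<xi> = 2 * pi * of_int k" by blast
    then have "\<xi> + 2 * pi * of_int (- k) = 0" by simp
    then show False using assms(3) unfolding generic_def by blast
  qed
  then have "fundamental_hat \<alpha> c \<xi> = fundamental_quotient \<alpha> c \<xi>" by (simp only: fundamental_hat_def if_False)
  also have "\<dots> = (\<kappa> * mq_profile (\<alpha> + 1/2) c \<bar>\<xi>\<bar>) / (\<Sum>\<^sub>\<infinity>j\<in>(UNIV :: int set). \<kappa> * mq_profile (\<alpha> + 1/2) c \<bar>\<xi> + 2 * pi * of_int j\<bar>)"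
  proof -
    have "multiquadric_hat \<alpha> c \<xi> = \<kappa> * mq_profile (\<alpha> + 1/2) c \<bar>\<xi>\<bar>" using hat[of 0] by simp
    then show ?thesis by (simp only: fundamental_quotient_def hat)
  qed
  also have "\<dots> = symb (mq_profile (\<alpha> + 1/2) c) \<xi>"
    using k by (simp add: infsum_cmult_right' symb_def period_sum_def)
  finally show ?thesis .
qed

text \<open>\<open>L\<close> is even, so the reflected half turns the exponential into 2 cos (x
  \<xi>), which together with 1/(2\<pi>) gives the kernel. The multiples of \<pi>, where
  \<open>symb_pos\<close> is 0 and the extension by limits lives, form a null set.\<close>

lemma fundamental_function_eq:
  assumes c: "1 \<le> c" and \<alpha>: "\<alpha> \<notin> \<nat>"
  shows "fundamental_function \<alpha> c x = of_real (cardinal_symbol.fundamental_kernel (mq_profile (\<alpha> + 1/2) c) x)"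
proof -
  define G where "G = mq_profile (\<alpha> + 1/2) c"
  interpret cardinal_symbol G "max 0 (- (\<alpha> + 1/2))" c
    unfolding G_def by (rule mq_profile_cardinal_symbol[OF c])
  \<comment> \<open>The even extension of \<open>symb_pos\<close>; \<open>0 + - 1 * \<xi>\<close> is
    the reflection in the form of an affine substitution.\<close>
  define S where "S \<xi> = symb_pos \<xi> + symb_pos (0 + - 1 * \<xi>)" for \<xi>
  define X where "X = range (\<lambda>k::int. pi * of_int k)"
  have X: "countable X" unfolding X_def by simp
  have eq: "S \<xi> = fundamental_hat \<alpha> c \<xi>" if "\<xi> \<notin> X" for \<xi>
  proof -
    have pc: "0 < \<eta> \<Longrightarrow> \<eta> \<notin> X \<Longrightarrow> \<eta> \<in> (\<Union>n. piece n)" for \<eta>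
    proof (rule piece_cover)
      assume "\<eta> \<notin> X"
      moreover have "range (\<lambda>n. pi * real n) \<subseteq> X"
      proof
        fix z assume "z \<in> range (\<lambda>n. pi * real n)"
        then obtain n where "z = pi * of_int (int n)" by auto
        then show "z \<in> X" unfolding X_def by blast
      qed
      ultimately show "\<eta> \<notin> range (\<lambda>n. pi * real n)" by blast
    qed
    have neg: "- \<xi> \<notin> X"
    proof
      assume "- \<xi> \<in> X"
      then obtain k :: int where "- \<xi> = pi * of_int k" unfolding X_def by blast
      then have "\<xi> = pi * of_int (- k)" by simp
      then show False using that unfolding X_def by blast
    qed
    have n0: "\<xi> \<noteq> 0"
    proof
      assume "\<xi> = 0"
      then have "\<xi> = pi * of_int 0" by simp
      then show False using that unfolding X_def by blast
    qed
    have gen: "generic \<xi>" unfolding generic_def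
    proof
      fix j :: int
      show "\<xi> + 2 * pi * of_int j \<noteq> 0"
      proof
        assume "\<xi> + 2 * pi * of_int j = 0"
        then have "\<xi> = pi * of_int (- 2 * j)" by simp
        then show False using that unfolding X_def by blast
      qed
    qed
    have np: "\<eta> \<le> 0 \<Longrightarrow> \<eta> \<notin> (\<Union>n. piece n)" for \<eta> using piece_pos by fastforce
    have "S \<xi> = symb G \<xi>"
    proof (cases "0 < \<xi>")
      case True
      then show ?thesis using pc[OF True that] np[of "- \<xi>"] by (simp add: S_def symb_pos_def)
    next
      case False
      then have "0 < - \<xi>" using n0 by simp
      then show ?thesis using pc[OF _ neg] np[of \<xi>] by (simp add: S_def symb_pos_def symb_minus)
    qed
    then show ?thesis using fundamental_hat_symb[OF _ \<alpha> gen] c by (simp add: G_def)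
  qed
  have [measurable]: "S \<in> borel_measurable borel" unfolding S_def by measurable
  have fm [measurable]: "fundamental_hat \<alpha> c \<in> borel_measurable borel"
    by (rule measurable_discrete_difference[OF _ X, where f = S]) (auto simp: eq)
  have ae: "AE \<xi> in lborel. fundamental_hat \<alpha> c \<xi> = S \<xi>"
    using AE_not_in[OF countable_imp_null_set_lborel[OF X]] by eventually_elim (simp add: eq)
  let ?e = "\<lambda>\<xi>. exp (\<i> * of_real (x * \<xi>)) :: complex"
  have int1: "integrable lborel (\<lambda>\<xi>. of_real (symb_pos \<xi>) * exp (\<i> * of_real (z * \<xi>)) :: complex)" for z
  proof (rule Bochner_Integration.integrable_bound)
    show "integrable lborel symb_pos" using symb_pos_integrable[of 0] by (simp only: mult_zero_left cos_zero mult_1_right)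
  qed (auto simp: norm_mult)
  define T where "T \<xi> = of_real (symb_pos \<xi>) * exp (\<i> * of_real (- x * \<xi>))" for \<xi>
  have intT: "integrable lborel T" unfolding T_def by (rule int1)
  have int2: "integrable lborel (\<lambda>\<xi>. T (0 + - 1 * \<xi>))" by (subst lborel_integrable_real_affine_iff) (auto intro: intT)
  have "(LINT \<xi>|lborel. of_real (fundamental_hat \<alpha> c \<xi>) * ?e \<xi>) = (LINT \<xi>|lborel. of_real (S \<xi>) * ?e \<xi>)"
    using ae by (intro integral_cong_AE) (auto elim!: eventually_mono)
  also have "\<dots> = (LINT \<xi>|lborel. of_real (symb_pos \<xi>) * ?e \<xi> + T (0 + - 1 * \<xi>))"
    by (simp add: S_def T_def distrib_right)
  also have "\<dots> = (LINT \<xi>|lborel. of_real (symb_pos \<xi>) * ?e \<xi>) + (LINT \<xi>|lborel. T (0 + - 1 * \<xi>))"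
    by (rule Bochner_Integration.integral_add[OF int1 int2])
  also have "(LINT \<xi>|lborel. T (0 + - 1 * \<xi>)) = (LINT \<xi>|lborel. T \<xi>)"
    using lborel_integral_real_affine[of "-1" T 0] by simp
  also have "(LINT \<xi>|lborel. of_real (symb_pos \<xi>) * ?e \<xi>) + (LINT \<xi>|lborel. T \<xi>) = (LINT \<xi>|lborel. of_real (symb_pos \<xi>) * ?e \<xi> + T \<xi>)"
    by (rule Bochner_Integration.integral_add[OF int1 intT, symmetric])
  also have "\<dots> = (LINT \<xi>|lborel. complex_of_real (2 * (symb_pos \<xi> * cos (x * \<xi>))))"
  proof (rule Bochner_Integration.integral_cong[OF refl])
    fix \<xi>
    have "?e \<xi> + exp (\<i> * of_real (- x * \<xi>)) = 2 * of_real (cos (x * \<xi>))"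
      by (simp add: complex_eq_iff Re_exp Im_exp)
    then show "of_real (symb_pos \<xi>) * ?e \<xi> + T \<xi> = complex_of_real (2 * (symb_pos \<xi> * cos (x * \<xi>)))"
      unfolding T_def distrib_left[symmetric] by (simp only:) (simp only: of_real_mult of_real_numeral mult.left_commute)
  qed
  also have "\<dots> = of_real (2 * (LINT \<xi>|lborel. symb_pos \<xi> * cos (x * \<xi>)))"
    by (simp only: integral_complex_of_real integral_mult_right_zero)
  finally show ?thesis unfolding fundamental_function_def fundamental_kernel_def G_def[symmetric] by simp
qed

section \<open>Convergence on sequences\<close>

lemma integer_decay_summable:
  fixes x q :: real
  assumes q: "1 < q"
  shows "(\<lambda>j::int. (1 / (1 + \<bar>x - of_int j\<bar>)) powr q) summable_on UNIV"
proof -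
  have sm: "summable (\<lambda>n. 2 powr q * real n powr (- q))"
    using q by (intro summable_mult) (simp add: summable_real_powr_iff)
  have est: "(1 / (1 + \<bar>x - of_int j\<bar>)) powr q \<le> 2 powr q * \<bar>of_int j\<bar> powr (- q)" if j: "max 1 (2 * \<bar>x\<bar>) \<le> \<bar>real_of_int j\<bar>" for j :: int
  proof -
    have "\<bar>of_int j\<bar> / 2 \<le> 1 + \<bar>x - of_int j\<bar>" using j by linarith
    then have "1 / (1 + \<bar>x - of_int j\<bar>) \<le> 1 / (\<bar>of_int j\<bar> / 2)" using j by (intro divide_left_mono mult_pos_pos) auto
    then have "(1 / (1 + \<bar>x - of_int j\<bar>)) powr q \<le> (2 / \<bar>of_int j\<bar>) powr q" using q by (intro powr_mono2) auto
    also have "\<dots> = 2 powr q * \<bar>of_int j\<bar> powr (- q)" unfolding powr_minus divide_inverse[symmetric] by (rule powr_divide)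
    finally show ?thesis .
  qed
  have ev: "\<forall>\<^sub>F n in sequentially. max 1 (2 * \<bar>x\<bar>) \<le> real n"
    using filterlim_real_sequentially unfolding filterlim_at_top by blast
  show ?thesis
  proof (rule summable_on_int_abs)
    show "summable (\<lambda>n. (1 / (1 + \<bar>x - of_int (int n)\<bar>)) powr q)"
    proof (rule summable_comparison_test_ev[OF _ sm])
      show "\<forall>\<^sub>F n in sequentially. norm ((1 / (1 + \<bar>x - of_int (int n)\<bar>)) powr q) \<le> 2 powr q * real n powr (- q)"
        using ev by eventually_elim (use est[of "int _"] in simp)
    qed
    show "summable (\<lambda>n. (1 / (1 + \<bar>x - of_int (- int n)\<bar>)) powr q)"
    proof (rule summable_comparison_test_ev[OF _ sm])
      show "\<forall>\<^sub>F n in sequentially. norm ((1 / (1 + \<bar>x - of_int (- int n)\<bar>)) powr q) \<le> 2 powr q * real n powr (- q)"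
        using ev by eventually_elim (use est[of "- int _"] in simp)
    qed
  qed simp
qed

lemma real_decay_integrable:
  fixes p :: real
  assumes p: "1 < p"
  shows "integrable lborel (\<lambda>x. (1 / (1 + \<bar>x\<bar>)) powr p)"
proof (rule integrableI_nonneg)
  let ?f = "\<lambda>j::int. (1 / (1 + \<bar>0 - real_of_int j\<bar>)) powr p"
  have "(\<integral>\<^sup>+x. ennreal ((1 / (1 + \<bar>x\<bar>)) powr p) \<partial>lborel) \<le> ennreal (2 powr p * infsum ?f UNIV)"
  proof (rule nn_integral_floor_le[where f = "\<lambda>j. ennreal (2 powr p * ?f j)"])
    fix N :: "int set" assume "finite N"
    then have "sum ?f N \<le> infsum ?f UNIV" by (intro finite_sum_le_infsum integer_decay_summable p) auto
    then have "2 powr p * sum ?f N \<le> 2 powr p * infsum ?f UNIV" by (intro mult_left_mono) auto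
    then show "(\<Sum>n\<in>N. ennreal (2 powr p * ?f n)) \<le> ennreal (2 powr p * infsum ?f UNIV)"
      by (subst sum_ennreal) (auto simp: sum_distrib_left intro!: ennreal_leI)
  next
    fix x :: real
    have "1 + \<bar>0 - real_of_int \<lfloor>x\<rfloor>\<bar> \<le> 2 * (1 + \<bar>x\<bar>)" using floor_correct[of x] by (smt (verit) of_int_add of_int_1)
    then have "1 / (1 + \<bar>x\<bar>) \<le> 2 * (1 / (1 + \<bar>0 - real_of_int \<lfloor>x\<rfloor>\<bar>))" by (simp add: field_simps)
    then have "(1 / (1 + \<bar>x\<bar>)) powr p \<le> (2 * (1 / (1 + \<bar>0 - real_of_int \<lfloor>x\<rfloor>\<bar>))) powr p" using p by (intro powr_mono2) auto
    also have "\<dots> = 2 powr p * ?f \<lfloor>x\<rfloor>" by (rule powr_mult)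
    finally show "ennreal ((1 / (1 + \<bar>x\<bar>)) powr p) \<le> ennreal (2 powr p * ?f \<lfloor>x\<rfloor>)" by (rule ennreal_leI)
  qed
  also have "\<dots> < \<infinity>" by simp
  finally show "(\<integral>\<^sup>+x. ennreal ((1 / (1 + \<bar>x\<bar>)) powr p) \<partial>lborel) < \<infinity>" .
qed auto

text \<open>Young's inequality in place of Hoelder's: |y_j| |k| \<le> |y_j|^p / p + |k|^q / q with
  the conjugate q > 1, and 1 / (1 + |x - j|) is q-summable over the integers.\<close>

lemma ell_p_convolution_summable:
  fixes k :: "real \<Rightarrow> real" and y :: "int \<Rightarrow> complex"
  assumes p: "1 < p" and y: "y \<in> ell_p p" and k: "\<And>x. (1 + \<bar>x\<bar>) * \<bar>k x\<bar> \<le> A"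
  shows "(\<lambda>j. norm (y j * of_real (k (x - of_int j)))) summable_on D"
proof -
  define q where "q = p / (p - 1)"
  have q: "1 < q" "1 / p + 1 / q = 1" using p by (auto simp: q_def field_simps)
  have A: "0 \<le> A" using k[of 0] by (smt (verit) abs_ge_zero mult_nonneg_nonneg)
  have s: "(\<lambda>j. (1 / p) * norm (y j) powr p + A powr q / q * (1 / (1 + \<bar>x - of_int j\<bar>)) powr q) summable_on UNIV"
    using y by (intro summable_on_add summable_on_cmult_right integer_decay_summable q) (simp add: ell_p_def)
  have "(\<lambda>j. norm (y j * of_real (k (x - of_int j)))) summable_on UNIV"
  proof (rule summable_on_comparison_test[OF s])
    fix j :: int
    have "\<bar>k (x - of_int j)\<bar> \<le> A * (1 / (1 + \<bar>x - of_int j\<bar>))" using k[of "x - of_int j"] by (simp add: field_simps)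
    then have "norm (y j * of_real (k (x - of_int j))) \<le> norm (y j) * (A * (1 / (1 + \<bar>x - of_int j\<bar>)))"
      unfolding norm_mult norm_of_real by (intro mult_left_mono) auto
    also have "\<dots> \<le> norm (y j) powr p / p + (A * (1 / (1 + \<bar>x - of_int j\<bar>))) powr q / q"
      using p q A by (intro Youngs_inequality) auto
    also have "(A * (1 / (1 + \<bar>x - of_int j\<bar>))) powr q = A powr q * (1 / (1 + \<bar>x - of_int j\<bar>)) powr q" by (rule powr_mult)
    finally show "norm (y j * of_real (k (x - of_int j))) \<le> (1 / p) * norm (y j) powr p + A powr q / q * (1 / (1 + \<bar>x - of_int j\<bar>)) powr q"
      by simp
  qed simp
  then show ?thesis by (rule summable_on_subset) auto
qed

section \<open>Convolution with whole sequences\<close>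

definition full_conv :: "(real \<Rightarrow> real) \<Rightarrow> int set \<Rightarrow> (int \<Rightarrow> complex) \<Rightarrow> real \<Rightarrow> complex" where
  "full_conv k D y x = (\<Sum>\<^sub>\<infinity>j\<in>D. y j * of_real (k (x - of_int j)))"

lemma finite_conv_eq: "finite_conv k J y x = (\<Sum>j\<in>J. y j * of_real (k (x - of_int j)))"
  by (simp add: finite_conv_def scaleR_conv_of_real mult.commute)

text \<open>Absolute convergence permits any exhaustion of \<open>D\<close> by finite sets; a
  sequence of them is what pointwise limits of measurable functions and Fatou's lemma
  require.\<close>

lemma finite_conv_tendsto_full_conv:
  assumes p: "1 < p" and y: "y \<in> ell_p p" and k: "\<And>x. (1 + \<bar>x\<bar>) * \<bar>k x\<bar> \<le> A"
  shows "(\<lambda>n. finite_conv k (D \<inter> {- int n..int n}) y x) \<longlonglongrightarrow> full_conv k D y x"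
proof -
  have "(\<lambda>j. y j * of_real (k (x - of_int j))) summable_on D"
    by (rule Infinite_Sum.abs_summable_summable[OF ell_p_convolution_summable[OF p y k]])
  then have "(sum (\<lambda>j. y j * of_real (k (x - of_int j))) \<longlongrightarrow> full_conv k D y x) (finite_subsets_at_top D)"
    unfolding full_conv_def by (simp add: has_sum_def[symmetric])
  moreover have "filterlim (\<lambda>n. D \<inter> {- int n..int n}) (finite_subsets_at_top D) sequentially"
    unfolding filterlim_finite_subsets_at_top
  proof (intro allI impI)
    fix X assume X: "finite X \<and> X \<subseteq> D"
    define M where "M = (\<Sum>j\<in>X. nat \<bar>j\<bar>)"
    have M: "nat \<bar>j\<bar> \<le> M" if "j \<in> X" for j
      unfolding M_def using X that by (intro member_le_sum) auto
    show "\<forall>\<^sub>F n in sequentially. finite (D \<inter> {- int n..int n}) \<and> X \<subseteq> D \<inter> {- int n..int n} \<and> D \<inter> {- int n..int n} \<subseteq> D"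
      using eventually_ge_at_top[of M]
    proof eventually_elim
      case (elim n)
      have "j \<in> {- int n..int n}" if "j \<in> X" for j using M[OF that] elim by auto
      then show ?case using X by auto
    qed
  qed
  ultimately show ?thesis unfolding finite_conv_eq by (rule filterlim_compose)
qed

lemma full_conv_measurable:
  assumes "1 < p" "y \<in> ell_p p" "\<And>x. (1 + \<bar>x\<bar>) * \<bar>k x\<bar> \<le> A" "k \<in> borel_measurable borel"
  shows "full_conv k D y \<in> borel_measurable borel"
  by (rule borel_measurable_LIMSEQ_metric[OF finite_conv_measurable finite_conv_tendsto_full_conv]) (use assms in auto)

text \<open>Fatou's lemma carries the bound for finite index sets over to arbitrary
  \<open>D\<close>, in particular to the complement of a finite set, where the right side is a
  tail.\<close>

lemma full_conv_bound:
  assumes p: "1 < p" and y: "y \<in> ell_p p" and k: "\<And>x. (1 + \<bar>x\<bar>) * \<bar>k x\<bar> \<le> A" and op: "conv_bounded p k B"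
  shows "(\<integral>\<^sup>+x. ennreal (norm (full_conv k D y x) powr p) \<partial>lborel) \<le> ennreal (B * (\<Sum>\<^sub>\<infinity>j\<in>D. norm (y j) powr p))"
proof -
  let ?k = "\<lambda>n. finite_conv k (D \<inter> {- int n..int n}) y"
  have [measurable]: "k \<in> borel_measurable borel" using op by (rule conv_bounded_measurable)
  have B: "0 \<le> B" using op by (simp add: conv_bounded_def)
  have ys: "(\<lambda>j. norm (y j) powr p) summable_on D"
    using y unfolding ell_p_def by (intro summable_on_subset[of _ UNIV D]) auto
  have fin: "(\<integral>\<^sup>+x. ennreal (norm (?k n x) powr p) \<partial>lborel) \<le> ennreal (B * (\<Sum>\<^sub>\<infinity>j\<in>D. norm (y j) powr p))" for n
  proof -
    have "(\<integral>\<^sup>+x. ennreal (norm (?k n x) powr p) \<partial>lborel) \<le> ennreal (B * (\<Sum>j\<in>D \<inter> {- int n..int n}. norm (y j) powr p))"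
      using op by (simp add: conv_bounded_def)
    also have "\<dots> \<le> ennreal (B * (\<Sum>\<^sub>\<infinity>j\<in>D. norm (y j) powr p))"
      using B by (intro ennreal_leI mult_left_mono finite_sum_le_infsum ys) auto
    finally show ?thesis .
  qed
  have "(\<integral>\<^sup>+x. ennreal (norm (full_conv k D y x) powr p) \<partial>lborel) = (\<integral>\<^sup>+x. liminf (\<lambda>n. ennreal (norm (?k n x) powr p)) \<partial>lborel)"
  proof (rule nn_integral_cong)
    fix x
    have "(\<lambda>n. ennreal (norm (?k n x) powr p)) \<longlonglongrightarrow> ennreal (norm (full_conv k D y x) powr p)"
    proof (rule tendsto_ennrealI, rule tendsto_powr')
      show "(\<lambda>n. norm (?k n x)) \<longlonglongrightarrow> norm (full_conv k D y x)"
        by (rule tendsto_norm[OF finite_conv_tendsto_full_conv[OF p y k]])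
    qed (use p in auto)
    then show "ennreal (norm (full_conv k D y x) powr p) = liminf (\<lambda>n. ennreal (norm (?k n x) powr p))"
      by (intro lim_imp_Liminf[symmetric]) auto
  qed
  also have "\<dots> \<le> liminf (\<lambda>n. \<integral>\<^sup>+x. ennreal (norm (?k n x) powr p) \<partial>lborel)"
    by (intro nn_integral_liminf) measurable
  also have "\<dots> \<le> ennreal (B * (\<Sum>\<^sub>\<infinity>j\<in>D. norm (y j) powr p))"
    using fin by (intro Liminf_le) auto
  finally show ?thesis .
qed

lemma full_conv_split:
  assumes p: "1 < p" and y: "y \<in> ell_p p" and k: "\<And>x. (1 + \<bar>x\<bar>) * \<bar>k x\<bar> \<le> A" and J: "finite J"
  shows "full_conv k UNIV y x = finite_conv k J y x + full_conv k (- J) y x"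
proof -
  have s: "(\<lambda>j. y j * of_real (k (x - of_int j))) summable_on D" for D
    by (rule Infinite_Sum.abs_summable_summable[OF ell_p_convolution_summable[OF p y k]])
  have "full_conv k UNIV y x = (\<Sum>\<^sub>\<infinity>j\<in>J \<union> - J. y j * of_real (k (x - of_int j)))" by (simp add: full_conv_def)
  also have "\<dots> = (\<Sum>\<^sub>\<infinity>j\<in>J. y j * of_real (k (x - of_int j))) + full_conv k (- J) y x"
    unfolding full_conv_def by (intro infsum_Un_disjoint s) auto
  finally show ?thesis using J by (simp add: finite_conv_eq)
qed

text \<open>A crude bound by Jensen and translation invariance, with a constant that grows with the
  size of \<open>J\<close>. This is harmless since \<open>J\<close> is fixed before \<open>c\<close>
  tends to infinity, and the bound sees \<open>k\<close> only through its L_p norm.\<close>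

lemma finite_conv_finite_bound:
  assumes p: "1 < p" and J: "finite J" and [measurable]: "k \<in> borel_measurable borel"
  shows "(\<integral>\<^sup>+x. ennreal (norm (finite_conv k J y x) powr p) \<partial>lborel)
    \<le> ennreal (real (card J) powr (p - 1) * (\<Sum>j\<in>J. norm (y j) powr p)) * (\<integral>\<^sup>+x. ennreal (\<bar>k x\<bar> powr p) \<partial>lborel)"
proof -
  let ?c = "real (card J) powr (p - 1)" and ?I = "\<integral>\<^sup>+x. ennreal (\<bar>k x\<bar> powr p) \<partial>lborel"
  have "norm (finite_conv k J y x) powr p \<le> (\<Sum>j\<in>J. (?c * norm (y j) powr p) * \<bar>k (x - of_int j)\<bar> powr p)" for x
  proof -
    have "norm (finite_conv k J y x) \<le> (\<Sum>j\<in>J. 1 * (norm (y j) * \<bar>k (x - of_int j)\<bar>))"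
      unfolding finite_conv_eq by (rule sum_norm_le) (simp add: norm_mult)
    then have "norm (finite_conv k J y x) powr p \<le> (\<Sum>j\<in>J. 1 * (norm (y j) * \<bar>k (x - of_int j)\<bar>)) powr p"
      using p by (intro powr_mono2) auto
    also have "\<dots> \<le> (\<Sum>j\<in>J. 1) powr (p - 1) * (\<Sum>j\<in>J. 1 * (norm (y j) * \<bar>k (x - of_int j)\<bar>) powr p)"
      using p J by (intro powr_sum_weighted_le) auto
    also have "\<dots> = (\<Sum>j\<in>J. (?c * norm (y j) powr p) * \<bar>k (x - of_int j)\<bar> powr p)"
      by (simp add: powr_mult sum_distrib_left mult.assoc)
    finally show ?thesis .
  qed
  then have "(\<integral>\<^sup>+x. ennreal (norm (finite_conv k J y x) powr p) \<partial>lborel) \<le> (\<integral>\<^sup>+x. (\<Sum>j\<in>J. ennreal (?c * norm (y j) powr p) * ennreal (\<bar>k (x - of_int j)\<bar> powr p)) \<partial>lborel)"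
    by (intro nn_integral_mono) (simp add: ennreal_mult'[symmetric] sum_ennreal ennreal_leI)
  also have "\<dots> = (\<Sum>j\<in>J. ennreal (?c * norm (y j) powr p) * (\<integral>\<^sup>+x. ennreal (\<bar>k (x - of_int j)\<bar> powr p) \<partial>lborel))"
    by (subst nn_integral_sum) (auto simp: nn_integral_cmult)
  also have "\<dots> = (\<Sum>j\<in>J. ennreal (?c * norm (y j) powr p) * ?I)"
  proof (intro sum.cong refl)
    fix j :: int
    have "?I = (\<integral>\<^sup>+x. ennreal (\<bar>k (- of_int j + 1 * x)\<bar> powr p) \<partial>lborel)"
      using nn_integral_real_affine[of "\<lambda>x. ennreal (\<bar>k x\<bar> powr p)" 1 "- of_int j"] by simp
    then show "ennreal (?c * norm (y j) powr p) * (\<integral>\<^sup>+x. ennreal (\<bar>k (x - of_int j)\<bar> powr p) \<partial>lborel) = ennreal (?c * norm (y j) powr p) * ?I"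
      by simp
  qed
  also have "\<dots> = ennreal (?c * (\<Sum>j\<in>J. norm (y j) powr p)) * ?I"
    by (simp add: sum_distrib_right[symmetric] sum_ennreal sum_distrib_left)
  finally show ?thesis .
qed

text \<open>The decay hypothesis dominates by A^p (1 + |x|)^(-p), integrable as p > 1, and
  \<open>e\<close> gives pointwise convergence. Writing \<open>max 1 c\<close> makes the integral
  meaningful for every \<open>c\<close> although the hypotheses speak of c \<ge> 1.\<close>

lemma kernel_Lp_tendsto_0:
  fixes k :: "real \<Rightarrow> real \<Rightarrow> real"
  assumes p: "1 < p" and meas: "\<And>c. 1 \<le> c \<Longrightarrow> k c \<in> borel_measurable borel"
    and k: "\<And>c x. 1 \<le> c \<Longrightarrow> (1 + \<bar>x\<bar>) * \<bar>k c x\<bar> \<le> A"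
    and e: "\<And>c x. 1 \<le> c \<Longrightarrow> \<bar>k c x\<bar> \<le> e c" "(e \<longlongrightarrow> 0) at_top"
  shows "((\<lambda>c. LINT x|lborel. \<bar>k (max 1 c) x\<bar> powr p) \<longlongrightarrow> 0) at_top"
    and "\<And>c. 1 \<le> c \<Longrightarrow> integrable lborel (\<lambda>x. \<bar>k c x\<bar> powr p)"
proof -
  have A: "0 \<le> A" using k[of 1 0] by (smt (verit) abs_ge_zero mult_nonneg_nonneg)
  have dom: "\<bar>k c x\<bar> powr p \<le> A powr p * (1 / (1 + \<bar>x\<bar>)) powr p" if "1 \<le> c" for c x
  proof -
    have "\<bar>k c x\<bar> \<le> A * (1 / (1 + \<bar>x\<bar>))" using k[OF that, of x] by (simp add: field_simps)
    then have "\<bar>k c x\<bar> powr p \<le> (A * (1 / (1 + \<bar>x\<bar>))) powr p" using p by (intro powr_mono2) auto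
    also have "\<dots> = A powr p * (1 / (1 + \<bar>x\<bar>)) powr p" by (rule powr_mult)
    finally show ?thesis .
  qed
  have int: "integrable lborel (\<lambda>x. A powr p * (1 / (1 + \<bar>x\<bar>)) powr p)"
    by (intro integrable_mult_right real_decay_integrable p)
  have m: "(\<lambda>x. \<bar>k c x\<bar> powr p) \<in> borel_measurable lborel" if "1 \<le> c" for c
  proof -
    note meas[OF that, measurable]
    show ?thesis by measurable
  qed
  have "((\<lambda>c. LINT x|lborel. \<bar>k (max 1 c) x\<bar> powr p) \<longlongrightarrow> integral\<^sup>L lborel (\<lambda>x::real. 0 :: real)) at_top"
  proof (rule integral_dominated_convergence_at_top[where s = "\<lambda>c x. \<bar>k (max 1 c) x\<bar> powr p" and f = "\<lambda>_. 0" and w = "\<lambda>x. A powr p * (1 / (1 + \<bar>x\<bar>)) powr p"])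
    show "\<forall>\<^sub>F c in at_top. AE x in lborel. norm (\<bar>k (max 1 c) x\<bar> powr p) \<le> A powr p * (1 / (1 + \<bar>x\<bar>)) powr p"
      using dom by (intro always_eventually allI AE_I2) simp
    show "AE x in lborel. ((\<lambda>c. \<bar>k (max 1 c) x\<bar> powr p) \<longlongrightarrow> 0) at_top"
    proof (rule AE_I2)
      fix x
      have "((\<lambda>c. \<bar>k (max 1 c) x\<bar>) \<longlongrightarrow> 0) at_top"
      proof (rule Lim_null_comparison[OF _ e(2)])
        show "\<forall>\<^sub>F c in at_top. norm \<bar>k (max 1 c) x\<bar> \<le> e c"
          using eventually_ge_at_top[of 1] by eventually_elim (use e(1) in \<open>simp add: max_def\<close>)
      qed
      then show "((\<lambda>c. \<bar>k (max 1 c) x\<bar> powr p) \<longlongrightarrow> 0) at_top"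
        using p by (intro tendsto_zero_powrI[where b = p]) auto
    qed
  qed (use m int in auto)
  then show "((\<lambda>c. LINT x|lborel. \<bar>k (max 1 c) x\<bar> powr p) \<longlongrightarrow> 0) at_top" by simp
  show "integrable lborel (\<lambda>x. \<bar>k c x\<bar> powr p)" if c: "1 \<le> c" for c
    by (rule Bochner_Integration.integrable_bound[OF int m[OF c]]) (use dom[OF c] A in auto)
qed

text \<open>A finite \<open>J\<close> leaves a tail that the uniform bound \<open>B\<close> makes
  small for all c \<ge> 1 at once; on \<open>J\<close> the L_p norm of the kernel tends to
  0.\<close>

lemma full_conv_Lp_small:
  fixes k :: "real \<Rightarrow> real \<Rightarrow> real" and \<epsilon> :: real
  assumes p: "1 < p" and y: "y \<in> ell_p p" and op: "\<And>c. 1 \<le> c \<Longrightarrow> conv_bounded p (k c) B"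
    and k: "\<And>c x. 1 \<le> c \<Longrightarrow> (1 + \<bar>x\<bar>) * \<bar>k c x\<bar> \<le> A"
    and e: "\<And>c x. 1 \<le> c \<Longrightarrow> \<bar>k c x\<bar> \<le> e c" "(e \<longlongrightarrow> 0) at_top"
    and \<epsilon>: "0 < \<epsilon>"
  shows "\<forall>\<^sub>F c in at_top. (\<integral>\<^sup>+x. ennreal (norm (full_conv (k c) UNIV y x) powr p) \<partial>lborel) \<le> ennreal \<epsilon>"
proof -
  let ?y = "\<lambda>j. norm (y j) powr p"
  have B: "0 \<le> B" using op[of 1] by (simp add: conv_bounded_def)
  have ys: "?y summable_on UNIV" using y by (simp add: ell_p_def)
  \<comment> \<open>Each of the two parts is to be at most
    \<open>\<epsilon> / (2 * 2 powr p)\<close>, before the factor \<open>2 powr p\<close> of the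
    splitting; adding 1 avoids division by 0.\<close>
  define \<delta> where "\<delta> = \<epsilon> / (2 * 2 powr p * (B + 1))"
  have \<delta>: "0 < \<delta>" using \<epsilon> B by (simp add: \<delta>_def)
  obtain J where J: "finite J" "infsum ?y (- J) \<le> \<delta>"
  proof -
    have "(sum ?y \<longlongrightarrow> infsum ?y UNIV) (finite_subsets_at_top UNIV)"
      using ys by (simp add: has_sum_def[symmetric])
    then have "\<forall>\<^sub>F J in finite_subsets_at_top UNIV. dist (sum ?y J) (infsum ?y UNIV) < \<delta>"
      using \<delta> by (rule tendstoD)
    then obtain J where J: "finite J" "dist (sum ?y J) (infsum ?y UNIV) < \<delta>"
      unfolding eventually_finite_subsets_at_top by blast
    have "infsum ?y UNIV = infsum ?y (J \<union> - J)" by simp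
    also have "\<dots> = infsum ?y J + infsum ?y (- J)"
      by (intro infsum_Un_disjoint summable_on_subset[OF ys]) auto
    finally have "infsum ?y (- J) \<le> \<delta>" using J by (simp add: dist_real_def)
    with J(1) show ?thesis by (rule that)
  qed
  define I where "I c = (LINT x|lborel. \<bar>k (max 1 c) x\<bar> powr p)" for c
  define M where "M = real (card J) powr (p - 1) * (\<Sum>j\<in>J. ?y j)"
  have M: "0 \<le> M" by (simp add: M_def sum_nonneg)
  have meas: "k c \<in> borel_measurable borel" if "1 \<le> c" for c using op[OF that] by (rule conv_bounded_measurable)
  have I0: "(I \<longlongrightarrow> 0) at_top" unfolding I_def[abs_def] by (rule kernel_Lp_tendsto_0(1)[OF p meas k e])
  have "\<forall>\<^sub>F c in at_top. I c < \<epsilon> / (2 * 2 powr p * (M + 1))"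
    using \<epsilon> M by (intro order_tendstoD(2)[OF I0]) auto
  then show ?thesis using eventually_ge_at_top[of 1]
  proof eventually_elim
    case (elim c)
    note c = elim(2)
    have [measurable]: "k c \<in> borel_measurable borel" by (rule meas[OF c])
    have [measurable]: "full_conv (k c) (- J) y \<in> borel_measurable borel" by (rule full_conv_measurable[OF p y k[OF c]]) measurable
    have Ic: "(\<integral>\<^sup>+x. ennreal (\<bar>k c x\<bar> powr p) \<partial>lborel) = ennreal (I c)"
      using c kernel_Lp_tendsto_0(2)[OF p meas k e c] by (simp add: I_def max_def nn_integral_eq_integral)
    have I0: "0 \<le> I c" by (simp add: I_def)
    have "norm (full_conv (k c) UNIV y x) powr p \<le> 2 powr p * (norm (finite_conv (k c) J y x) powr p + norm (full_conv (k c) (- J) y x) powr p)" for x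
    proof -
      have "norm (full_conv (k c) UNIV y x) powr p \<le> (norm (finite_conv (k c) J y x) + norm (full_conv (k c) (- J) y x)) powr p"
        unfolding full_conv_split[OF p y k[OF c] J(1)] using p by (intro powr_mono2 norm_triangle_ineq) auto
      also have "\<dots> \<le> 2 powr p * (norm (finite_conv (k c) J y x) powr p + norm (full_conv (k c) (- J) y x) powr p)"
        using p by (intro powr_sum_le) auto
      finally show ?thesis .
    qed
    then have "(\<integral>\<^sup>+x. ennreal (norm (full_conv (k c) UNIV y x) powr p) \<partial>lborel)
       \<le> (\<integral>\<^sup>+x. ennreal (2 powr p) * (ennreal (norm (finite_conv (k c) J y x) powr p) + ennreal (norm (full_conv (k c) (- J) y x) powr p)) \<partial>lborel)"
      by (intro nn_integral_mono) (simp add: ennreal_mult'[symmetric] ennreal_plus[symmetric] ennreal_leI del: ennreal_plus)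
    also have "\<dots> = ennreal (2 powr p) * ((\<integral>\<^sup>+x. ennreal (norm (finite_conv (k c) J y x) powr p) \<partial>lborel) + (\<integral>\<^sup>+x. ennreal (norm (full_conv (k c) (- J) y x) powr p) \<partial>lborel))"
      by (subst nn_integral_cmult, measurable) (subst nn_integral_add, auto)
    also have "\<dots> \<le> ennreal (2 powr p) * (ennreal M * ennreal (I c) + ennreal (B * infsum ?y (- J)))"
      unfolding Ic[symmetric] M_def
      by (intro mult_left_mono add_mono finite_conv_finite_bound full_conv_bound[OF p y k[OF c] op[OF c]] p J(1)) auto
    also have "\<dots> = ennreal (2 powr p * (M * I c + B * infsum ?y (- J)))"
    proof -
      have "0 \<le> infsum ?y (- J)" by (intro infsum_nonneg) auto
      then show ?thesis using M I0 B by (simp add: ennreal_mult ennreal_plus)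
    qed
    also have "\<dots> \<le> ennreal \<epsilon>"
    proof (rule ennreal_leI)
      have "M * I c \<le> (M + 1) * (\<epsilon> / (2 * 2 powr p * (M + 1)))"
        using elim(1) M I0 by (intro mult_mono) auto
      also have "\<dots> = \<epsilon> / (2 * 2 powr p)" using M by simp
      finally have 1: "M * I c \<le> \<epsilon> / (2 * 2 powr p)" .
      have "B * infsum ?y (- J) \<le> (B + 1) * \<delta>" using J(2) B \<delta> by (intro mult_mono) (auto intro: infsum_nonneg)
      also have "\<dots> = \<epsilon> / (2 * 2 powr p)" using B by (simp add: \<delta>_def)
      finally have "B * infsum ?y (- J) \<le> \<epsilon> / (2 * 2 powr p)" .
      with 1 have "2 powr p * (M * I c + B * infsum ?y (- J)) \<le> 2 powr p * (\<epsilon> / (2 * 2 powr p) + \<epsilon> / (2 * 2 powr p))"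
        by (intro mult_left_mono add_mono) auto
      also have "\<dots> = \<epsilon>" by (simp add: field_simps)
      finally show "2 powr p * (M * I c + B * infsum ?y (- J)) \<le> \<epsilon>" .
    qed
    finally show ?case .
  qed
qed

text \<open>Dominated convergence with a majorant independent of \<open>c\<close>. Pointwise, off
  the multiples of \<pi>, the error below \<pi> is bounded by \<open>one_minus_symb\<close> and
  above \<pi> by \<open>symb_decay\<close>, both exponentially small in \<open>c\<close>. At the
  jump itself nothing is claimed.\<close>

lemma symb_error_tendsto_0:
  fixes G :: "real \<Rightarrow> real \<Rightarrow> real" and m :: real
  assumes G: "\<And>c. 1 \<le> c \<Longrightarrow> cardinal_symbol (G c) m c"
  shows "((\<lambda>c. cardinal_symbol.symb_error (G (max 1 c))) \<longlongrightarrow> 0) at_top"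
proof -
  define s where "s c \<xi> = \<bar>cardinal_symbol.symb_pos (G (max 1 c)) \<xi> - indicator {0..pi} \<xi>\<bar>" for c \<xi> :: real
  have G': "cardinal_symbol (G (max 1 c)) m (max 1 c)" for c by (rule G) simp
  have m: "0 \<le> m" using G'[of 1] by (rule cardinal_symbol.m)
  have meas: "(\<lambda>\<xi>. s c \<xi>) \<in> borel_measurable lborel" for c
  proof -
    note cardinal_symbol.symb_pos_measurable[OF G', measurable]
    show ?thesis unfolding s_def by measurable
  qed
  have "((\<lambda>c. integral\<^sup>L lborel (s c)) \<longlongrightarrow> integral\<^sup>L lborel (\<lambda>\<xi>::real. 0 :: real)) at_top"
  proof (rule integral_dominated_convergence_at_top[where w = "\<lambda>\<xi>. majorant m \<xi> + indicator {0..pi} \<xi>"])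
    show "integrable lborel (\<lambda>\<xi>. majorant m \<xi> + indicat_real {0..pi} \<xi>)"
      by (intro Bochner_Integration.integrable_add majorant_integrable[OF m] integrable_real_indicator) auto
    show "\<forall>\<^sub>F c in at_top. AE \<xi> in lborel. norm (s c \<xi>) \<le> majorant m \<xi> + indicator {0..pi} \<xi>"
    proof (intro always_eventually allI AE_I2)
      fix c \<xi> :: real
      show "norm (s c \<xi>) \<le> majorant m \<xi> + indicator {0..pi} \<xi>"
        using cardinal_symbol.symb_pos_bounds[OF G', of c \<xi>] by (auto simp: s_def indicator_def)
    qed
    have "countable (range (\<lambda>n. pi * real n))" by simp
    from AE_not_in[OF countable_imp_null_set_lborel[OF this]]
    show "AE \<xi> in lborel. ((\<lambda>c. s c \<xi>) \<longlongrightarrow> 0) at_top"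
    proof eventually_elim
      case (elim \<xi>)
      show ?case
      proof (cases "0 < \<xi>")
        case False
        then have "\<xi> \<notin> (\<Union>n. piece n)" using piece_pos by blast
        moreover have "\<xi> \<noteq> 0" using elim by (metis mult_zero_right of_nat_0 rangeI)
        ultimately have "s c \<xi> = 0" for c using False cardinal_symbol.symb_pos_def[OF G'] by (simp add: s_def)
        then show ?thesis by simp
      next
        case True
        have pc: "\<xi> \<in> (\<Union>n. piece n)" by (rule piece_cover[OF True elim])
        then have gen: "generic \<xi>" using piece_generic by blast
        have sp: "cardinal_symbol.symb_pos (G (max 1 c)) \<xi> = symb (G (max 1 c)) \<xi>" for c
          using pc cardinal_symbol.symb_pos_def[OF G', of c \<xi>] by simp
        have npi: "\<xi> \<noteq> pi" using elim by (metis mult.right_neutral of_nat_1 rangeI)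
        show ?thesis
        proof (cases "\<xi> < pi")
          case lt: True
          define K where "K = (pi / \<xi>) powr m * exp (\<xi> - pi) * (\<Sum>\<^sub>\<infinity>j\<in>-{0::int}. tail_profile m \<bar>\<xi> + 2 * pi * of_int j\<bar>)"
          show ?thesis
          proof (rule Lim_null_comparison)
            have "((\<lambda>c. exp (- (c - 1) * (2 * (pi - \<xi>)))) \<longlongrightarrow> 0) at_top"
              using lt by real_asymp
            from tendsto_mult_right[OF this, of K]
            show "((\<lambda>c. exp (- (c - 1) * (2 * (pi - \<xi>))) * K) \<longlongrightarrow> 0) at_top" by simp
            show "\<forall>\<^sub>F c in at_top. norm (s c \<xi>) \<le> exp (- (c - 1) * (2 * (pi - \<xi>))) * K"
              using eventually_ge_at_top[of 1]
            proof eventually_elim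
              case (elim c)
              have "norm (s c \<xi>) = 1 - symb (G (max 1 c)) \<xi>"
                using cardinal_symbol.symb_le_1[OF G' gen, of c] lt True by (simp add: s_def sp)
              also have "\<dots> \<le> exp (- (c - 1) * (2 * (pi - \<xi>))) * K"
                using cardinal_symbol.one_minus_symb[OF G' gen True lt, of c] elim by (simp add: K_def max_def)
              finally show ?case .
            qed
          qed
        next
          case False
          then have gt: "pi < \<xi>" using npi by simp
          show ?thesis
          proof (rule Lim_null_comparison)
            have "((\<lambda>c. exp (- c * (\<xi> - pi))) \<longlongrightarrow> 0) at_top"
              using gt by real_asymp
            from tendsto_mult_left[OF this, of "(\<xi> / pi) powr m"]
            show "((\<lambda>c. (\<xi> / pi) powr m * exp (- c * (\<xi> - pi))) \<longlongrightarrow> 0) at_top" by simp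
            show "\<forall>\<^sub>F c in at_top. norm (s c \<xi>) \<le> (\<xi> / pi) powr m * exp (- c * (\<xi> - pi))"
              using eventually_ge_at_top[of 1]
            proof eventually_elim
              case (elim c)
              have "norm (s c \<xi>) = symb (G (max 1 c)) \<xi>"
                using cardinal_symbol.symb_nonneg[OF G' gen, of c] gt by (simp add: s_def sp)
              also have "\<dots> \<le> (\<xi> / pi) powr m * exp (- c * (\<xi> - pi))"
                using cardinal_symbol.symb_decay[OF G' gen, of c] gt elim by (simp add: max_def)
              finally show ?case .
            qed
          qed
        qed
      qed
    qed
  qed (use meas in auto)
  then show ?thesis unfolding s_def[abs_def] cardinal_symbol.symb_error_def[OF G'] by simp
qed

section \<open>Conclusion from the uniform bound and the convergence of the kernels\<close>

lemma conv_bounded_sinc: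
  assumes "1 < p" "0 \<le> C" "\<And>t. 0 \<le> t \<Longrightarrow> conv_bounded p (dirichlet t) (C * (1 + t) powr p)"
  shows "conv_bounded p (\<lambda>x. sinc (pi * x)) (\<bar>1 / pi\<bar> powr p * (C * (1 + pi) powr p))"
proof -
  have "(\<lambda>x. 1 / pi * dirichlet pi x) = (\<lambda>x. sinc (pi * x))" by (auto simp: dirichlet_def)
  then show ?thesis using conv_bounded_cmult[OF assms(3)[of pi], of "1 / pi"] by simp
qed

theorem theorem25:
  fixes p \<alpha> :: real and y :: "int \<Rightarrow> complex"
  assumes "1 < p"
    and "y \<in> ell_p p"
    and "\<alpha> \<in> {..< -3/2} \<union> ({1/2..} - \<nat>)"
  shows "((\<lambda>c::real. Lp_norm p (\<lambda>x. cardinal_interpolant \<alpha> c y x - whittaker y x)) \<longlongrightarrow> 0) at_top"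
proof -
  note p = assms(1) and y = assms(2)
  have \<alpha>: "\<alpha> \<notin> \<nat>" using assms(3) by (auto elim!: Nats_cases)
  define m where "m = max 0 (- (\<alpha> + 1/2))"
  define G where "G = mq_profile (\<alpha> + 1/2)"
  have G: "cardinal_symbol (G c) m c" if "1 \<le> c" for c
    unfolding G_def m_def by (rule mq_profile_cardinal_symbol[OF that])
  obtain C where C: "0 \<le> C" "\<And>t. 0 \<le> t \<Longrightarrow> conv_bounded p (dirichlet t) (C * (1 + t) powr p)"
    using conv_bounded_dirichlet[OF p] by blast
  define k where "k c x = cardinal_symbol.fundamental_kernel (G c) x - sinc (pi * x)" for c x
  define e where "e c = (1 / pi) * cardinal_symbol.symb_error (G (max 1 c))" for c
  \<comment> \<open>Bounds |k| and |x| |k| separately: the first summand uses the L_1 majorant of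
    the error, the others the decay of the fundamental kernel and of sinc.\<close>
  define A where "A = (1 / pi) * ((LINT \<xi>|lborel. majorant m \<xi> + indicat_real {0..pi} \<xi>)) + ((1 / pi) * (4 * (\<Sum>n. piece_bound m n)) + 1 / pi)"
  \<comment> \<open>\<open>B\<close> can be chosen before \<open>c\<close> because both operator
    bounds depend only on p, C and m.\<close>
  obtain B where op: "\<And>c. 1 \<le> c \<Longrightarrow> conv_bounded p (k c) B"
    unfolding k_def using conv_bounded_diff[OF cardinal_symbol.fundamental_kernel_conv_bounded[OF G p C] conv_bounded_sinc[OF p C] p] by blast
  have m: "0 \<le> m" by (simp add: m_def)
  have sinc_decay: "\<bar>x\<bar> * \<bar>sinc (pi * x)\<bar> \<le> 1 / pi" for x
  proof -
    have "\<bar>x\<bar> * \<bar>sinc (pi * x)\<bar> = (1 / pi) * (\<bar>x\<bar> * \<bar>dirichlet pi x\<bar>)" by (simp add: dirichlet_def abs_mult)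
    also have "\<dots> \<le> (1 / pi) * 1" using dirichlet_decay[of x pi] by (intro mult_left_mono) auto
    finally show ?thesis by simp
  qed
  have e1: "\<bar>k c x\<bar> \<le> e c" if c: "1 \<le> c" for c x
    using cardinal_symbol.fundamental_kernel_sinc_error[OF G[OF c], of x] c unfolding k_def e_def by (simp only: max_absorb2)
  have e0: "(e \<longlongrightarrow> 0) at_top"
    unfolding e_def[abs_def] using tendsto_mult_left[OF symb_error_tendsto_0[of G m, OF G], of "1 / pi"] by simp
  have eA: "e c \<le> (1 / pi) * (LINT \<xi>|lborel. majorant m \<xi> + indicat_real {0..pi} \<xi>)" for c
    unfolding e_def
  proof (rule mult_left_mono)
    have G': "cardinal_symbol (G (max 1 c)) m (max 1 c)" by (rule G) simp
    show "cardinal_symbol.symb_error (G (max 1 c)) \<le> (LINT \<xi>|lborel. majorant m \<xi> + indicat_real {0..pi} \<xi>)"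
      unfolding cardinal_symbol.symb_error_def[OF G']
    proof (rule integral_mono')
      show "integrable lborel (\<lambda>\<xi>. majorant m \<xi> + indicat_real {0..pi} \<xi>)"
        by (intro Bochner_Integration.integrable_add majorant_integrable[OF m] integrable_real_indicator) auto
      show "\<bar>cardinal_symbol.symb_pos (G (max 1 c)) \<xi> - indicat_real {0..pi} \<xi>\<bar> \<le> majorant m \<xi> + indicat_real {0..pi} \<xi>" for \<xi>
        using cardinal_symbol.symb_pos_bounds[OF G', of \<xi>] by (auto simp: indicator_def)
      show "0 \<le> majorant m \<xi> + indicat_real {0..pi} \<xi>" for \<xi> using majorant_nonneg by simp
    qed
  qed simp
  have kA: "(1 + \<bar>x\<bar>) * \<bar>k c x\<bar> \<le> A" if c: "1 \<le> c" for c x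
  proof -
    have "\<bar>x\<bar> * \<bar>k c x\<bar> \<le> \<bar>x\<bar> * (\<bar>cardinal_symbol.fundamental_kernel (G c) x\<bar> + \<bar>sinc (pi * x)\<bar>)"
      unfolding k_def by (intro mult_left_mono abs_triangle_ineq4) auto
    also have "\<dots> = \<bar>x\<bar> * \<bar>cardinal_symbol.fundamental_kernel (G c) x\<bar> + \<bar>x\<bar> * \<bar>sinc (pi * x)\<bar>" by (rule distrib_left)
    also have "\<dots> \<le> (1 / pi) * (4 * (\<Sum>n. piece_bound m n)) + 1 / pi"
      by (intro add_mono sinc_decay cardinal_symbol.fundamental_kernel_decay[OF G[OF c] p C])
    finally have "\<bar>x\<bar> * \<bar>k c x\<bar> \<le> (1 / pi) * (4 * (\<Sum>n. piece_bound m n)) + 1 / pi" .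
    moreover have "\<bar>k c x\<bar> \<le> (1 / pi) * (LINT \<xi>|lborel. majorant m \<xi> + indicat_real {0..pi} \<xi>)"
      using e1[OF c, of x] eA[of c] by (rule order_trans)
    ultimately have "\<bar>k c x\<bar> + \<bar>x\<bar> * \<bar>k c x\<bar> \<le> A" unfolding A_def by (intro add_mono)
    then show ?thesis by (simp add: distrib_right)
  qed
  \<comment> \<open>Both series converge absolutely, so they may be subtracted termwise; the decay
    of the fundamental kernel is recovered from that of \<open>k\<close> and of sinc.\<close>
  have eq: "cardinal_interpolant \<alpha> c y x - whittaker y x = full_conv (k c) UNIV y x" if c: "1 \<le> c" for c x
  proof -
    have sd: "(1 + \<bar>u\<bar>) * \<bar>sinc (pi * u)\<bar> \<le> 1 + 1 / pi" for u
      using sinc_decay[of u] abs_sinc_le[of "pi * u"] by (simp only: distrib_right mult_1_left add_mono)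
    have fd: "(1 + \<bar>u\<bar>) * \<bar>cardinal_symbol.fundamental_kernel (G c) u\<bar> \<le> A + (1 + 1 / pi)" for u
    proof -
      have "\<bar>cardinal_symbol.fundamental_kernel (G c) u\<bar> \<le> \<bar>k c u\<bar> + \<bar>sinc (pi * u)\<bar>" unfolding k_def by linarith
      then have "(1 + \<bar>u\<bar>) * \<bar>cardinal_symbol.fundamental_kernel (G c) u\<bar> \<le> (1 + \<bar>u\<bar>) * (\<bar>k c u\<bar> + \<bar>sinc (pi * u)\<bar>)"
        by (intro mult_left_mono) auto
      also have "\<dots> \<le> A + (1 + 1 / pi)" unfolding distrib_left[of "1 + \<bar>u\<bar>"] by (intro add_mono kA[OF c] sd)
      finally show ?thesis .
    qed
    note s1 = Infinite_Sum.abs_summable_summable[OF ell_p_convolution_summable[OF p y fd]]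
    note s2 = Infinite_Sum.abs_summable_summable[OF ell_p_convolution_summable[OF p y sd]]
    have "cardinal_interpolant \<alpha> c y x - whittaker y x =
      (\<Sum>\<^sub>\<infinity>j\<in>UNIV. y j * of_real (cardinal_symbol.fundamental_kernel (G c) (x - of_int j))) - (\<Sum>\<^sub>\<infinity>j\<in>UNIV. y j * of_real (sinc (pi * (x - of_int j))))"
      unfolding cardinal_interpolant_def whittaker_def fundamental_function_eq[OF c \<alpha>] G_def ..
    also have "\<dots> = (\<Sum>\<^sub>\<infinity>j\<in>UNIV. y j * of_real (cardinal_symbol.fundamental_kernel (G c) (x - of_int j)) - y j * of_real (sinc (pi * (x - of_int j))))"
      using infsum_add[OF s1 summable_on_uminus[THEN iffD2, OF s2]]
      by (simp only: infsum_uminus add_uminus_conv_diff)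
    also have "\<dots> = full_conv (k c) UNIV y x"
      unfolding full_conv_def k_def of_real_diff right_diff_distrib ..
    finally show ?thesis .
  qed
  have small: "\<forall>\<^sub>F c in at_top. (\<integral>\<^sup>+x. ennreal (norm (full_conv (k c) UNIV y x) powr p) \<partial>lborel) \<le> ennreal \<epsilon>" if "0 < \<epsilon>" for \<epsilon>
    by (rule full_conv_Lp_small[OF p y op kA e1 e0 that])
  define R where "R c = (LINT x|lborel. norm (full_conv (k c) UNIV y x) powr p)" for c
  have R: "0 \<le> R c \<and> R c \<le> \<epsilon> \<and> integrable lborel (\<lambda>x. norm (full_conv (k c) UNIV y x) powr p)"
    if N: "(\<integral>\<^sup>+x. ennreal (norm (full_conv (k c) UNIV y x) powr p) \<partial>lborel) \<le> ennreal \<epsilon>" and c: "1 \<le> c" and e: "0 < \<epsilon>" for c \<epsilon>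
  proof -
    have [measurable]: "full_conv (k c) UNIV y \<in> borel_measurable borel"
      by (rule full_conv_measurable[OF p y kA[OF c] conv_bounded_measurable[OF op[OF c]]])
    have int: "integrable lborel (\<lambda>x. norm (full_conv (k c) UNIV y x) powr p)"
      using le_less_trans[OF N ennreal_less_top] by (intro integrableI_nonneg) auto
    have "ennreal (R c) \<le> ennreal \<epsilon>" using N int by (simp add: R_def nn_integral_eq_integral)
    then show ?thesis using int e by (simp add: R_def)
  qed
  have R_nonneg: "0 \<le> R c" for c by (simp add: R_def)
  have "(R \<longlongrightarrow> 0) at_top"
  proof (rule tendstoI)
    fix \<epsilon> :: real assume "0 < \<epsilon>"
    then have e2: "0 < \<epsilon> / 2" by simp
    show "\<forall>\<^sub>F c in at_top. dist (R c) 0 < \<epsilon>"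
      using small[OF e2] eventually_ge_at_top[of 1]
    proof eventually_elim
      case (elim c)
      then show ?case using R[OF elim e2] \<open>0 < \<epsilon>\<close> by (simp add: dist_real_def)
    qed
  qed
  then have "((\<lambda>c. R c powr (1 / p)) \<longlongrightarrow> 0) at_top"
    using p by (intro tendsto_zero_powrI[where b = "1 / p"]) (auto simp: R_nonneg)
  then have lim: "((\<lambda>c. ennreal (R c powr (1 / p))) \<longlongrightarrow> 0) at_top"
    using tendsto_ennrealI[of "\<lambda>c. R c powr (1 / p)" 0 at_top] by simp
  \<comment> \<open>Eventually the integral is finite, so \<open>Lp_norm\<close> takes its finite
    branch and equals the p-th root of \<open>R c\<close>.\<close>
  have "\<forall>\<^sub>F c in at_top. ennreal (R c powr (1 / p)) = Lp_norm p (\<lambda>x. cardinal_interpolant \<alpha> c y x - whittaker y x)"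
    using small[OF zero_less_one] eventually_ge_at_top[of 1]
  proof eventually_elim
    case (elim c)
    have "full_conv (k c) UNIV y \<in> borel_measurable lborel"
      using full_conv_measurable[OF p y kA[OF elim(2)] conv_bounded_measurable[OF op[OF elim(2)]]] by simp
    then show ?case
      unfolding eq[OF elim(2)] Lp_norm_def using R[OF elim zero_less_one] by (simp add: R_def)
  qed
  from tendsto_cong[OF this] lim show ?thesis by blast
qed

end
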